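(* Let $G$ be a group acting on a non-empty set $S$, and let $K=\ker(G\curvearrowright S)$. If the abstract twisted Brin--Thompson group $SV_G$ is finitely presented, then the simple group $SV_{G/K}$ (for the induced faithful action of $G/K$ on $S$) is finitely presented if and only if $G/K$ is finitely presented.
   Context: Abstract twisted Brin--Thompson groups. Let $G$ act on the left on a non-empty set $S$ (not necessarily faithfully). Let $C=\{0,1\}^{\mathbb N}$ be the Cantor set, $C^S$ the space of functions $S\to C$ with the product topology, and $C^S(m)$ the disjoint union of $m$ copies of $C^S$ ($m\ge 1$). For $\psi\colon S\to\{0,1\}^*$ (finite words) with $\psi(s)$ empty for all but finitely many $s$, the dyadic brick $B(\psi)$ is $\{\kappa\in C^S\mid \psi(s)\text{ is a prefix of }\kappa(s)\ \forall s\}$, with canonical homeomorphism $h_\psi\colon C^S\to B(\psi)$, $h_\psi(\kappa)(s)=\psi(s)\cdot\kappa(s)$. The Brin--Thompson groupoid $S\mathcal V$ consists of all homeomorphisms $C^S(m)\to C^S(n)$ obtained by partitioning domain and range into the same finite number of dyadic bricks (inside the copies of $C^S$) and mapping domain bricks to range bricks via canonical homeomorphisms $h_\varphi\circ h_\psi^{-1}$. It contains, for $s\in S$, the simple split $x_s\colon C^S\to C^S(2)$ (sending the half where $\kappa(s)$ starts with $0$, resp. $1$, to the first, resp. second, copy by deleting that first letter of $\kappa(s)$), and for $\sigma\in\Sigma_n$ the permutation $p_\sigma$ of the copies in $C^S(n)$ (copy $i$ goes to copy $\sigma(i)$); it has an obvious direct sum $\oplus$ (juxtaposition). The groupoid $S\mathcal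 V_G$ has objects the positive integers and is generated by $S\mathcal V$ together with, for each $n$, a copy of $G^n$ based at the object $n$ (with $(g_1,\dots,g_n)$ also written $g_1\oplus\cdots\oplus g_n$), subject to the set of relations that is closed under compositions and direct sums and contains $x_{g.s}\circ g=(g\oplus g)\circ x_s$ for $s\in S,g\in G$, and $(g_1\oplus\cdots\oplus g_n)\circ p_\sigma=p_\sigma\circ(g_{\sigma(1)}\oplus\cdots\oplus g_{\sigma(n)})$ for $\sigma\in\Sigma_n$, $g_i\in G$. The group $SV_G$ is the group of morphisms of $S\mathcal V_G$ from the object $1$ to itself. (Equivalently, letting $G$ act on $C^S$ by $(g\kappa)(s)=\kappa(g^{-1}.s)$, $SV_G$ is the group of pairs $(h,\gamma)$, $h$ a homeomorphism of $C^S$ and $\gamma\colon C^S\to G$, for which there are finite partitions of $C^S$ into dyadic bricks $B(\psi_1),\dots,B(\psi_n)$ and $B(\varphi_1),\dots,B(\varphi_n)$ and $g_1,\dots,g_n\in G$ with $h|_{B(\psi_i)}=h_{\varphi_i}\circ g_i\circ h_{\psi_i}^{-1}$ and $\gamma|_{B(\psi_i)}\equiv g_i$; the product is $(h,\gamma)(h',\gamma')=(hh',\ \kappa\mapsto\gamma(h'(\kappa))\gamma'(\kappa))$.) When the action is faithful, $SV_G$ is known to be simple. *)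

theory Defs
  imports "HOL-Analysis.Analysis" "HOL-Algebra.Group_Action" "HOL-Combinatorics.Permutations"
begin

section \<open>Finitely presented groups\<close>

text \<open>
  A word over generators \<open>X\<close> is a list of pairs \<open>(x, b)\<close>, where \<open>(x, True)\<close> stands for
  the letter \<open>x\<close> and \<open>(x, False)\<close> for its formal inverse.
\<close>

inductive pres_eq ::
    "'x set \<Rightarrow> ('x \<times> bool) list set \<Rightarrow> ('x \<times> bool) list \<Rightarrow> ('x \<times> bool) list \<Rightarrow> bool"
  for X R where
  pres_refl: "w \<in> lists (X \<times> UNIV) \<Longrightarrow> pres_eq X R w w"
| pres_sym: "pres_eq X R v w \<Longrightarrow> pres_eq X R w v"
| pres_trans: "pres_eq X R u v \<Longrightarrow> pres_eq X R v w \<Longrightarrow> pres_eq X R u w"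
| pres_append: "pres_eq X R v v' \<Longrightarrow> pres_eq X R w w' \<Longrightarrow> pres_eq X R (v @ w) (v' @ w')"
| pres_cancel: "x \<in> X \<Longrightarrow> pres_eq X R [(x, b), (x, \<not> b)] []"
| pres_relator: "r \<in> R \<Longrightarrow> pres_eq X R r []"

definition pres_class ::
    "'x set \<Rightarrow> ('x \<times> bool) list set \<Rightarrow> ('x \<times> bool) list \<Rightarrow> ('x \<times> bool) list set" where
  "pres_class X R w = {v. pres_eq X R w v}"

definition presented_group ::
    "'x set \<Rightarrow> ('x \<times> bool) list set \<Rightarrow> ('x \<times> bool) list set monoid" where
  "presented_group X R =
     \<lparr> carrier = pres_class X R ` lists (X \<times> UNIV),
       mult = (\<lambda>A B. \<Union>v\<in>A. \<Union>w\<in>B. pres_class X R (v @ w)),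
       one = pres_class X R [] \<rparr>"

text \<open>Finite generating sets may be labelled by natural numbers without loss of generality.\<close>

definition finitely_presented :: "('a, 'b) monoid_scheme \<Rightarrow> bool" where
  "finitely_presented G \<longleftrightarrow>
     (\<exists>(X :: nat set) R. finite X \<and> finite R \<and> R \<subseteq> lists (X \<times> UNIV) \<and>
        presented_group X R \<cong> G)"


section \<open>The Brin--Thompson groupoid\<close>

type_synonym 's cantor_fun = "'s \<Rightarrow> nat \<Rightarrow> bool"

text \<open>
  \<open>cantor_pow S\<close> is the power \<open>C\<^sup>S\<close> of the Cantor set \<open>C = nat \<Rightarrow> bool\<close>, with letters
  0, 1 rendered as \<open>False\<close>, \<open>True\<close>; its points are functions that are \<open>undefined\<close> outside
  \<open>S\<close>.  \<open>cantor_copies S m\<close> is the disjoint union of \<open>m\<close> copies, a point being a pair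
  (number of the copy, point of \<open>C\<^sup>S\<close>), with the copies numbered \<open>0, \<dots>, m - 1\<close>.
\<close>

definition cantor_pow :: "'s set \<Rightarrow> 's cantor_fun topology" where
  "cantor_pow S = product_topology (\<lambda>_. euclidean) S"

definition cantor_copies :: "'s set \<Rightarrow> nat \<Rightarrow> (nat \<times> 's cantor_fun) topology" where
  "cantor_copies S m = sum_topology (\<lambda>_. cantor_pow S) {..<m}"

definition prepend :: "bool list \<Rightarrow> (nat \<Rightarrow> bool) \<Rightarrow> nat \<Rightarrow> bool" where
  "prepend w \<alpha> = (\<lambda>n. if n < length w then w ! n else \<alpha> (n - length w))"

definition is_prefix :: "bool list \<Rightarrow> (nat \<Rightarrow> bool) \<Rightarrow> bool" where
  "is_prefix w \<alpha> \<longleftrightarrow> (\<forall>n < length w. \<alpha> n = w ! n)"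

definition brick_index :: "'s set \<Rightarrow> ('s \<Rightarrow> bool list) \<Rightarrow> bool" where
  "brick_index S \<psi> \<longleftrightarrow> finite {s \<in> S. \<psi> s \<noteq> []}"

definition brick :: "'s set \<Rightarrow> ('s \<Rightarrow> bool list) \<Rightarrow> 's cantor_fun set" where
  "brick S \<psi> = {\<kappa> \<in> topspace (cantor_pow S). \<forall>s\<in>S. is_prefix (\<psi> s) (\<kappa> s)}"

definition brick_homeo :: "'s set \<Rightarrow> ('s \<Rightarrow> bool list) \<Rightarrow> 's cantor_fun \<Rightarrow> 's cantor_fun" where
  "brick_homeo S \<psi> \<kappa> = (\<lambda>s\<in>S. prepend (\<psi> s) (\<kappa> s))"

text \<open>
  A partition of \<open>C\<^sup>S(m)\<close> into \<open>k\<close> dyadic bricks; the \<open>l\<close>-th brick is \<open>B(\<psi> l)\<close> inside the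
  copy \<open>c l\<close>.
\<close>

definition brick_partition ::
    "'s set \<Rightarrow> nat \<Rightarrow> nat \<Rightarrow> (nat \<Rightarrow> nat) \<Rightarrow> (nat \<Rightarrow> 's \<Rightarrow> bool list) \<Rightarrow> bool" where
  "brick_partition S m k c \<psi> \<longleftrightarrow>
     (\<forall>l<k. brick_index S (\<psi> l)) \<and>
     disjoint_family_on (\<lambda>l. {c l} \<times> brick S (\<psi> l)) {..<k} \<and>
     (\<Union>l<k. {c l} \<times> brick S (\<psi> l)) = topspace (cantor_copies S m)"

definition brin_thompson ::
    "'s set \<Rightarrow> nat \<Rightarrow> nat \<Rightarrow> (nat \<times> 's cantor_fun \<Rightarrow> nat \<times> 's cantor_fun) set" where
  "brin_thompson S m n =
     {f \<in> extensional (topspace (cantor_copies S m)).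
        homeomorphic_map (cantor_copies S m) (cantor_copies S n) f \<and>
        (\<exists>k c \<psi> d \<phi>. brick_partition S m k c \<psi> \<and> brick_partition S n k d \<phi> \<and>
           (\<forall>l<k. \<forall>\<kappa> \<in> topspace (cantor_pow S).
              f (c l, brick_homeo S (\<psi> l) \<kappa>) = (d l, brick_homeo S (\<phi> l) \<kappa>)))}"

definition bt_id :: "'s set \<Rightarrow> nat \<Rightarrow> nat \<times> 's cantor_fun \<Rightarrow> nat \<times> 's cantor_fun" where
  "bt_id S n = (\<lambda>p \<in> topspace (cantor_copies S n). p)"

definition bt_split :: "'s set \<Rightarrow> 's \<Rightarrow> nat \<times> 's cantor_fun \<Rightarrow> nat \<times> 's cantor_fun" where
  "bt_split S s = (\<lambda>(i, \<kappa>) \<in> topspace (cantor_copies S 1).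
     (if \<kappa> s 0 then 1 else 0, \<kappa>(s := (\<lambda>n. \<kappa> s (Suc n)))))"

definition bt_perm ::
    "'s set \<Rightarrow> nat \<Rightarrow> (nat \<Rightarrow> nat) \<Rightarrow> nat \<times> 's cantor_fun \<Rightarrow> nat \<times> 's cantor_fun" where
  "bt_perm S n \<sigma> = (\<lambda>(i, \<kappa>) \<in> topspace (cantor_copies S n). (\<sigma> i, \<kappa>))"

text \<open>
  The direct sum of \<open>f : C\<^sup>S(m) \<rightarrow> C\<^sup>S(n)\<close> and \<open>f' : C\<^sup>S(m') \<rightarrow> C\<^sup>S(n')\<close>: \<open>f\<close> acts on the first
  \<open>m\<close> copies and \<open>f'\<close> on the last \<open>m'\<close>.
\<close>

definition bt_sum ::
    "'s set \<Rightarrow> nat \<Rightarrow> nat \<Rightarrow> nat \<Rightarrow> (nat \<times> 's cantor_fun \<Rightarrow> nat \<times> 's cantor_fun) \<Rightarrow>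
     (nat \<times> 's cantor_fun \<Rightarrow> nat \<times> 's cantor_fun) \<Rightarrow> nat \<times> 's cantor_fun \<Rightarrow> nat \<times> 's cantor_fun"
  where
  "bt_sum S m n m' f f' = (\<lambda>(i, \<kappa>) \<in> topspace (cantor_copies S (m + m')).
     if i < m then f (i, \<kappa>) else apfst (\<lambda>j. n + j) (f' (i - m, \<kappa>)))"


section \<open>Abstract twisted Brin--Thompson groups\<close>

text \<open>
  The groupoid generated by the Brin--Thompson groupoid and the groups \<open>G\<^sup>n\<close>: its morphisms
  are formal expressions built from the generators by composition and direct sum, up to the
  least congruence for both operations that contains the given relations.  No formal
  inverses are needed, since the set of generators is closed under inverses.

  \<open>BT m n f\<close> is the generator given by \<open>f : C\<^sup>S(m) \<rightarrow> C\<^sup>S(n)\<close>, and \<open>Tup [g\<^sub>1, \<dots>, g\<^sub>n]\<close> the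
  generator \<open>(g\<^sub>1, \<dots>, g\<^sub>n)\<close> based at the object \<open>n\<close>.  \<open>Cmp e e'\<close> applies \<open>e'\<close> first.
\<close>

datatype ('g, 's) tw_expr =
    BT nat nat "nat \<times> 's cantor_fun \<Rightarrow> nat \<times> 's cantor_fun"
  | Tup "'g list"
  | Cmp "('g, 's) tw_expr" "('g, 's) tw_expr"
  | DSum "('g, 's) tw_expr" "('g, 's) tw_expr"

inductive tw_mor ::
    "('g, 'b) monoid_scheme \<Rightarrow> 's set \<Rightarrow> nat \<Rightarrow> nat \<Rightarrow> ('g, 's) tw_expr \<Rightarrow> bool"
  for G S where
  mor_BT: "1 \<le> m \<Longrightarrow> 1 \<le> n \<Longrightarrow> f \<in> brin_thompson S m n \<Longrightarrow> tw_mor G S m n (BT m n f)"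
| mor_Tup: "gs \<in> lists (carrier G) \<Longrightarrow> length gs = n \<Longrightarrow> 1 \<le> n \<Longrightarrow> tw_mor G S n n (Tup gs)"
| mor_Cmp: "tw_mor G S n p e \<Longrightarrow> tw_mor G S m n e' \<Longrightarrow> tw_mor G S m p (Cmp e e')"
| mor_DSum: "tw_mor G S m n e \<Longrightarrow> tw_mor G S m' n' e' \<Longrightarrow>
    tw_mor G S (m + m') (n + n') (DSum e e')"

text \<open>
  \<open>tw_eq G S \<phi> m n e e'\<close>: the expressions \<open>e, e' : m \<rightarrow> n\<close> denote the same morphism.  The
  rules up to \<open>tw_interchange\<close> say that we have a category with a strictly associative
  direct sum functor; the next five keep composition, identities and direct sums of the
  Brin--Thompson groupoid and of the groups \<open>G\<^sup>n\<close>; the last two are the twisting relations.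
\<close>

inductive tw_eq ::
    "('g, 'b) monoid_scheme \<Rightarrow> 's set \<Rightarrow> ('g \<Rightarrow> 's \<Rightarrow> 's) \<Rightarrow> nat \<Rightarrow> nat \<Rightarrow>
     ('g, 's) tw_expr \<Rightarrow> ('g, 's) tw_expr \<Rightarrow> bool"
  for G S \<phi> where
  tw_refl: "tw_mor G S m n e \<Longrightarrow> tw_eq G S \<phi> m n e e"
| tw_sym: "tw_eq G S \<phi> m n e e' \<Longrightarrow> tw_eq G S \<phi> m n e' e"
| tw_trans: "tw_eq G S \<phi> m n e e' \<Longrightarrow> tw_eq G S \<phi> m n e' e'' \<Longrightarrow> tw_eq G S \<phi> m n e e''"
| tw_Cmp: "tw_eq G S \<phi> n p a a' \<Longrightarrow> tw_eq G S \<phi> m n b b' \<Longrightarrow>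
    tw_eq G S \<phi> m p (Cmp a b) (Cmp a' b')"
| tw_DSum: "tw_eq G S \<phi> m n a a' \<Longrightarrow> tw_eq G S \<phi> m' n' b b' \<Longrightarrow>
    tw_eq G S \<phi> (m + m') (n + n') (DSum a b) (DSum a' b')"
| tw_Cmp_assoc: "tw_mor G S p q a \<Longrightarrow> tw_mor G S n p b \<Longrightarrow> tw_mor G S m n c \<Longrightarrow>
    tw_eq G S \<phi> m q (Cmp (Cmp a b) c) (Cmp a (Cmp b c))"
| tw_id_left: "tw_mor G S m n e \<Longrightarrow> tw_eq G S \<phi> m n (Cmp (BT n n (bt_id S n)) e) e"
| tw_id_right: "tw_mor G S m n e \<Longrightarrow> tw_eq G S \<phi> m n (Cmp e (BT m m (bt_id S m))) e"
| tw_DSum_assoc: "tw_mor G S m n a \<Longrightarrow> tw_mor G S m' n' b \<Longrightarrow> tw_mor G S m'' n'' c \<Longrightarrow>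
    tw_eq G S \<phi> (m + m' + m'') (n + n' + n'') (DSum (DSum a b) c) (DSum a (DSum b c))"
| tw_interchange: "tw_mor G S n p a \<Longrightarrow> tw_mor G S m n b \<Longrightarrow>
    tw_mor G S n' p' a' \<Longrightarrow> tw_mor G S m' n' b' \<Longrightarrow>
    tw_eq G S \<phi> (m + m') (p + p') (DSum (Cmp a b) (Cmp a' b')) (Cmp (DSum a a') (DSum b b'))"
| tw_BT_Cmp: "1 \<le> m \<Longrightarrow> 1 \<le> n \<Longrightarrow> 1 \<le> p \<Longrightarrow>
    f \<in> brin_thompson S n p \<Longrightarrow> f' \<in> brin_thompson S m n \<Longrightarrow>
    tw_eq G S \<phi> m p (Cmp (BT n p f) (BT m n f'))
      (BT m p (compose (topspace (cantor_copies S m)) f f'))"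
| tw_BT_DSum: "1 \<le> m \<Longrightarrow> 1 \<le> n \<Longrightarrow> 1 \<le> m' \<Longrightarrow> 1 \<le> n' \<Longrightarrow>
    f \<in> brin_thompson S m n \<Longrightarrow> f' \<in> brin_thompson S m' n' \<Longrightarrow>
    tw_eq G S \<phi> (m + m') (n + n') (DSum (BT m n f) (BT m' n' f'))
      (BT (m + m') (n + n') (bt_sum S m n m' f f'))"
| tw_Tup_one: "1 \<le> n \<Longrightarrow>
    tw_eq G S \<phi> n n (Tup (replicate n \<one>\<^bsub>G\<^esub>)) (BT n n (bt_id S n))"
| tw_Tup_Cmp: "gs \<in> lists (carrier G) \<Longrightarrow> hs \<in> lists (carrier G) \<Longrightarrow>
    length gs = n \<Longrightarrow> length hs = n \<Longrightarrow> 1 \<le> n \<Longrightarrow>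
    tw_eq G S \<phi> n n (Cmp (Tup gs) (Tup hs)) (Tup (map2 (\<lambda>g h. g \<otimes>\<^bsub>G\<^esub> h) gs hs))"
| tw_Tup_DSum: "gs \<in> lists (carrier G) \<Longrightarrow> hs \<in> lists (carrier G) \<Longrightarrow>
    length gs = n \<Longrightarrow> length hs = n' \<Longrightarrow> 1 \<le> n \<Longrightarrow> 1 \<le> n' \<Longrightarrow>
    tw_eq G S \<phi> (n + n') (n + n') (DSum (Tup gs) (Tup hs)) (Tup (gs @ hs))"
| tw_split: "g \<in> carrier G \<Longrightarrow> s \<in> S \<Longrightarrow>
    tw_eq G S \<phi> 1 2 (Cmp (BT 1 2 (bt_split S (\<phi> g s))) (Tup [g]))
      (Cmp (Tup [g, g]) (BT 1 2 (bt_split S s)))"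
| tw_perm: "gs \<in> lists (carrier G) \<Longrightarrow> length gs = n \<Longrightarrow> 1 \<le> n \<Longrightarrow> \<sigma> permutes {..<n} \<Longrightarrow>
    tw_eq G S \<phi> n n (Cmp (Tup gs) (BT n n (bt_perm S n \<sigma>)))
      (Cmp (BT n n (bt_perm S n \<sigma>)) (Tup (map (\<lambda>i. gs ! \<sigma> i) [0..<n])))"

definition tw_class ::
    "('g, 'b) monoid_scheme \<Rightarrow> 's set \<Rightarrow> ('g \<Rightarrow> 's \<Rightarrow> 's) \<Rightarrow> ('g, 's) tw_expr \<Rightarrow>
     ('g, 's) tw_expr set" where
  "tw_class G S \<phi> e = {e'. tw_eq G S \<phi> 1 1 e e'}"

definition twisted_BT_group ::
    "('g, 'b) monoid_scheme \<Rightarrow> 's set \<Rightarrow> ('g \<Rightarrow> 's \<Rightarrow> 's) \<Rightarrow> ('g, 's) tw_expr set monoid" where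
  "twisted_BT_group G S \<phi> =
     \<lparr> carrier = tw_class G S \<phi> ` {e. tw_mor G S 1 1 e},
       mult = (\<lambda>A B. \<Union>a\<in>A. \<Union>b\<in>B. tw_class G S \<phi> (Cmp a b)),
       one = tw_class G S \<phi> (BT 1 1 (bt_id S 1)) \<rparr>"


section \<open>The induced faithful action\<close>

definition action_kernel :: "('g, 'b) monoid_scheme \<Rightarrow> 's set \<Rightarrow> ('g \<Rightarrow> 's \<Rightarrow> 's) \<Rightarrow> 'g set" where
  "action_kernel G S \<phi> = kernel G (BijGroup S) \<phi>"

text \<open>All elements of a coset of the kernel act by the same permutation of \<open>S\<close>.\<close>

definition induced_action :: "('g \<Rightarrow> 's \<Rightarrow> 's) \<Rightarrow> 'g set \<Rightarrow> 's \<Rightarrow> 's" where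
  "induced_action \<phi> A = the_elem (\<phi> ` A)"

lemma induced_action_faithful:
  assumes "group_action G S \<phi>"
  shows "faithful_action (G Mod action_kernel G S \<phi>) S (induced_action \<phi>)"
proof -
  interpret group_hom G "BijGroup S" \<phi>
    using assms by (rule group_action.group_hom)
  have "group (G Mod action_kernel G S \<phi>)"
    unfolding action_kernel_def by (intro normal.factorgroup_is_group normal_kernel)
  then have "group_hom (G Mod action_kernel G S \<phi>) (BijGroup S) (induced_action \<phi>)"
    using FactGroup_hom
    unfolding action_kernel_def induced_action_def [abs_def]
    by (intro group_hom.intro group_hom_axioms.intro H.is_group)
  moreover have "inj_on (induced_action \<phi>) (carrier (G Mod action_kernel G S \<phi>))"
    using FactGroup_inj_on unfolding action_kernel_def induced_action_def [abs_def] .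
  ultimately show ?thesis
    by (intro faithful_action.intro group_action.intro faithful_action_axioms.intro)
qed

end

theory Submission
  imports Defs
begin

text \<open>
  An element of \<open>SV\<^sub>G\<close> moves the points of \<open>C\<^sup>S\<close> and carries a cocycle \<open>C\<^sup>S \<rightarrow> G\<close> with finitely many
  values.  A finite presentation of \<open>SV\<^sub>G\<close> therefore gives finitely many generators (the cocycle
  values of the generators) and relators (the cocycle read along the relators from all points)
  of a group \<open>H\<close> that maps onto \<open>G\<close> and through which the cocycle factors.  Constant points of
  \<open>C\<^sup>S\<close> are fixed by \<open>G \<le> SV\<^sub>G\<close>, so evaluating the lifted cocycle there splits \<open>H \<rightarrow> G\<close>, and a
  retract of a finitely presented group is finitely presented.  Hence \<open>G\<close> is finitely presented
  whenever \<open>SV\<^sub>G\<close> is; applied to \<open>G/K\<close>, this is one direction.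

  For the other direction, \<open>G\<close> is finitely generated and \<open>G/K\<close> finitely presented, so \<open>K\<close> is the
  normal closure in \<open>G\<close> of a finite set.  The kernel of \<open>SV\<^sub>G \<rightarrow> SV\<^bsub>G/K\<^esub>\<close> is generated as a normal
  subgroup by the tuples over \<open>K\<close>, transported to the object 1.  Splitting the trivial entries of
  a tuple is a conjugation in the groupoid, so the tuples \<open>(k)\<close>, \<open>(1, k)\<close>, \<open>(k, 1)\<close>,
  \<open>(1, k, 1)\<close> with \<open>k\<close> in the finite set suffice.
\<close>

section \<open>Presentations and words\<close>

text \<open>Elements of the group are classes of formal expressions, and the two directions treat
  them differently. To extract a cocycle, expressions are interpreted by an action and a cocycle on
  points, and every rule of the congruence is checked to preserve both. The kernel, in contrast, is
  computed inside the congruence: an equality over \<open>G Mod K\<close> is lifted rule by rule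
  through coset representatives. These are not multiplicative, so the lifted rules hold only up to
  inserting tuples over the kernel, and such insertions must be shown to be absorbed by a normal
  subgroup of the group at 1. Four shapes of tuples occur because conjugation by an isomorphism of
  objects can resize a block of trivial entries but cannot create or remove one: the blocks before
  and after \<open>k\<close> are independently empty or not, and a nonempty one shrinks to length 1.
  Inverses are not part of the syntax; the group at 1 receives them from its finite presentation and
  passes them on to its quotient.\<close>

definition words :: "'x set \<Rightarrow> ('x \<times> bool) list set" where
  "words X = lists (X \<times> UNIV)"

lemma words_simps [simp]:
  "[] \<in> words X"
  "(x, b) # w \<in> words X \<longleftrightarrow> x \<in> X \<and> w \<in> words X"
  "v @ w \<in> words X \<longleftrightarrow> v \<in> words X \<and> w \<in> words X"
  by (auto simp: words_def)

lemma words_induct [consumes 1, case_names Nil Cons]: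
  assumes "w \<in> words X" "P []"
    and "\<And>x b w. x \<in> X \<Longrightarrow> w \<in> words X \<Longrightarrow> P w \<Longrightarrow> P ((x, b) # w)"
  shows "P w"
  using assms(1) unfolding words_def by (induction w rule: lists.induct) (use assms in \<open>auto simp: words_def\<close>)

lemma pres_eq_refl: "w \<in> words X \<Longrightarrow> pres_eq X R w w"
  unfolding words_def by (rule pres_refl)

definition word_eval :: "('a, 'b) monoid_scheme \<Rightarrow> ('x \<Rightarrow> 'a) \<Rightarrow> ('x \<times> bool) list \<Rightarrow> 'a" where
  "word_eval G f w =
     foldr (\<lambda>(x, b) a. (if b then f x else inv\<^bsub>G\<^esub> f x) \<otimes>\<^bsub>G\<^esub> a) w \<one>\<^bsub>G\<^esub>"

lemma word_eval_simps [simp]: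
  "word_eval G f [] = \<one>\<^bsub>G\<^esub>"
  "word_eval G f ((x, b) # w) = (if b then f x else inv\<^bsub>G\<^esub> f x) \<otimes>\<^bsub>G\<^esub> word_eval G f w"
  by (auto simp: word_eval_def)

lemma word_eval_closed [simp]:
  assumes "group G" "f \<in> X \<rightarrow> carrier G" "w \<in> words X"
  shows "word_eval G f w \<in> carrier G"
proof -
  interpret group G by fact
  show ?thesis using assms(3)
    by (induction w rule: words_induct) (use assms(2) in \<open>auto simp: Pi_iff\<close>)
qed

lemma word_eval_append:
  assumes "group G" "f \<in> X \<rightarrow> carrier G" "v \<in> words X" "w \<in> words X"
  shows "word_eval G f (v @ w) = word_eval G f v \<otimes>\<^bsub>G\<^esub> word_eval G f w"
proof -
  interpret group G by fact
  note closed = word_eval_closed[OF assms(1,2)]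
  show ?thesis using assms(3)
  proof (induction v rule: words_induct)
    case Nil
    then show ?case using assms closed by simp
  next
    case (Cons x b v)
    moreover have "f x \<in> carrier G" using assms(2) Cons by auto
    ultimately show ?case using assms closed by (auto simp: m_assoc)
  qed
qed

lemma word_eval_hom:
  assumes "group G" "group H" "h \<in> hom G H" "f \<in> X \<rightarrow> carrier G" "w \<in> words X"
  shows "h (word_eval G f w) = word_eval H (h \<circ> f) w"
proof -
  interpret group_hom G H h using assms by (simp add: group_hom_def group_hom_axioms_def)
  show ?thesis using assms(5)
  proof (induction w rule: words_induct)
    case (Cons x b w)
    moreover have "f x \<in> carrier G" using assms(4) Cons by auto
    ultimately show ?case using word_eval_closed[OF assms(1,4)] by auto
  qed simp
qed

lemma word_eval_cong:
  assumes "w \<in> words X" "\<And>x. x \<in> X \<Longrightarrow> f x = f' x"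
  shows "word_eval G f w = word_eval G f' w"
  using assms(1) by (induction w rule: words_induct) (use assms(2) in auto)

definition word_inv :: "('x \<times> bool) list \<Rightarrow> ('x \<times> bool) list" where
  "word_inv w = rev (map (apsnd Not) w)"

lemma word_inv_Nil [simp]: "word_inv [] = []"
  by (simp add: word_inv_def)

lemma word_inv_lists [simp]: "w \<in> words X \<Longrightarrow> word_inv w \<in> words X"
  by (induction w rule: words_induct) (auto simp: word_inv_def)

lemma word_eval_inv:
  fixes G (structure)
  assumes "group G" "f \<in> X \<rightarrow> carrier G" "w \<in> words X"
  shows "word_eval G f (word_inv w) = inv\<^bsub>G\<^esub> word_eval G f w"
proof -
  interpret group G by fact
  show ?thesis using assms(3)
  proof (induction w rule: words_induct)
    case (Cons x b w)
    then have xw: "x \<in> X" "w \<in> words X" by auto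
    have fx: "f x \<in> carrier G" using assms(2) xw by auto
    have "word_eval G f (word_inv ((x, b) # w)) = word_eval G f (word_inv w @ [(x, \<not> b)])"
      by (simp add: word_inv_def)
    also have "\<dots> = inv word_eval G f w \<otimes> word_eval G f [(x, \<not> b)]"
      using Cons xw by (subst word_eval_append[OF assms(1,2)]) auto
    also have "\<dots> = inv word_eval G f ((x, b) # w)"
      using xw fx word_eval_closed[OF assms(1,2)] by (auto simp: inv_mult_group)
    finally show ?case .
  qed (simp add: word_inv_def)
qed

section \<open>Consequences of a set of relators\<close>

lemma pres_eq_lists:
  assumes "pres_eq X R v w" "R \<subseteq> words X"
  shows "v \<in> words X" "w \<in> words X"
  using assms by (induction rule: pres_eq.induct) (auto simp: words_def[symmetric])

text \<open>Von Dyck's theorem at the level of words: once the relators hold in \<open>G\<close>, so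
  do all their consequences.\<close>

lemma pres_eq_imp_word_eval_eq:
  assumes "pres_eq X R v w" "group G" "f \<in> X \<rightarrow> carrier G" "R \<subseteq> words X"
    and "\<And>r. r \<in> R \<Longrightarrow> word_eval G f r = \<one>\<^bsub>G\<^esub>"
  shows "word_eval G f v = word_eval G f w"
proof -
  interpret group G by fact
  show ?thesis using assms(1)
  proof (induction rule: pres_eq.induct)
    case (pres_append v v' w w')
    then show ?case
      using pres_eq_lists[OF _ assms(4)] by (simp add: word_eval_append[OF assms(2,3)])
  next
    case (pres_cancel x b)
    then have "f x \<in> carrier G" using assms(3) by auto
    then show ?case by simp
  qed (use assms(5) in auto)
qed

lemma pres_eq_append_right:
  "pres_eq X R v v' \<Longrightarrow> w \<in> words X \<Longrightarrow> pres_eq X R (v @ w) (v' @ w)"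
  by (intro pres_append pres_eq_refl)

lemma pres_eq_append_left:
  "pres_eq X R v v' \<Longrightarrow> w \<in> words X \<Longrightarrow> pres_eq X R (w @ v) (w @ v')"
  by (intro pres_append pres_eq_refl)

lemma pres_eq_word_inv_right:
  "w \<in> words X \<Longrightarrow> pres_eq X R (w @ word_inv w) []"
proof (induction w rule: words_induct)
  case (Cons x b w)
  then have xw: "x \<in> X" "w \<in> words X" by auto
  have "pres_eq X R ((w @ word_inv w) @ [(x, \<not> b)]) ([] @ [(x, \<not> b)])"
    by (rule pres_eq_append_right) (use Cons xw in auto)
  then have "pres_eq X R ([(x, b)] @ ((w @ word_inv w) @ [(x, \<not> b)])) ([(x, b)] @ ([] @ [(x, \<not> b)]))"
    by (rule pres_eq_append_left) (use xw in auto)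
  then have "pres_eq X R ([(x, b)] @ ((w @ word_inv w) @ [(x, \<not> b)])) []"
    by (rule pres_trans) (use xw pres_cancel in auto)
  then show ?case by (simp add: word_inv_def)
qed (simp add: word_inv_def pres_eq_refl)

lemma word_inv_word_inv [simp]: "word_inv (word_inv w) = w"
  by (simp add: word_inv_def rev_map apsnd_def map_prod_def comp_def case_prod_unfold)

lemma pres_eq_word_inv_left:
  "w \<in> words X \<Longrightarrow> pres_eq X R (word_inv w @ w) []"
  using pres_eq_word_inv_right[of "word_inv w" X R] by simp

text \<open>Bracketing \<open>v @ word_inv w @ w\<close> in two ways gives \<open>v\<close> and
  \<open>w\<close>. Equalities thus reduce to words that represent the identity, the form in which
  \<open>presents\<close> records completeness.\<close>

lemma pres_eqI_inv:
  assumes "pres_eq X R (v @ word_inv w) []" "v \<in> words X" "w \<in> words X"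
  shows "pres_eq X R v w"
proof -
  have "pres_eq X R (v @ (word_inv w @ w)) (v @ [])"
    by (intro pres_append pres_eq_refl pres_eq_word_inv_left assms)
  moreover have "pres_eq X R ((v @ word_inv w) @ w) ([] @ w)"
    by (intro pres_append pres_eq_refl assms)
  ultimately show ?thesis by (auto intro: pres_trans pres_sym)
qed

lemma pres_eq_word_inv:
  assumes "pres_eq X R v w" "R \<subseteq> words X"
  shows "pres_eq X R (word_inv v) (word_inv w)"
proof -
  note l = pres_eq_lists[OF assms]
  have "pres_eq X R (word_inv v @ w) (word_inv v @ v)"
    by (intro pres_append pres_sym[OF assms(1)] pres_eq_refl word_inv_lists l)
  then have "pres_eq X R (word_inv v @ word_inv (word_inv w)) []"
    unfolding word_inv_word_inv by (rule pres_trans) (intro pres_eq_word_inv_left l)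
  then show ?thesis by (rule pres_eqI_inv) (use l in auto)
qed

lemma pres_eq_mono:
  assumes "pres_eq X R v w" "R \<subseteq> R'"
  shows "pres_eq X R' v w"
  using assms(1)
proof (induction rule: pres_eq.induct)
  case (pres_relator r)
  then show ?case using assms(2) by (blast intro: pres_eq.pres_relator)
qed (rule pres_eq.intros; assumption)+

text \<open>
  Equivalently, \<open>word_eval G f\<close> induces an isomorphism from the presented group to \<open>G\<close>.
\<close>

definition presents ::
    "('a, 'b) monoid_scheme \<Rightarrow> 'x set \<Rightarrow> ('x \<times> bool) list set \<Rightarrow> ('x \<Rightarrow> 'a) \<Rightarrow> bool" where
  "presents G X R f \<longleftrightarrow>
     f \<in> X \<rightarrow> carrier G \<and> R \<subseteq> words X \<and> (\<forall>r\<in>R. word_eval G f r = \<one>\<^bsub>G\<^esub>) \<and>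
     carrier G \<subseteq> word_eval G f ` words X \<and>
     (\<forall>w \<in> words X. word_eval G f w = \<one>\<^bsub>G\<^esub> \<longrightarrow> pres_eq X R w [])"

lemma presents_pres_eq_iff:
  fixes G (structure)
  assumes "group G" "presents G X R f" "v \<in> words X" "w \<in> words X"
  shows "pres_eq X R v w \<longleftrightarrow> word_eval G f v = word_eval G f w"
proof
  interpret group G by fact
  have f: "f \<in> X \<rightarrow> carrier G" using assms by (simp add: presents_def)
  assume "word_eval G f v = word_eval G f w"
  then have "word_eval G f (v @ word_inv w) = \<one>"
    using assms f by (simp add: word_eval_append word_eval_inv)
  then show "pres_eq X R v w"
    using assms by (intro pres_eqI_inv[of X R v w]) (auto simp: presents_def)
qed (use assms in \<open>auto simp: presents_def intro!: pres_eq_imp_word_eval_eq\<close>)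

section \<open>Presented groups and presentations of a given group\<close>

lemma pres_class_eq_iff:
  assumes "v \<in> words X"
  shows "pres_class X R v = pres_class X R w \<longleftrightarrow> pres_eq X R v w"
  using assms pres_eq_refl[of v X R] unfolding pres_class_def
  by (auto intro: pres_sym pres_trans)

lemma carrier_presented_group: "carrier (presented_group X R) = pres_class X R ` words X"
  and one_presented_group: "\<one>\<^bsub>presented_group X R\<^esub> = pres_class X R []"
  by (auto simp: presented_group_def words_def)

text \<open>All classes in the defining union coincide, because concatenation respects the
  congruence, and the union is not empty.\<close>

lemma presented_group_mult:
  assumes "v \<in> words X" "w \<in> words X"
  shows "pres_class X R v \<otimes>\<^bsub>presented_group X R\<^esub> pres_class X R w = pres_class X R (v @ w)"
proof -
  let ?A = "pres_class X R v" and ?B = "pres_class X R w" and ?C = "pres_class X R (v @ w)"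
  have "pres_class X R (v' @ w') = ?C" if "v' \<in> ?A" "w' \<in> ?B" for v' w'
    using that assms by (subst eq_commute, subst pres_class_eq_iff) (auto simp: pres_class_def intro: pres_append)
  then have "(\<Union>v'\<in>?A. \<Union>w'\<in>?B. pres_class X R (v' @ w')) = (\<Union>v'\<in>?A. \<Union>w'\<in>?B. ?C)"
    by (intro SUP_cong refl) auto
  moreover have "v \<in> ?A" "w \<in> ?B"
    using assms by (auto simp: pres_class_def intro: pres_eq_refl)
  then have "(\<Union>v'\<in>?A. \<Union>w'\<in>?B. ?C) = ?C" by blast
  ultimately show ?thesis unfolding presented_group_def by simp
qed

lemma group_presented_group: "group (presented_group X R)"
proof (rule groupI)
  let ?P = "presented_group X R"
  note car = carrier_presented_group[of X R] and one = one_presented_group[of X R]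
  fix a assume "a \<in> carrier ?P"
  then obtain w where w: "w \<in> words X" "a = pres_class X R w" by (auto simp: car)
  show "\<one>\<^bsub>?P\<^esub> \<otimes>\<^bsub>?P\<^esub> a = a" using w by (simp add: one presented_group_mult)
  show "\<exists>y\<in>carrier ?P. y \<otimes>\<^bsub>?P\<^esub> a = \<one>\<^bsub>?P\<^esub>"
  proof
    show "pres_class X R (word_inv w) \<in> carrier ?P" using w by (auto simp: car)
    show "pres_class X R (word_inv w) \<otimes>\<^bsub>?P\<^esub> a = \<one>\<^bsub>?P\<^esub>"
      using w by (simp add: presented_group_mult one pres_class_eq_iff pres_eq_word_inv_left)
  qed
next
  let ?P = "presented_group X R"
  fix a b c assume "a \<in> carrier ?P" "b \<in> carrier ?P" "c \<in> carrier ?P"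
  then show "a \<otimes>\<^bsub>?P\<^esub> b \<otimes>\<^bsub>?P\<^esub> c = a \<otimes>\<^bsub>?P\<^esub> (b \<otimes>\<^bsub>?P\<^esub> c)"
    by (auto simp: presented_group_mult carrier_presented_group)
next
  let ?P = "presented_group X R"
  fix a b assume "a \<in> carrier ?P" "b \<in> carrier ?P"
  then show "a \<otimes>\<^bsub>?P\<^esub> b \<in> carrier ?P"
    by (auto simp: presented_group_mult carrier_presented_group)
qed (auto simp: carrier_presented_group one_presented_group)

lemma word_eval_presented_group:
  assumes "w \<in> words X"
  shows "word_eval (presented_group X R) (\<lambda>x. pres_class X R [(x, True)]) w = pres_class X R w"
proof -
  let ?P = "presented_group X R"
  interpret P: group ?P by (rule group_presented_group)
  note car = carrier_presented_group[of X R] and one = one_presented_group[of X R]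
  show ?thesis using assms
  proof (induction w rule: words_induct)
    case (Cons x b w)
    then have xw: "x \<in> X" "w \<in> words X" by auto
    have "inv\<^bsub>?P\<^esub> pres_class X R [(x, True)] = pres_class X R [(x, False)]"
      using xw pres_cancel[of x X R False]
      by (intro P.inv_equality) (auto simp: presented_group_mult one pres_class_eq_iff car)
    then have "(if b then pres_class X R [(x, True)] else inv\<^bsub>?P\<^esub> pres_class X R [(x, True)])
        = pres_class X R [(x, b)]" by auto
    then show ?case using Cons xw
      by (simp add: presented_group_mult)
  qed (simp add: one)
qed

text \<open>The generators found later are group elements, whereas \<open>finitely_presented\<close>
  asks for labels in \<open>nat\<close>; so the presentation is first transported along an injection
  \<open>e\<close> of the finite set \<open>X\<close>.\<close>

lemma finitely_presentedI:
  fixes G (structure) and X :: "'x set"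
  assumes "group G" "presents G X R f" "finite X" "finite R"
  shows "finitely_presented G"
proof -
  interpret group G by fact
  obtain e :: "'x \<Rightarrow> nat" where e: "inj_on e X"
    using finite_imp_inj_to_nat_seg[OF assms(3)] by blast
  define E where "E = map (apfst e :: 'x \<times> bool \<Rightarrow> nat \<times> bool)"
  define X' where "X' = e ` X"
  define R' where "R' = E ` R"
  define f' where "f' = f \<circ> inv_into X e"
  have f: "f \<in> X \<rightarrow> carrier G" and R: "R \<subseteq> words X"
    using assms by (auto simp: presents_def)
  have E_lists: "E w \<in> words X'" if "w \<in> words X" for w
    using that by (induction w rule: words_induct) (auto simp: E_def X'_def)
  have R': "R' \<subseteq> words X'" using R E_lists unfolding R'_def by blast
  have f': "f' \<in> X' \<rightarrow> carrier G" using f e by (auto simp: f'_def X'_def)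
  have eval: "word_eval G f' (E w) = word_eval G f w" if "w \<in> words X" for w
    using that by (induction w rule: words_induct) (use e in \<open>auto simp: E_def f'_def\<close>)
  have E_surj: "\<exists>v \<in> words X. w = E v" if "w \<in> words X'" for w
    using that
  proof (induction w rule: words_induct)
    case (Cons y b w)
    then obtain v x where "v \<in> words X" "w = E v" "y = e x" "x \<in> X"
      by (auto simp: X'_def)
    then show ?case by (intro bexI[of _ "(x, b) # v"]) (auto simp: E_def)
  qed (auto simp: E_def)
  have E_eq: "pres_eq X' R' (E v) (E w)" if "pres_eq X R v w" for v w
    using that
  proof (induction rule: pres_eq.induct)
    case (pres_append v v' w w')
    then show ?case by (auto simp: E_def intro: pres_eq.pres_append)
  next
    case (pres_cancel x b)
    then show ?case by (auto simp: E_def X'_def intro!: pres_eq.pres_cancel)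
  next
    case (pres_relator r)
    then have "pres_eq X' R' (E r) []" by (intro pres_eq.pres_relator) (simp add: R'_def)
    then show ?case by (simp add: E_def)
  qed (auto simp: words_def[symmetric] intro: pres_sym pres_trans intro!: pres_eq_refl E_lists)
  have pres: "presents G X' R' f'"
    unfolding presents_def
  proof (intro conjI f' R')
    show "\<forall>r\<in>R'. word_eval G f' r = \<one>"
      using R assms(2) eval unfolding R'_def presents_def by (auto simp: subset_iff)
    show "carrier G \<subseteq> word_eval G f' ` words X'"
    proof
      fix g assume "g \<in> carrier G"
      then obtain w where "w \<in> words X" "g = word_eval G f w"
        using assms(2) unfolding presents_def by blast
      then show "g \<in> word_eval G f' ` words X'"
        using E_lists eval by (intro image_eqI[of _ _ "E w"]) auto
    qed
    show "\<forall>w\<in>words X'. word_eval G f' w = \<one> \<longrightarrow> pres_eq X' R' w []"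
    proof (intro ballI impI)
      fix w assume w: "w \<in> words X'" "word_eval G f' w = \<one>"
      obtain v where v: "v \<in> words X" "w = E v" using E_surj w by blast
      then have "pres_eq X R v []" using assms(2) w eval by (auto simp: presents_def)
      from E_eq[OF this] show "pres_eq X' R' w []" by (simp add: v E_def)
    qed
  qed
  \<comment> \<open>The words evaluating to \<open>g\<close> form exactly one class, so this inverts
    the map induced by evaluation without choosing a word for \<open>g\<close>.\<close>
  define h where "h g = {w \<in> words X'. word_eval G f' w = g}" for g
  have h_eval: "h (word_eval G f' w) = pres_class X' R' w" if "w \<in> words X'" for w
    using that presents_pres_eq_iff[OF assms(1) pres] pres_eq_lists[OF _ R']
    unfolding h_def pres_class_def by (intro Collect_cong) metis
  have surj: "\<exists>w \<in> words X'. g = word_eval G f' w" if "g \<in> carrier G" for g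
    using pres that unfolding presents_def by blast
  have "h \<in> iso G (presented_group X' R')"
  proof (rule isoI)
    show "h \<in> hom G (presented_group X' R')"
    proof (rule homI)
      fix g assume "g \<in> carrier G"
      then show "h g \<in> carrier (presented_group X' R')"
        using surj[of g] h_eval by (auto simp: carrier_presented_group)
    next
      fix a b assume "a \<in> carrier G" "b \<in> carrier G"
      then obtain v w where vw: "v \<in> words X'" "w \<in> words X'"
        "a = word_eval G f' v" "b = word_eval G f' w" using surj by blast
      have "h (a \<otimes> b) = h (word_eval G f' (v @ w))"
        using vw f' by (simp add: word_eval_append[OF assms(1)])
      also have "\<dots> = h a \<otimes>\<^bsub>presented_group X' R'\<^esub> h b"
        using vw by (simp add: h_eval presented_group_mult)
      finally show "h (a \<otimes> b) = h a \<otimes>\<^bsub>presented_group X' R'\<^esub> h b" .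
    qed
    have "inj_on h (carrier G)"
    proof (rule inj_onI)
      fix a b assume ab: "a \<in> carrier G" "b \<in> carrier G" "h a = h b"
      then obtain w where "w \<in> h a" using surj unfolding h_def by blast
      then show "a = b" using ab(3) unfolding h_def by auto
    qed
    moreover have "h ` carrier G = carrier (presented_group X' R')"
    proof -
      have "carrier G = word_eval G f' ` words X'"
        using surj word_eval_closed[OF assms(1) f'] by blast
      then show ?thesis using h_eval by (simp add: image_image carrier_presented_group)
    qed
    ultimately show "bij_betw h (carrier G) (carrier (presented_group X' R'))"
      by (simp add: bij_betw_def)
  qed
  then have "presented_group X' R' \<cong> G"
    using iso_sym is_isoI by blast
  moreover have "finite X'" "finite R'" using assms by (auto simp: X'_def R'_def)
  ultimately show ?thesis
    using R' unfolding finitely_presented_def words_def by blast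
qed

lemma finitely_presentedE:
  assumes "group G" "finitely_presented G"
  obtains X :: "nat set" and R f where "finite X" "finite R" "presents G X R f"
proof -
  obtain X :: "nat set" and R h where X: "finite X" "finite R" and R: "R \<subseteq> words X"
    and h: "h \<in> iso (presented_group X R) G"
    using assms(2) unfolding finitely_presented_def is_iso_def words_def by blast
  let ?P = "presented_group X R"
  let ?c = "\<lambda>x. pres_class X R [(x, True)]"
  interpret P: group ?P by (rule group_presented_group)
  interpret group_hom ?P G h
    using h assms(1) by (simp add: group_hom_def group_hom_axioms_def iso_def P.is_group)
  have bij: "bij_betw h (carrier ?P) (carrier G)" using h by (simp add: iso_def)
  note car = carrier_presented_group[of X R] and one = one_presented_group[of X R]
  have c: "?c \<in> X \<rightarrow> carrier ?P" by (auto simp: car)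
  have eval: "word_eval G (h \<circ> ?c) w = h (pres_class X R w)" if "w \<in> words X" for w
    using word_eval_hom[OF P.is_group assms(1) homh c that] word_eval_presented_group[OF that, of R]
    by simp
  have "presents G X R (h \<circ> ?c)"
    unfolding presents_def
  proof (intro conjI R ballI impI)
    show "h \<circ> ?c \<in> X \<rightarrow> carrier G" using c hom_closed by (auto simp: Pi_iff)
    show "carrier G \<subseteq> word_eval G (h \<circ> ?c) ` words X"
    proof
      fix g assume "g \<in> carrier G"
      then obtain w where "w \<in> words X" "g = h (pres_class X R w)"
        using bij by (auto simp: bij_betw_def car)
      then show "g \<in> word_eval G (h \<circ> ?c) ` words X" using eval[of w] by (intro image_eqI[of _ _ w]) auto
    qed
  next
    fix r assume r: "r \<in> R"
    then have "pres_class X R r = pres_class X R []"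
      using R by (subst pres_class_eq_iff) (auto intro: pres_relator)
    then show "word_eval G (h \<circ> ?c) r = \<one>\<^bsub>G\<^esub>"
      using eval[of r] r R hom_one by (auto simp: one)
  next
    fix w assume w: "w \<in> words X" "word_eval G (h \<circ> ?c) w = \<one>\<^bsub>G\<^esub>"
    then have "h (pres_class X R w) = h (pres_class X R [])" 
      using eval[of w] hom_one by (simp add: one)
    moreover have "pres_class X R w \<in> carrier ?P" "pres_class X R [] \<in> carrier ?P"
      using w by (auto simp: car)
    ultimately have "pres_class X R w = pres_class X R []"
      using bij by (meson bij_betw_def inj_onD)
    then show "pres_eq X R w []" using w by (simp add: pres_class_eq_iff)
  qed
  then show thesis using that X by blast
qed

section \<open>Quotients of finitely presented groups\<close>

lemma presents_surj:
  assumes "presents G X R f" "g \<in> carrier G"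
  obtains w where "w \<in> words X" "word_eval G f w = g"
  using assms unfolding presents_def by blast

text \<open>The last hypothesis puts the kernel inside the normal closure of the values of
  \<open>T\<close>; quantifying over normal subgroups avoids building that closure. It is applied to
  one subgroup \<open>N\<close> only: the elements represented by words that
  \<open>R \<union> T\<close> makes trivial.\<close>

lemma presents_quotient:
  assumes "group H" "group_hom G Q h" "h ` carrier G = carrier Q" 
    and "presents G X R f" "T \<subseteq> words X"
    and "\<And>t. t \<in> T \<Longrightarrow> h (word_eval G f t) = \<one>\<^bsub>Q\<^esub>"
    and "\<And>N. N \<lhd> G \<Longrightarrow> word_eval G f ` T \<subseteq> N \<Longrightarrow> kernel G Q h \<subseteq> N"
  shows "presents Q X (R \<union> T) (h \<circ> f)"
proof -
  interpret group_hom G Q h by fact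
  have f: "f \<in> X \<rightarrow> carrier G" and R: "R \<subseteq> words X"
    and R1: "\<And>r. r \<in> R \<Longrightarrow> word_eval G f r = \<one>\<^bsub>G\<^esub>"
    using assms(4) by (auto simp: presents_def)
  note closed = word_eval_closed[OF G.is_group f]
  have eval: "word_eval Q (h \<circ> f) w = h (word_eval G f w)" if "w \<in> words X" for w
    using word_eval_hom[OF G.is_group H.is_group homh f that] by simp
  have RT: "R \<union> T \<subseteq> words X" using R assms(5) by simp
  define N where "N = word_eval G f ` {w \<in> words X. pres_eq X (R \<union> T) w []}"
  \<comment> \<open>Membership in \<open>N\<close> provides some trivial word with the given value.
    Two words with the same value are \<open>R\<close>-equivalent, so every word with that value is
    trivial.\<close>
  have N_iff: "pres_eq X (R \<union> T) w []" if wN: "word_eval G f w \<in> N" "w \<in> words X" for w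
  proof -
    obtain v where v: "v \<in> words X" "pres_eq X (R \<union> T) v []" "word_eval G f w = word_eval G f v"
      using wN unfolding N_def by blast
    then have "pres_eq X R w v"
      using presents_pres_eq_iff[OF G.is_group assms(4)] wN by simp
    then show ?thesis using v(2) by (meson pres_eq_mono pres_trans Un_upper1)
  qed
  have subg: "subgroup N G"
  proof (rule subgroup.intro)
    show "N \<subseteq> carrier G" using closed by (auto simp: N_def)
    show "\<one>\<^bsub>G\<^esub> \<in> N" unfolding N_def
      by (rule image_eqI[of _ _ "[]"]) (auto intro: pres_eq_refl)
  next
    fix a b assume "a \<in> N" "b \<in> N"
    then obtain v w where "v \<in> words X" "w \<in> words X" "a = word_eval G f v" "b = word_eval G f w"
      "pres_eq X (R \<union> T) v []" "pres_eq X (R \<union> T) w []" unfolding N_def by blast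
    then show "a \<otimes>\<^bsub>G\<^esub> b \<in> N" unfolding N_def
      using pres_append[of X "R \<union> T" v "[]" w "[]"]
      by (intro image_eqI[of _ _ "v @ w"]) (auto simp: word_eval_append[OF G.is_group f])
  next
    fix a assume "a \<in> N"
    then obtain v where "v \<in> words X" "a = word_eval G f v" "pres_eq X (R \<union> T) v []"
      unfolding N_def by blast
    then show "inv\<^bsub>G\<^esub> a \<in> N" unfolding N_def
      using pres_eq_word_inv[of X "R \<union> T" v "[]"] RT
      by (intro image_eqI[of _ _ "word_inv v"]) (auto simp: word_eval_inv[OF G.is_group f])
  qed
  have "N \<lhd> G"
    unfolding G.normal_inv_iff
  proof (intro conjI subg ballI)
    fix g a assume "g \<in> carrier G" "a \<in> N"
    then obtain u v where u: "u \<in> words X" "g = word_eval G f u"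
      and v: "v \<in> words X" "a = word_eval G f v" "pres_eq X (R \<union> T) v []"
      using presents_surj[OF assms(4)] unfolding N_def by blast
    have "pres_eq X (R \<union> T) (u @ v @ word_inv u) (u @ [] @ word_inv u)"
      by (intro pres_append pres_eq_refl v u word_inv_lists)
    then have "pres_eq X (R \<union> T) (u @ v @ word_inv u) []"
      using pres_eq_word_inv_right[OF u(1)] by (auto intro: pres_trans)
    then show "g \<otimes>\<^bsub>G\<^esub> a \<otimes>\<^bsub>G\<^esub> inv\<^bsub>G\<^esub> g \<in> N"
      unfolding N_def using u v closed
      by (intro image_eqI[of _ _ "u @ v @ word_inv u"])
        (auto simp: word_eval_append[OF G.is_group f] word_eval_inv[OF G.is_group f] G.m_assoc)
  qed
  moreover have "word_eval G f ` T \<subseteq> N"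
    using assms(5) unfolding N_def by (auto intro!: imageI intro: pres_relator)
  ultimately have ker: "kernel G Q h \<subseteq> N" by (rule assms(7))
  show ?thesis
    unfolding presents_def words_def[symmetric]
  proof (intro conjI RT ballI impI)
    show "h \<circ> f \<in> X \<rightarrow> carrier Q" using f by (auto simp: Pi_iff)
    show "carrier Q \<subseteq> word_eval Q (h \<circ> f) ` words X"
    proof
      fix q assume "q \<in> carrier Q"
      then obtain g where "g \<in> carrier G" "q = h g" using assms(3) by blast
      then obtain w where "w \<in> words X" "q = h (word_eval G f w)"
        using presents_surj[OF assms(4)] by metis
      then show "q \<in> word_eval Q (h \<circ> f) ` words X" using eval[of w] by (intro image_eqI[of _ _ w]) auto
    qed
  next
    fix r assume "r \<in> R \<union> T"
    then show "word_eval Q (h \<circ> f) r = \<one>\<^bsub>Q\<^esub>"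
      using eval[of r] RT R1 assms(6) by auto
  next
    fix w assume "w \<in> words X" "word_eval Q (h \<circ> f) w = \<one>\<^bsub>Q\<^esub>"
    then have "word_eval G f w \<in> kernel G Q h" using eval[of w] closed by (simp add: kernel_def)
    then show "pres_eq X (R \<union> T) w []" using ker N_iff \<open>w \<in> words X\<close> by blast
  qed
qed

lemma finitely_presented_quotient:
  assumes "group_hom G Q h" "h ` carrier G = carrier Q" "finitely_presented G"
    and "finite T" "T \<subseteq> kernel G Q h"
    and "\<And>N. N \<lhd> G \<Longrightarrow> T \<subseteq> N \<Longrightarrow> kernel G Q h \<subseteq> N"
  shows "finitely_presented Q"
proof -
  interpret group_hom G Q h by fact
  obtain X :: "nat set" and R f where X: "finite X" "finite R" "presents G X R f"
    using finitely_presentedE[OF G.is_group assms(3)] .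
  have "\<exists>w. w \<in> words X \<and> word_eval G f w = t" if "t \<in> T" for t
    using that assms(5) presents_surj[OF X(3), of t] unfolding kernel_def by blast
  then obtain W where W: "\<And>t. t \<in> T \<Longrightarrow> W t \<in> words X \<and> word_eval G f (W t) = t" by metis
  have img: "word_eval G f ` W ` T = T" using W by force
  have "presents Q X (R \<union> W ` T) (h \<circ> f)"
  proof (rule presents_quotient)
    show "h (word_eval G f t) = \<one>\<^bsub>Q\<^esub>" if "t \<in> W ` T" for t
      using that W assms(5) unfolding kernel_def by auto
  qed (use W assms X img in auto)
  then show ?thesis using X assms(4) H.is_group by (intro finitely_presentedI[of Q X "R \<union> W ` T"]) auto
qed

text \<open>Lift the generators of \<open>G Mod K\<close> to elements \<open>q y\<close> of
  \<open>G\<close>. If \<open>N\<close> is normal and contains \<open>T\<close>, the lifts generate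
  \<open>G Mod N\<close> and satisfy there the relators of \<open>G Mod K\<close>; hence
  \<open>G Mod N\<close> is a quotient of \<open>G Mod K\<close>, that is,
  \<open>K \<subseteq> N\<close>.\<close>

lemma finite_normal_generators:
  fixes G (structure)
  assumes "group G" "K \<lhd> G" "finitely_presented (G Mod K)"
    and "finite X" "f \<in> X \<rightarrow> carrier G" "carrier G \<subseteq> word_eval G f ` words X"
  obtains T where "finite T" "T \<subseteq> K" "\<And>N. N \<lhd> G \<Longrightarrow> T \<subseteq> N \<Longrightarrow> K \<subseteq> N"
proof -
  interpret normal K G by fact
  interpret Q: group "G Mod K" by (rule factorgroup_is_group)
  obtain Y :: "nat set" and R p where Y: "finite Y" "finite R" "presents (G Mod K) Y R p"
    using finitely_presentedE[OF Q.is_group assms(3)] .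
  have p: "p \<in> Y \<rightarrow> carrier (G Mod K)" and R: "R \<subseteq> words Y"
    using Y by (auto simp: presents_def)
  define proj where "proj = (\<lambda>g. K #>\<^bsub>G\<^esub> g)"
  have proj: "proj \<in> hom G (G Mod K)" unfolding proj_def by (rule r_coset_hom_Mod)
  have "\<exists>g. g \<in> carrier G \<and> proj g = p y" if "y \<in> Y" for y
    using p that unfolding proj_def by (fastforce simp: FactGroup_def RCOSETS_def Pi_iff)
  then obtain q where q: "\<And>y. y \<in> Y \<Longrightarrow> q y \<in> carrier G \<and> proj (q y) = p y" by metis
  have qY: "q \<in> Y \<rightarrow> carrier G" using q by auto
  have eval: "proj (word_eval G q w) = word_eval (G Mod K) p w" if "w \<in> words Y" for w
  proof -
    have "proj (word_eval G q w) = word_eval (G Mod K) (proj \<circ> q) w"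
      by (rule word_eval_hom[OF assms(1) Q.is_group proj qY that])
    also have "\<dots> = word_eval (G Mod K) p w"
      using that q by (intro word_eval_cong) auto
    finally show ?thesis .
  qed
  have "\<exists>w. w \<in> words Y \<and> word_eval (G Mod K) p w = proj (f x)" if "x \<in> X" for x
  proof -
    have "proj (f x) \<in> carrier (G Mod K)" using proj assms(5) that by (auto simp: hom_def)
    then show ?thesis using presents_surj[OF Y(3)] by metis
  qed
  then obtain W where W: "\<And>x. x \<in> X \<Longrightarrow> W x \<in> words Y \<and> word_eval (G Mod K) p (W x) = proj (f x)"
    by metis
  have proj_eq: "g \<otimes> inv h \<in> K" if "g \<in> carrier G" "h \<in> carrier G" "proj g = proj h" for g h
    using that unfolding proj_def
    by (metis coset_join1 coset_mult_inv2 inv_closed is_subgroup m_closed repr_independenceD rcos_self subset)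
  have proj1: "g \<in> K" if "g \<in> carrier G" "proj g = \<one>\<^bsub>G Mod K\<^esub>" for g
    using that unfolding proj_def by (metis coset_join1 is_subgroup one_FactGroup subset)
  note ev = word_eval_closed[OF assms(1) qY]
  have fX: "f x \<in> carrier G" if "x \<in> X" for x using assms(5) that by auto
  \<comment> \<open>The first family makes the relators of \<open>G Mod K\<close> hold for the
    lifts. The second lets each generator \<open>f x\<close> be rewritten in the lifts,
    \<open>W x\<close> being a word for its coset.\<close>
  define T where "T = word_eval G q ` R \<union> (\<lambda>x. f x \<otimes> inv word_eval G q (W x)) ` X"
  show thesis
  proof (rule that)
    show "finite T" using Y assms(4) by (auto simp: T_def)
    show "T \<subseteq> K"
    proof -
      have "word_eval G q r \<in> K" if "r \<in> R" for r
      proof (rule proj1)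
        show "word_eval G q r \<in> carrier G" using that R ev by auto
        show "proj (word_eval G q r) = \<one>\<^bsub>G Mod K\<^esub>"
          using that R Y(3) eval[of r] by (auto simp: presents_def)
      qed
      moreover have "f x \<otimes> inv word_eval G q (W x) \<in> K" if "x \<in> X" for x
        using W[OF that] eval[of "W x"] fX[OF that] ev by (intro proj_eq) auto
      ultimately show ?thesis by (auto simp: T_def)
    qed
    fix N assume N: "N \<lhd> G" "T \<subseteq> N"
    interpret N: normal N G by fact
    interpret QN: group "G Mod N" by (rule N.factorgroup_is_group)
    define pr where "pr = (\<lambda>g. N #>\<^bsub>G\<^esub> g)"
    have pr: "pr \<in> hom G (G Mod N)" unfolding pr_def by (rule N.r_coset_hom_Mod)
    have prq: "pr \<circ> q \<in> Y \<rightarrow> carrier (G Mod N)" using pr qY by (auto simp: hom_def Pi_iff)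
    have pr_one: "pr g = \<one>\<^bsub>G Mod N\<^esub>" if "g \<in> N" for g
      using that by (simp add: pr_def coset_join2 N.is_subgroup)
    have evN: "pr (word_eval G q w) = word_eval (G Mod N) (pr \<circ> q) w" if "w \<in> words Y" for w
      by (rule word_eval_hom[OF assms(1) QN.is_group pr qY that])
    show "K \<subseteq> N"
    proof
      fix k assume k: "k \<in> K"
      then have kG: "k \<in> carrier G" using subset by auto
      \<comment> \<open>Rewriting the letters of \<open>v\<close> through \<open>W\<close> preserves
        the images in both quotients at once: modulo \<open>K\<close> by the choice of
        \<open>W\<close>, modulo \<open>N\<close> by the second family in \<open>T\<close>.\<close>
      have lift: "\<exists>w\<in>words Y. proj (word_eval G q w) = proj (word_eval G f v) \<and>
          pr (word_eval G q w) = pr (word_eval G f v)" if "v \<in> words X" for v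
        using that
      proof (induction v rule: words_induct)
        case Nil
        then show ?case by (intro bexI[of _ "[]"]) auto
      next
        case (Cons x b v)
        then obtain w where w: "w \<in> words Y" "proj (word_eval G q w) = proj (word_eval G f v)"
          "pr (word_eval G q w) = pr (word_eval G f v)" by blast
        let ?u = "if b then W x else word_inv (W x)"
        let ?g = "if b then f x else inv f x"
        note Wx = W[OF Cons(1)]
        have eu: "word_eval G q ?u = (if b then word_eval G q (W x) else inv word_eval G q (W x))"
          using Wx by (simp add: word_eval_inv[OF assms(1) qY])
        interpret pj: group_hom G "G Mod K" proj
          using proj by (simp add: group_hom_def group_hom_axioms_def)
        interpret pn: group_hom G "G Mod N" pr
          using pr by (simp add: group_hom_def group_hom_axioms_def)
        have 1: "proj (word_eval G q (W x)) = proj (f x)" using Wx eval by simp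
        have "f x \<otimes> inv word_eval G q (W x) \<in> N" using N(2) Cons(1) by (auto simp: T_def)
        then have "pr (f x \<otimes> inv word_eval G q (W x)) = \<one>\<^bsub>G Mod N\<^esub>" by (rule pr_one)
        moreover have "f x = f x \<otimes> inv word_eval G q (W x) \<otimes> word_eval G q (W x)"
          using Wx fX[OF Cons(1)] ev by (simp add: m_assoc)
        ultimately have 2: "pr (f x) = pr (word_eval G q (W x))"
          using Wx fX[OF Cons(1)] ev
          by (metis QN.l_one inv_closed m_closed pn.hom_closed pn.hom_mult)
        show ?case
        proof (intro bexI[of _ "?u @ w"] conjI)
          show "?u @ w \<in> words Y" using Wx w by auto
          show "proj (word_eval G q (?u @ w)) = proj (word_eval G f ((x, b) # v))"
            using Wx w fX[OF Cons(1)] ev 1 word_eval_closed[OF assms(1,5) Cons(2)]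
            by (simp add: word_eval_append[OF assms(1) qY] eu)
          show "pr (word_eval G q (?u @ w)) = pr (word_eval G f ((x, b) # v))"
            using Wx w fX[OF Cons(1)] ev 2 word_eval_closed[OF assms(1,5) Cons(2)]
            by (simp add: word_eval_append[OF assms(1) qY] eu)
        qed
      qed
      obtain v where v: "v \<in> words X" "k = word_eval G f v" using kG assms(6) by blast
      obtain w where w: "w \<in> words Y" "proj (word_eval G q w) = proj k" "pr (word_eval G q w) = pr k"
        using lift[OF v(1)] v(2) by blast
      \<comment> \<open>Since \<open>k\<close> is trivial modulo \<open>K\<close>, its rewritten
        word is a consequence of \<open>R\<close>, and these relators also hold in
        \<open>G Mod N\<close>.\<close>
      have "proj k = \<one>\<^bsub>G Mod K\<^esub>" using k by (simp add: proj_def coset_join2 is_subgroup kG)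
      then have "pres_eq Y R w []" using w eval Y(3) by (simp add: presents_def words_def)
      then have "word_eval (G Mod N) (pr \<circ> q) w = word_eval (G Mod N) (pr \<circ> q) []"
      proof (rule pres_eq_imp_word_eval_eq[OF _ QN.is_group prq R])
        fix r assume r: "r \<in> R"
        then have "word_eval G q r \<in> N" using N(2) by (auto simp: T_def)
        then show "word_eval (G Mod N) (pr \<circ> q) r = \<one>\<^bsub>G Mod N\<^esub>"
          using evN[of r] pr_one r R by auto
      qed
      then have "pr k = N" using w evN by simp
      then show "k \<in> N" using kG rcos_self[OF kG N.is_subgroup] by (simp add: pr_def)
    qed
  qed
qed

section \<open>Cocycles with finitely many values\<close>

text \<open>Free of topology: \<open>\<Omega>\<close> is a bare set, and the finite brick partitions
  survive only as finiteness of the set of values of each \<open>coc a\<close>. This is what bounds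
  the generators and relators obtained below.\<close>

locale cocycle =
  \<Gamma>: group \<Gamma> + G: group G
  for \<Gamma> :: "('a, 'c) monoid_scheme" and G :: "('g, 'd) monoid_scheme" +
  fixes \<Omega> :: "'p set" and act :: "'a \<Rightarrow> 'p \<Rightarrow> 'p" and coc :: "'a \<Rightarrow> 'p \<Rightarrow> 'g"
  assumes act_closed: "a \<in> carrier \<Gamma> \<Longrightarrow> p \<in> \<Omega> \<Longrightarrow> act a p \<in> \<Omega>"
    and act_one: "p \<in> \<Omega> \<Longrightarrow> act \<one>\<^bsub>\<Gamma>\<^esub> p = p"
    and act_mult: "a \<in> carrier \<Gamma> \<Longrightarrow> b \<in> carrier \<Gamma> \<Longrightarrow> p \<in> \<Omega> \<Longrightarrow>
      act (a \<otimes>\<^bsub>\<Gamma>\<^esub> b) p = act a (act b p)"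
    and coc_closed: "a \<in> carrier \<Gamma> \<Longrightarrow> p \<in> \<Omega> \<Longrightarrow> coc a p \<in> carrier G"
    and coc_mult: "a \<in> carrier \<Gamma> \<Longrightarrow> b \<in> carrier \<Gamma> \<Longrightarrow> p \<in> \<Omega> \<Longrightarrow>
      coc (a \<otimes>\<^bsub>\<Gamma>\<^esub> b) p = coc a (act b p) \<otimes>\<^bsub>G\<^esub> coc b p"
    and finite_coc: "a \<in> carrier \<Gamma> \<Longrightarrow> finite (coc a ` \<Omega>)"
begin

lemma coc_one: "p \<in> \<Omega> \<Longrightarrow> coc \<one>\<^bsub>\<Gamma>\<^esub> p = \<one>\<^bsub>G\<^esub>"
  using coc_mult[of "\<one>\<^bsub>\<Gamma>\<^esub>" "\<one>\<^bsub>\<Gamma>\<^esub>" p] coc_closed[of "\<one>\<^bsub>\<Gamma>\<^esub>" p] act_one by simp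

text \<open>Going backwards along \<open>a\<close> from \<open>p\<close> crosses the edge that
  \<open>a\<close> traverses from the point \<open>inv a\<close> moves \<open>p\<close> to. This is
  why \<open>coc_word\<close> evaluates the cocycle at that point when it reads an inverse
  letter.\<close>

lemma coc_inv:
  assumes "a \<in> carrier \<Gamma>" "p \<in> \<Omega>"
  shows "coc (inv\<^bsub>\<Gamma>\<^esub> a) p = inv\<^bsub>G\<^esub> coc a (act (inv\<^bsub>\<Gamma>\<^esub> a) p)"
proof -
  have "coc a (act (inv\<^bsub>\<Gamma>\<^esub> a) p) \<otimes>\<^bsub>G\<^esub> coc (inv\<^bsub>\<Gamma>\<^esub> a) p = \<one>\<^bsub>G\<^esub>"
    using coc_mult[of a "inv\<^bsub>\<Gamma>\<^esub> a" p] assms coc_one by simp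
  then show ?thesis
    using assms by (metis G.inv_comm G.inv_equality \<Gamma>.inv_closed act_closed coc_closed)
qed

text \<open>The values of the cocycle along the path that \<open>w\<close> traces from \<open>p\<close>.\<close>

fun coc_word :: "('x \<Rightarrow> 'a) \<Rightarrow> ('x \<times> bool) list \<Rightarrow> 'p \<Rightarrow> ('g \<times> bool) list" where
  "coc_word f [] p = []"
| "coc_word f ((x, b) # w) p =
     (let q = act (word_eval \<Gamma> f w) p
      in (coc (f x) (if b then q else act (inv\<^bsub>\<Gamma>\<^esub> f x) q), b) # coc_word f w p)"

definition coc_gens :: "('x \<Rightarrow> 'a) \<Rightarrow> 'x set \<Rightarrow> 'g set" where
  "coc_gens f X = (\<Union>x\<in>X. coc (f x) ` \<Omega>)"

context
  fixes f :: "'x \<Rightarrow> 'a" and X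
  assumes f: "f \<in> X \<rightarrow> carrier \<Gamma>"
begin

lemma eval_closed: "w \<in> words X \<Longrightarrow> word_eval \<Gamma> f w \<in> carrier \<Gamma>"
  using f by (rule word_eval_closed[OF \<Gamma>.is_group])

lemma f_closed: "x \<in> X \<Longrightarrow> f x \<in> carrier \<Gamma>"
  using f by auto

lemma coc_word_append:
  assumes "v \<in> words X" "w \<in> words X" "p \<in> \<Omega>"
  shows "coc_word f (v @ w) p = coc_word f v (act (word_eval \<Gamma> f w) p) @ coc_word f w p"
  using assms(1)
  by (induction v rule: words_induct)
    (use assms in \<open>auto simp: Let_def act_mult word_eval_append[OF \<Gamma>.is_group f] eval_closed\<close>)

lemma coc_gens_closed: "coc_gens f X \<subseteq> carrier G"
  using f_closed coc_closed by (auto simp: coc_gens_def)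

lemma coc_word_words:
  assumes "w \<in> words X" "p \<in> \<Omega>"
  shows "coc_word f w p \<in> words (coc_gens f X)"
  using assms(1)
proof (induction w rule: words_induct)
  case (Cons x b w)
  let ?q = "act (word_eval \<Gamma> f w) p"
  have "?q \<in> \<Omega>" "act (inv\<^bsub>\<Gamma>\<^esub> f x) ?q \<in> \<Omega>"
    using Cons assms f_closed eval_closed by (auto intro!: act_closed)
  then show ?case using Cons by (auto simp: Let_def coc_gens_def)
qed simp

lemma length_coc_word: "length (coc_word f w p) = length w"
  by (induction w) (auto simp: Let_def)

lemma word_eval_coc_word:
  assumes "w \<in> words X" "p \<in> \<Omega>"
  shows "word_eval G id (coc_word f w p) = coc (word_eval \<Gamma> f w) p"
  using assms(1)
proof (induction w rule: words_induct)
  case Nil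
  then show ?case using assms coc_one by simp
next
  case (Cons x b w)
  then show ?case using assms f_closed eval_closed
    by (auto simp: Let_def coc_mult coc_inv act_closed)
qed

text \<open>In a product the left factor is read from the point reached by the right one. So the
  starting point varies in the induction, and equivalent right factors must reach the same point,
  which holds because the relators are trivial in \<open>\<Gamma>\<close>. A cancelling pair crosses
  one edge back and forth and yields one letter with opposite signs.\<close>

lemma coc_word_pres_eq:
  assumes "pres_eq X R v w" "p \<in> \<Omega>" "R \<subseteq> words X" "\<forall>r\<in>R. word_eval \<Gamma> f r = \<one>\<^bsub>\<Gamma>\<^esub>"
    and R': "\<And>r q. r \<in> R \<Longrightarrow> q \<in> \<Omega> \<Longrightarrow> coc_word f r q \<in> R'"
  shows "pres_eq (coc_gens f X) R' (coc_word f v p) (coc_word f w p)"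
  using assms(1,2)
proof (induction arbitrary: p rule: pres_eq.induct)
  case (pres_refl w)
  then show ?case by (intro pres_eq_refl coc_word_words) (auto simp: words_def)
next
  case (pres_trans u v w)
  then show ?case by (metis pres_eq.pres_trans)
next
  case (pres_append v v' w w')
  have l: "v \<in> words X" "v' \<in> words X" "w \<in> words X" "w' \<in> words X"
    using pres_eq_lists pres_append assms(3) by blast+
  have "word_eval \<Gamma> f w = word_eval \<Gamma> f w'"
    using pres_eq_imp_word_eval_eq[OF pres_append(2) \<Gamma>.is_group f assms(3)] assms(4) by blast
  then show ?case using pres_append l eval_closed act_closed
    by (auto simp: coc_word_append intro!: pres_eq.pres_append)
next
  case (pres_cancel x b)
  have "act (inv\<^bsub>\<Gamma>\<^esub> f x) p \<in> \<Omega>" using pres_cancel f_closed by (auto intro!: act_closed)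
  then have "coc (f x) (if b then act (inv\<^bsub>\<Gamma>\<^esub> f x) p else p) \<in> coc_gens f X"
    using pres_cancel by (auto simp: coc_gens_def)
  from pres_eq.pres_cancel[OF this, of R' b] show ?case
    using pres_cancel f_closed by (cases b) (auto simp: Let_def act_one act_mult[symmetric])
next
  case (pres_relator r)
  then show ?case using R' by (auto intro: pres_eq.pres_relator)
qed (auto intro: pres_sym)

end

text \<open>
  The relators \<open>coc_word f r p\<close> present a group \<open>H\<close> to which the cocycle lifts.  Evaluated at
  the fixed point, the lifted cocycle splits the projection \<open>H \<rightarrow> G\<close>, so finitely many further
  relators, saying that the generators of \<open>H\<close> lie in the image of the splitting, present \<open>G\<close>.
\<close>

lemma finitely_presented_of_fixed_point:
  assumes "finitely_presented \<Gamma>" "\<iota> \<in> hom G \<Gamma>" "p \<in> \<Omega>"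
    and fixed: "\<And>g. g \<in> carrier G \<Longrightarrow> act (\<iota> g) p = p"
    and coc_p: "\<And>g. g \<in> carrier G \<Longrightarrow> coc (\<iota> g) p = g"
  shows "finitely_presented G"
proof -
  obtain X :: "nat set" and R f where X: "finite X" "finite R" "presents \<Gamma> X R f"
    using finitely_presentedE[OF \<Gamma>.is_group assms(1)] .
  have f: "f \<in> X \<rightarrow> carrier \<Gamma>" and R: "R \<subseteq> words X" and R1: "\<forall>r\<in>R. word_eval \<Gamma> f r = \<one>\<^bsub>\<Gamma>\<^esub>"
    using X by (auto simp: presents_def)
  interpret \<iota>: group_hom G \<Gamma> \<iota>
    using assms(2) by (simp add: group_hom_def group_hom_axioms_def G.is_group \<Gamma>.is_group)
  have "\<exists>w. w \<in> words X \<and> word_eval \<Gamma> f w = \<iota> g" if "g \<in> carrier G" for g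
    using presents_surj[OF X(3)] \<iota>.hom_closed[OF that] by metis
  then obtain W where W: "\<And>g. g \<in> carrier G \<Longrightarrow> W g \<in> words X \<and> word_eval \<Gamma> f (W g) = \<iota> g"
    by metis
  define F where "F = coc_gens f X"
  \<comment> \<open>A word for the lifted cocycle of \<open>\<iota> g\<close> at \<open>p\<close>:
    this is the splitting of the projection onto \<open>G\<close>.\<close>
  define s where "s g = coc_word f (W g) p" for g
  define R1 where "R1 = (\<Union>r\<in>R. coc_word f r ` \<Omega>)"
  define R2 where "R2 = R1 \<union> (\<lambda>g. (g, False) # s g) ` F"
  have FG: "F \<subseteq> carrier G" unfolding F_def by (rule coc_gens_closed[OF f])
  have id: "id \<in> F \<rightarrow> carrier G" using FG by auto
  have "finite (coc (f x) ` \<Omega>)" if "x \<in> X" for x using f that by (intro finite_coc) auto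
  then have finF: "finite F" unfolding F_def coc_gens_def using X(1) by simp
  \<comment> \<open>Although \<open>\<Omega>\<close> may be infinite, reading a relator keeps its
    length and uses letters from the finite set \<open>F\<close> only.\<close>
  have finR1: "finite R1"
  proof -
    have "set (coc_word f r q) \<subseteq> F \<times> UNIV" if "r \<in> R" "q \<in> \<Omega>" for r q
      using coc_word_words[OF f _ that(2), of r] R that unfolding F_def words_def by (metis lists_eq_set mem_Collect_eq subsetD)
    then have "R1 \<subseteq> (\<Union>r\<in>R. {w. set w \<subseteq> F \<times> UNIV \<and> length w = length r})"
      unfolding R1_def by (intro UN_mono) (auto simp: length_coc_word[OF f])
    moreover have "finite {w. set w \<subseteq> F \<times> (UNIV :: bool set) \<and> length w = n}" for n
      using finF by (intro finite_lists_length_eq) simp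
    then have "finite (\<Union>r\<in>R. {w. set w \<subseteq> F \<times> (UNIV :: bool set) \<and> length w = length r})"
      using X(2) by (intro finite_UN_I)
    ultimately show ?thesis by (rule finite_subset)
  qed
  have s_words: "s g \<in> words F" if "g \<in> carrier G" for g
    unfolding s_def F_def using W[OF that] assms(3) by (intro coc_word_words[OF f]) auto
  have s_eval: "word_eval G id (s g) = g" if "g \<in> carrier G" for g
    unfolding s_def using W[OF that] assms(3) coc_p[OF that]
    by (simp add: word_eval_coc_word[OF f])
  have R1_words: "R1 \<subseteq> words F" unfolding R1_def F_def using coc_word_words[OF f] R by blast
  have R2_words: "R2 \<subseteq> words F"
    using R1_words s_words FG unfolding R2_def by auto
  have lift: "pres_eq F R2 (coc_word f v q) (coc_word f w q)"
    if "v \<in> words X" "w \<in> words X" "word_eval \<Gamma> f v = word_eval \<Gamma> f w" "q \<in> \<Omega>" for v w q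
    unfolding F_def
  proof (rule coc_word_pres_eq[OF f])
    show "pres_eq X R v w" using presents_pres_eq_iff[OF \<Gamma>.is_group X(3)] that by simp
  qed (use that R R1 in \<open>auto simp: R2_def R1_def\<close>)
  \<comment> \<open>Since \<open>\<iota> h\<close> fixes \<open>p\<close>, both factors of
    \<open>W g @ W h\<close> are read from \<open>p\<close>, and the splitting becomes
    multiplicative.\<close>
  have s_mult: "pres_eq F R2 (s g @ s h) (s (g \<otimes>\<^bsub>G\<^esub> h))"
    if "g \<in> carrier G" "h \<in> carrier G" for g h
  proof -
    have gh: "g \<otimes>\<^bsub>G\<^esub> h \<in> carrier G" using that by simp
    have "pres_eq F R2 (coc_word f (W g @ W h) p) (coc_word f (W (g \<otimes>\<^bsub>G\<^esub> h)) p)"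
      using W that W[OF gh] assms(3) by (intro lift) (auto simp: word_eval_append[OF \<Gamma>.is_group f])
    then show ?thesis
      using W that assms(3) fixed by (simp add: s_def coc_word_append[OF f])
  qed
  have s_one: "pres_eq F R2 (s \<one>\<^bsub>G\<^esub>) []"
    using lift[of "W \<one>\<^bsub>G\<^esub>" "[]" p] W[of "\<one>\<^bsub>G\<^esub>"] assms(3) by (simp add: s_def)
  \<comment> \<open>The additional relator settles the positive letter. For the inverse letter,
    multiplicativity makes \<open>s\<close> of the inverse equivalent to the formal inverse of
    \<open>s g\<close>.\<close>
  have gen: "pres_eq F R2 [(g, b)] (s (if b then g else inv\<^bsub>G\<^esub> g))" if "g \<in> F" for g b
  proof -
    have gG: "g \<in> carrier G" using that FG by auto
    have "pres_eq F R2 ((g, False) # s g) []" using that by (intro pres_relator) (auto simp: R2_def)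
    then have "pres_eq F R2 ([(g, False)] @ word_inv (word_inv (s g))) []" by simp
    then have 1: "pres_eq F R2 [(g, False)] (word_inv (s g))"
      by (rule pres_eqI_inv) (use s_words[OF gG] that in auto)
    have "pres_eq F R2 (s (inv\<^bsub>G\<^esub> g) @ s g) (s \<one>\<^bsub>G\<^esub>)"
      using s_mult[of "inv\<^bsub>G\<^esub> g" g] gG by simp
    then have "pres_eq F R2 (s (inv\<^bsub>G\<^esub> g) @ word_inv (word_inv (s g))) []"
      using s_one unfolding word_inv_word_inv by (rule pres_trans)
    then have "pres_eq F R2 (s (inv\<^bsub>G\<^esub> g)) (word_inv (s g))"
      by (rule pres_eqI_inv) (use s_words gG in auto)
    with 1 have "pres_eq F R2 [(g, False)] (s (inv\<^bsub>G\<^esub> g))" by (metis pres_sym pres_trans)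
    moreover have "pres_eq F R2 [(g, True)] (s g)"
      using pres_eq_word_inv[OF 1 R2_words] by (simp add: word_inv_def[of "[_]"])
    ultimately show ?thesis by simp
  qed
  \<comment> \<open>So the splitting is onto: up to the relators, a word is determined by its value
    in \<open>G\<close>.\<close>
  have normal_form: "pres_eq F R2 w (s (word_eval G id w))" if "w \<in> words F" for w
    using that
  proof (induction w rule: words_induct)
    case Nil
    then show ?case using s_one by (simp add: pres_sym)
  next
    case (Cons g b w)
    let ?g = "if b then g else inv\<^bsub>G\<^esub> g"
    have g: "?g \<in> carrier G" using Cons FG by auto
    have "pres_eq F R2 ([(g, b)] @ w) (s ?g @ s (word_eval G id w))"
      by (rule pres_append[OF gen[OF Cons(1)] Cons(3)])
    moreover have "pres_eq F R2 (s ?g @ s (word_eval G id w)) (s (?g \<otimes>\<^bsub>G\<^esub> word_eval G id w))"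
      by (rule s_mult[OF g word_eval_closed[OF G.is_group id Cons(2)]])
    ultimately have "pres_eq F R2 ([(g, b)] @ w) (s (?g \<otimes>\<^bsub>G\<^esub> word_eval G id w))"
      by (rule pres_trans)
    then show ?case by (cases b) (simp_all add: id_def)
  qed
  have "presents G F R2 id"
    unfolding presents_def
  proof (intro conjI R2_words id ballI impI)
    fix r assume "r \<in> R2"
    then consider "r \<in> R1" | g where "g \<in> F" "r = (g, False) # s g" by (auto simp: R2_def)
    then show "word_eval G id r = \<one>\<^bsub>G\<^esub>"
    proof cases
      case 1
      then obtain r' q where "r' \<in> R" "q \<in> \<Omega>" "r = coc_word f r' q" by (auto simp: R1_def)
      then show ?thesis
        using word_eval_coc_word[OF f, of r' q] R R1 coc_one by auto
    next
      case 2
      then show ?thesis using s_eval FG by auto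
    qed
  next
    show "carrier G \<subseteq> word_eval G id ` words F"
      using s_eval s_words by (metis image_eqI subsetI)
  next
    fix w assume "w \<in> words F" "word_eval G id w = \<one>\<^bsub>G\<^esub>"
    then have "pres_eq F R2 w (s \<one>\<^bsub>G\<^esub>)" using normal_form[of w] by simp
    then show "pres_eq F R2 w []" using s_one by (rule pres_trans)
  qed
  moreover have "finite R2" using finR1 finF by (simp add: R2_def)
  ultimately show ?thesis using finF by (intro finitely_presentedI[OF G.is_group])
qed

end

section \<open>Splits and permutations\<close>

lemma topspace_cantor_pow: "topspace (cantor_pow S) = S \<rightarrow>\<^sub>E UNIV"
  by (simp add: cantor_pow_def)

lemma topspace_cantor_copies: "topspace (cantor_copies S m) = {..<m} \<times> (S \<rightarrow>\<^sub>E UNIV)"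
  by (simp add: cantor_copies_def topspace_cantor_pow comp_def)

lemma continuous_map_sum_topologyI:
  assumes "\<And>i. i \<in> I \<Longrightarrow> continuous_map (X i) Y (\<lambda>x. f (i, x))"
  shows "continuous_map (sum_topology X I) Y f"
  unfolding continuous_map_def openin_sum_topology
proof (intro conjI allI impI)
  show "f \<in> topspace (sum_topology X I) \<rightarrow> topspace Y"
    using assms by (auto simp: continuous_map_def Pi_iff)
  fix U assume "openin Y U"
  show "{x \<in> topspace (sum_topology X I). f x \<in> U} \<subseteq> Sigma I (topspace \<circ> X)"
    by auto
  show "\<forall>i\<in>I. openin (X i) {x. (i, x) \<in> {x \<in> topspace (sum_topology X I). f x \<in> U}}"
  proof
    fix i assume i: "i \<in> I"
    have "openin (X i) {x \<in> topspace (X i). f (i, x) \<in> U}"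
      using assms[OF i] \<open>openin Y U\<close> by (auto simp: continuous_map_def)
    then show "openin (X i) {x. (i, x) \<in> {x \<in> topspace (sum_topology X I). f x \<in> U}}"
      using i by simp
  qed
qed

lemma continuous_map_cantor_copiesI:
  assumes "\<And>i. i < m \<Longrightarrow> continuous_map (cantor_pow S) Y (\<lambda>\<kappa>. f (i, \<kappa>))"
  shows "continuous_map (cantor_copies S m) Y f"
  unfolding cantor_copies_def using assms by (intro continuous_map_sum_topologyI) simp

lemma continuous_map_into_cantor_copies:
  assumes "continuous_map X (cantor_pow S) f" "i < m"
  shows "continuous_map X (cantor_copies S m) (\<lambda>x. (i, f x))"
  unfolding cantor_copies_def
  using continuous_map_compose[OF assms(1) continuous_map_component_injection[of i "{..<m}" "\<lambda>_. cantor_pow S"]]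
    assms(2) by (simp add: comp_def)

lemma brick_homeo_Nil: "\<kappa> \<in> S \<rightarrow>\<^sub>E UNIV \<Longrightarrow> brick_homeo S (\<lambda>_. []) \<kappa> = \<kappa>"
  by (auto simp: brick_homeo_def prepend_def PiE_def extensional_def)

lemma brick_Nil: "brick S (\<lambda>_. []) = S \<rightarrow>\<^sub>E UNIV"
  by (auto simp: brick_def is_prefix_def topspace_cantor_pow)

text \<open>With empty words the bricks are whole copies. This serves both sides of a permutation of
  the copies and the undivided side of a split.\<close>

lemma brick_partition_trivial:
  assumes "\<sigma> permutes {..<n}"
  shows "brick_partition S n n \<sigma> (\<lambda>_ _. [])"
proof -
  have "(\<Union>l<n. {\<sigma> l} \<times> (S \<rightarrow>\<^sub>E UNIV)) = \<sigma> ` {..<n} \<times> (S \<rightarrow>\<^sub>E UNIV)" by auto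
  then show ?thesis
    using permutes_image[OF assms] permutes_inj[OF assms]
    by (auto simp: brick_partition_def brick_index_def brick_Nil disjoint_family_on_def
      topspace_cantor_copies dest: injD)
qed

lemma brin_thompsonI:
  assumes "f \<in> extensional (topspace (cantor_copies S m))"
    and "homeomorphic_map (cantor_copies S m) (cantor_copies S n) f"
    and "brick_partition S m k c \<psi>" "brick_partition S n k d \<xi>"
    and "\<And>l \<kappa>. l < k \<Longrightarrow> \<kappa> \<in> S \<rightarrow>\<^sub>E UNIV \<Longrightarrow>
      f (c l, brick_homeo S (\<psi> l) \<kappa>) = (d l, brick_homeo S (\<xi> l) \<kappa>)"
  shows "f \<in> brin_thompson S m n"
  using assms unfolding brin_thompson_def topspace_cantor_pow by blast

lemma bt_perm_in_brin_thompson: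
  assumes "\<sigma> permutes {..<n}"
  shows "bt_perm S n \<sigma> \<in> brin_thompson S n n"
proof -
  let ?C = "cantor_copies S n"
  have cont: "continuous_map ?C ?C (bt_perm S n \<tau>)" if "\<tau> permutes {..<n}" for \<tau>
  proof (rule continuous_map_eq)
    show "continuous_map ?C ?C (\<lambda>(i, \<kappa>). (\<tau> i, \<kappa>))"
    proof (rule continuous_map_cantor_copiesI)
      fix i assume "i < n"
      then have "\<tau> i < n" using permutes_in_image[OF that, of i] by simp
      then show "continuous_map (cantor_pow S) ?C (\<lambda>\<kappa>. case (i, \<kappa>) of (i, \<kappa>) \<Rightarrow> (\<tau> i, \<kappa>))"
        using continuous_map_into_cantor_copies[OF continuous_map_id, of "\<tau> i" n S] by simp
    qed
  qed (auto simp: bt_perm_def)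
  have "homeomorphic_maps ?C ?C (bt_perm S n \<sigma>) (bt_perm S n (inv_into UNIV \<sigma>))"
    using cont[OF assms] cont[OF permutes_inv[OF assms]]
      permutes_in_image[OF assms] permutes_in_image[OF permutes_inv[OF assms]]
    by (auto simp: homeomorphic_maps_def bt_perm_def topspace_cantor_copies
      permutes_inverses[OF assms])
  then have "homeomorphic_map ?C ?C (bt_perm S n \<sigma>)" by (rule homeomorphic_maps_imp_map)
  then show ?thesis
    by (rule brin_thompsonI[OF _ _ brick_partition_trivial[of id n S, OF permutes_id]
          brick_partition_trivial[OF assms, of S], rotated])
      (auto simp: brick_homeo_Nil bt_perm_def topspace_cantor_copies)
qed

lemma bt_id_eq_bt_perm: "bt_id S n = bt_perm S n id"
  by (auto simp: bt_id_def bt_perm_def)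

lemma bt_id_in_brin_thompson: "bt_id S n \<in> brin_thompson S n n"
  unfolding bt_id_eq_bt_perm by (intro bt_perm_in_brin_thompson permutes_id)

text \<open>The inverse of the simple split: the number of the copy, 0 or 1, becomes the letter that
  the split deleted. It is given explicitly because the groupoid has no formal inverses.\<close>

definition bt_merge :: "'s set \<Rightarrow> 's \<Rightarrow> nat \<times> 's cantor_fun \<Rightarrow> nat \<times> 's cantor_fun" where
  "bt_merge S s = (\<lambda>(i, \<kappa>) \<in> topspace (cantor_copies S 2). (0, \<kappa>(s := prepend [i = 1] (\<kappa> s))))"

lemma brick_partition_split:
  assumes "s \<in> S"
  shows "brick_partition S 1 2 (\<lambda>_. 0) (\<lambda>l. (\<lambda>_. [])(s := [l = 1]))"
proof -
  have brick: "brick S ((\<lambda>_. [])(s := [b])) = {\<kappa> \<in> S \<rightarrow>\<^sub>E UNIV. \<kappa> s 0 = b}" for b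
    using assms by (auto simp: brick_def is_prefix_def topspace_cantor_pow)
  have "{..<2::nat} = {0, 1}" by auto
  then show ?thesis
    by (auto simp: brick_partition_def brick brick_index_def disjoint_family_on_def topspace_cantor_copies)
qed

lemma bt_split_merge:
  assumes "s \<in> S"
  shows homeomorphic_maps_bt_split_merge:
      "homeomorphic_maps (cantor_copies S 1) (cantor_copies S 2) (bt_split S s) (bt_merge S s)"
    and bt_split_in_brin_thompson: "bt_split S s \<in> brin_thompson S 1 2"
    and bt_merge_in_brin_thompson: "bt_merge S s \<in> brin_thompson S 2 1"
proof -
  \<comment> \<open>Prefixing a letter and deleting one both change a single coordinate by a
    continuous map of the Cantor set, so continuity is checked coordinate by coordinate.\<close>
  have upd: "continuous_map (cantor_pow S) (cantor_pow S) (\<lambda>\<kappa>. \<kappa>(s := h (\<kappa> s)))"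
    if "continuous_on UNIV h" for h :: "(nat \<Rightarrow> bool) \<Rightarrow> nat \<Rightarrow> bool"
    unfolding cantor_pow_def continuous_map_componentwise
  proof (intro conjI ballI)
    show "(\<lambda>\<kappa>. \<kappa>(s := h (\<kappa> s))) ` topspace (product_topology (\<lambda>_. euclidean) S) \<subseteq> extensional S"
      using assms by (auto simp: extensional_def)
    fix t assume t: "t \<in> S"
    have 1: "continuous_map (product_topology (\<lambda>_. euclidean) S) euclidean (\<lambda>\<kappa>. \<kappa> s)"
      using assms by (rule continuous_map_product_projection)
    have "continuous_map (product_topology (\<lambda>_. euclidean) S) euclidean (\<lambda>\<kappa>. h (\<kappa> s))"
      using continuous_map_compose[OF 1, of euclidean h] that by (simp add: comp_def)
    moreover have "continuous_map (product_topology (\<lambda>_. euclidean) S) euclidean (\<lambda>\<kappa>. \<kappa> t)"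
      using t by (rule continuous_map_product_projection)
    ultimately show "continuous_map (product_topology (\<lambda>_. euclidean) S) euclidean
        (\<lambda>\<kappa>. (\<kappa>(s := h (\<kappa> s))) t)"
      by (cases "t = s") auto
  qed
  have "continuous_on UNIV (prepend [b])" for b
    unfolding prepend_def
  proof (rule continuous_on_coordinatewise_then_product)
    fix i
    show "continuous_on UNIV (\<lambda>\<alpha>. if i < length [b] then [b] ! i else \<alpha> (i - length [b]))"
      by (cases i) (auto intro!: continuous_intros)
  qed
  then have cont_merge: "continuous_map (cantor_copies S 2) (cantor_copies S 1) (bt_merge S s)"
    unfolding bt_merge_def
    by (intro continuous_map_eq[OF continuous_map_cantor_copiesI, of _ _ _ "\<lambda>(i, \<kappa>). (0, \<kappa>(s := prepend [i = 1] (\<kappa> s)))"])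
      (auto intro!: continuous_map_into_cantor_copies upd)
  let ?sh = "\<lambda>\<kappa>. \<kappa>(s := (\<lambda>n. \<kappa> s (Suc n)))"
  have "continuous_on UNIV (\<lambda>\<alpha> n. \<alpha> (Suc n) :: bool)"
    by (intro continuous_on_coordinatewise_then_product) (auto intro!: continuous_intros)
  then have sh: "continuous_map (cantor_pow S) (cantor_pow S) ?sh" by (rule upd)
  \<comment> \<open>Each half is a fibre of a continuous map to the discrete set of letters, hence
    open; the split is continuous because it is so on each half.\<close>
  have half: "openin (cantor_pow S) {\<kappa> \<in> S \<rightarrow>\<^sub>E UNIV. \<kappa> s 0 = b}" for b
  proof -
    have 1: "continuous_map (cantor_pow S) euclidean (\<lambda>\<kappa>. \<kappa> s)"
      unfolding cantor_pow_def using assms by (rule continuous_map_product_projection)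
    have 2: "continuous_map euclidean euclidean (\<lambda>\<alpha> :: nat \<Rightarrow> bool. \<alpha> 0)"
      by (auto intro!: continuous_intros)
    have "continuous_map (cantor_pow S) euclidean (\<lambda>\<kappa>. \<kappa> s 0)"
      using continuous_map_compose[OF 1 2] by (simp add: comp_def)
    from openin_continuous_map_preimage[OF this, of "{b}"] show ?thesis
      by (simp add: topspace_cantor_pow open_discrete)
  qed
  have cont_split: "continuous_map (cantor_copies S 1) (cantor_copies S 2) (bt_split S s)"
  proof -
    have "continuous_map (cantor_pow S) (cantor_copies S 2) (\<lambda>\<kappa>. (if \<kappa> s 0 then 1 else 0, ?sh \<kappa>))"
      unfolding continuous_map_def
    proof (intro conjI allI impI)
      show "(\<lambda>\<kappa>. (if \<kappa> s 0 then 1 else 0, ?sh \<kappa>)) \<in> topspace (cantor_pow S) \<rightarrow> topspace (cantor_copies S 2)"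
        using assms by (auto simp: topspace_cantor_copies topspace_cantor_pow PiE_def extensional_def)
      fix U assume U: "openin (cantor_copies S 2) U"
      have "openin (cantor_pow S) {\<kappa> \<in> topspace (cantor_pow S). ?sh \<kappa> \<in> {x. (i, x) \<in> U}}" if "i < 2" for i
        using that U sh unfolding cantor_copies_def openin_sum_topology by (intro openin_continuous_map_preimage) auto
      then have "openin (cantor_pow S)
          (({\<kappa> \<in> S \<rightarrow>\<^sub>E UNIV. \<kappa> s 0 = False} \<inter> {\<kappa> \<in> topspace (cantor_pow S). ?sh \<kappa> \<in> {x. (0, x) \<in> U}}) \<union>
           ({\<kappa> \<in> S \<rightarrow>\<^sub>E UNIV. \<kappa> s 0 = True} \<inter> {\<kappa> \<in> topspace (cantor_pow S). ?sh \<kappa> \<in> {x. (1, x) \<in> U}}))"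
        by (intro openin_Un openin_Int half) auto
      also have "\<dots> = {\<kappa> \<in> topspace (cantor_pow S). (if \<kappa> s 0 then 1 else 0, ?sh \<kappa>) \<in> U}"
        by (auto simp: topspace_cantor_pow)
      finally show "openin (cantor_pow S) \<dots>" .
    qed
    then show ?thesis unfolding bt_split_def
      by (intro continuous_map_eq[OF continuous_map_cantor_copiesI, of _ _ _ "\<lambda>(i, \<kappa>). (if \<kappa> s 0 then 1 else 0, ?sh \<kappa>)"]) auto
  qed
  have fun1: "\<alpha> 0 \<Longrightarrow> prepend [True] (\<lambda>n. \<alpha> (Suc n)) = \<alpha>"
    "\<not> \<alpha> 0 \<Longrightarrow> prepend [False] (\<lambda>n. \<alpha> (Suc n)) = \<alpha>" for \<alpha>
    by (auto simp: prepend_def fun_eq_iff)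
  have fun2: "prepend [b] \<alpha> 0 = b" "prepend [b] \<alpha> (Suc n) = \<alpha> n" for b \<alpha> n
    by (auto simp: prepend_def)
  have inv1: "bt_merge S s (bt_split S s p) = p" if "p \<in> topspace (cantor_copies S 1)" for p
    using that assms fun1
    by (auto simp: bt_merge_def bt_split_def topspace_cantor_copies PiE_def extensional_def)
  have inv2: "bt_split S s (bt_merge S s p) = p" if "p \<in> topspace (cantor_copies S 2)" for p
    using that assms
    by (auto simp: bt_merge_def bt_split_def topspace_cantor_copies PiE_def extensional_def fun2)
  show hom: "homeomorphic_maps (cantor_copies S 1) (cantor_copies S 2) (bt_split S s) (bt_merge S s)"
    using cont_split cont_merge inv1 inv2 by (auto simp: homeomorphic_maps_def)
  have merge: "bt_merge S s (l, brick_homeo S (\<lambda>_. []) \<kappa>)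
      = (0, brick_homeo S ((\<lambda>_. [])(s := [l = 1])) \<kappa>)"
    if "l < 2" "\<kappa> \<in> S \<rightarrow>\<^sub>E UNIV" for l \<kappa>
    using that assms
    by (auto simp: brick_homeo_Nil) (auto simp: brick_homeo_def bt_merge_def topspace_cantor_copies prepend_def fun_eq_iff PiE_def extensional_def)
  have split: "bt_split S s (0, brick_homeo S ((\<lambda>_. [])(s := [l = 1])) \<kappa>)
      = (l, brick_homeo S (\<lambda>_. []) \<kappa>)"
    if "l < 2" "\<kappa> \<in> S \<rightarrow>\<^sub>E UNIV" for l \<kappa>
    using that inv2[of "(l, \<kappa>)"] merge[OF that]
    by (auto simp: brick_homeo_Nil topspace_cantor_copies)
  have part: "brick_partition S 2 2 (\<lambda>l. l) (\<lambda>_ _. [])"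
    using brick_partition_trivial[of id 2 S, OF permutes_id] by (simp add: id_def)
  show "bt_split S s \<in> brin_thompson S 1 2"
    by (rule brin_thompsonI[OF _ homeomorphic_maps_imp_map[OF hom] brick_partition_split[OF assms] part split])
      (simp only: bt_split_def restrict_extensional)
  show "bt_merge S s \<in> brin_thompson S 2 1"
    by (rule brin_thompsonI[OF _ homeomorphic_maps_imp_map[OF hom[unfolded homeomorphic_maps_sym[of "cantor_copies S 1"]]]
          part brick_partition_split[OF assms] merge])
      (simp only: bt_merge_def restrict_extensional)
qed

lemma compose_bt_split_merge:
  assumes "s \<in> S"
  shows "compose (topspace (cantor_copies S 1)) (bt_merge S s) (bt_split S s) = bt_id S 1"
    and "compose (topspace (cantor_copies S 2)) (bt_split S s) (bt_merge S s) = bt_id S 2"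
  using homeomorphic_maps_bt_split_merge[OF assms]
  by (auto simp: homeomorphic_maps_def compose_def bt_id_def)

section \<open>The action on points and its cocycle\<close>

declare One_nat_def [simp del]

locale twisted_groupoid = group_action G S \<phi>
  for G :: "('g, 'b) monoid_scheme" (structure) and S :: "'s set" and \<phi> :: "'g \<Rightarrow> 's \<Rightarrow> 's"
begin

sublocale G: group G
  by (rule group_hom.axioms(1)[OF group_hom])

abbreviation mor :: "nat \<Rightarrow> nat \<Rightarrow> ('g, 's) tw_expr \<Rightarrow> bool" where
  "mor \<equiv> tw_mor G S"

abbreviation eq :: "nat \<Rightarrow> nat \<Rightarrow> ('g, 's) tw_expr \<Rightarrow> ('g, 's) tw_expr \<Rightarrow> bool" where
  "eq \<equiv> tw_eq G S \<phi>"

abbreviation cls :: "('g, 's) tw_expr \<Rightarrow> ('g, 's) tw_expr set" where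
  "cls \<equiv> tw_class G S \<phi>"

abbreviation SVG :: "('g, 's) tw_expr set monoid" where
  "SVG \<equiv> twisted_BT_group G S \<phi>"

abbreviation Id :: "nat \<Rightarrow> ('g, 's) tw_expr" where
  "Id n \<equiv> BT n n (bt_id S n)"

lemma mor_Id: "1 \<le> n \<Longrightarrow> mor n n (Id n)"
  by (intro mor_BT bt_id_in_brin_thompson)

lemma mor_pos: "mor m n e \<Longrightarrow> 1 \<le> m \<and> 1 \<le> n"
  by (induction rule: tw_mor.induct) auto

section \<open>The group at the object 1\<close>

lemma cls_eq_iff: "mor 1 1 e \<Longrightarrow> cls e = cls e' \<longleftrightarrow> eq 1 1 e e'"
  using tw_refl[of G S 1 1 e \<phi>] unfolding tw_class_def by (auto intro: tw_sym tw_trans)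

lemma carrier_SVG: "carrier SVG = cls ` {e. mor 1 1 e}"
  and one_SVG: "\<one>\<^bsub>SVG\<^esub> = cls (Id 1)"
  by (auto simp: twisted_BT_group_def)

lemma cls_closed: "mor 1 1 e \<Longrightarrow> cls e \<in> carrier SVG"
  by (auto simp: carrier_SVG)

lemma cls_mult:
  assumes "mor 1 1 a" "mor 1 1 b"
  shows "cls a \<otimes>\<^bsub>SVG\<^esub> cls b = cls (Cmp a b)"
proof -
  have "cls (Cmp a' b') = cls (Cmp a b)" if "a' \<in> cls a" "b' \<in> cls b" for a' b'
  proof -
    have "eq 1 1 (Cmp a b) (Cmp a' b')"
      using that by (intro tw_Cmp) (auto simp: tw_class_def)
    then show ?thesis using cls_eq_iff[OF mor_Cmp[OF assms]] by metis
  qed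
  then have "(\<Union>a'\<in>cls a. \<Union>b'\<in>cls b. cls (Cmp a' b')) = (\<Union>a'\<in>cls a. \<Union>b'\<in>cls b. cls (Cmp a b))"
    by (intro SUP_cong refl) auto
  moreover have "a \<in> cls a" "b \<in> cls b" using assms by (auto simp: tw_class_def intro: tw_refl)
  then have "(\<Union>a'\<in>cls a. \<Union>b'\<in>cls b. cls (Cmp a b)) = cls (Cmp a b)" by blast
  ultimately show ?thesis by (simp add: twisted_BT_group_def)
qed

lemma monoid_SVG: "monoid SVG"
proof (rule monoidI)
  show "\<one>\<^bsub>SVG\<^esub> \<in> carrier SVG" by (simp add: one_SVG cls_closed mor_Id)
next
  fix A B assume "A \<in> carrier SVG" "B \<in> carrier SVG"
  then show "A \<otimes>\<^bsub>SVG\<^esub> B \<in> carrier SVG"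
    by (auto simp: carrier_SVG cls_mult intro: mor_Cmp)
next
  fix A B C assume "A \<in> carrier SVG" "B \<in> carrier SVG" "C \<in> carrier SVG"
  then obtain a b c where "A = cls a" "B = cls b" "C = cls c" "mor 1 1 a" "mor 1 1 b" "mor 1 1 c"
    by (auto simp: carrier_SVG)
  then show "A \<otimes>\<^bsub>SVG\<^esub> B \<otimes>\<^bsub>SVG\<^esub> C = A \<otimes>\<^bsub>SVG\<^esub> (B \<otimes>\<^bsub>SVG\<^esub> C)"
    using tw_Cmp_assoc[of G S 1 1 a 1 b 1 c \<phi>] mor_Cmp[of G S 1 1 _ 1]
    by (simp add: cls_mult cls_eq_iff)
next
  fix A assume "A \<in> carrier SVG"
  then obtain a where "A = cls a" "mor 1 1 a" by (auto simp: carrier_SVG)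
  then show "\<one>\<^bsub>SVG\<^esub> \<otimes>\<^bsub>SVG\<^esub> A = A" "A \<otimes>\<^bsub>SVG\<^esub> \<one>\<^bsub>SVG\<^esub> = A"
    using tw_id_left[of G S 1 1 a] tw_id_right[of G S 1 1 a] mor_Cmp[of G S 1 1 _ 1]
    by (simp_all add: one_SVG cls_mult mor_Id cls_eq_iff)
qed

text \<open>The rules directly give the monoid axioms. Inverses are imported along the isomorphism
  with a presented group, which is a group by construction.\<close>

lemma group_SVG:
  assumes "finitely_presented SVG"
  shows "group SVG"
  using assms group.iso_imp_group[OF group_presented_group _ monoid_SVG]
  unfolding finitely_presented_def by blast

section \<open>Interpretation of expressions by an action and a cocycle\<close>

definition shuffle :: "'g \<Rightarrow> 's cantor_fun \<Rightarrow> 's cantor_fun" where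
  "shuffle g \<kappa> = (\<lambda>s\<in>S. \<kappa> (\<phi> (inv g) s))"

lemma shuffle_closed: "shuffle g \<kappa> \<in> S \<rightarrow>\<^sub>E UNIV"
  by (simp add: shuffle_def)

lemma shuffle_one: "\<kappa> \<in> S \<rightarrow>\<^sub>E UNIV \<Longrightarrow> shuffle \<one> \<kappa> = \<kappa>"
  using id_eq_one[symmetric] by (auto simp: shuffle_def PiE_def extensional_def restrict_def)

lemma shuffle_mult:
  assumes "g \<in> carrier G" "h \<in> carrier G"
  shows "shuffle (g \<otimes> h) \<kappa> = shuffle g (shuffle h \<kappa>)"
  using assms element_image[of "inv g"] composition_rule[of _ "inv h" "inv g"]
  by (auto simp: shuffle_def G.inv_mult_group restrict_def fun_eq_iff)

text \<open>Types are recomputed from the expression because the action of a direct sum must know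
  how many copies belong to its left summand.\<close>

fun src :: "('g, 's) tw_expr \<Rightarrow> nat" where
  "src (BT m n f) = m"
| "src (Tup gs) = length gs"
| "src (Cmp a b) = src b"
| "src (DSum a b) = src a + src b"

fun tgt :: "('g, 's) tw_expr \<Rightarrow> nat" where
  "tgt (BT m n f) = n"
| "tgt (Tup gs) = length gs"
| "tgt (Cmp a b) = tgt a"
| "tgt (DSum a b) = tgt a + tgt b"

text \<open>Together with \<open>coc\<close>, this is the description of a twisted Brin--Thompson
  element by a homeomorphism and a map from points to \<open>G\<close>. Both functions are total on
  raw expressions and carry meaning on well-typed ones.\<close>

fun act :: "('g, 's) tw_expr \<Rightarrow> nat \<times> 's cantor_fun \<Rightarrow> nat \<times> 's cantor_fun" where
  "act (BT m n f) p = f p"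
| "act (Tup gs) p = (fst p, shuffle (gs ! fst p) (snd p))"
| "act (Cmp a b) p = act a (act b p)"
| "act (DSum a b) p =
    (if fst p < src a then act a p
     else (tgt a + fst (act b (fst p - src a, snd p)), snd (act b (fst p - src a, snd p))))"

fun coc :: "('g, 's) tw_expr \<Rightarrow> nat \<times> 's cantor_fun \<Rightarrow> 'g" where
  "coc (BT m n f) p = \<one>"
| "coc (Tup gs) p = gs ! fst p"
| "coc (Cmp a b) p = coc a (act b p) \<otimes> coc b p"
| "coc (DSum a b) p = (if fst p < src a then coc a p else coc b (fst p - src a, snd p))"

definition pts :: "nat \<Rightarrow> (nat \<times> 's cantor_fun) set" where
  "pts m = topspace (cantor_copies S m)"

lemma mem_pts: "p \<in> pts m \<longleftrightarrow> fst p < m \<and> snd p \<in> S \<rightarrow>\<^sub>E UNIV"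
  by (cases p) (simp add: pts_def topspace_cantor_copies)

lemma brin_thompson_pts: "f \<in> brin_thompson S m n \<Longrightarrow> p \<in> pts m \<Longrightarrow> f p \<in> pts n"
  unfolding pts_def brin_thompson_def
  by (auto dest: homeomorphic_imp_surjective_map)

text \<open>Finiteness of the cocycle values passes through the induction: a composite takes its
  values among the products of two finite sets, a direct sum in the union of two, and a
  Brin--Thompson map has the sole value \<open>\<one>\<close>.\<close>

lemma mor_sound:
  assumes "mor m n e"
  shows "src e = m \<and> tgt e = n \<and> (\<forall>p\<in>pts m. act e p \<in> pts n \<and> coc e p \<in> carrier G) \<and>
    finite (coc e ` pts m)"
  using assms
proof (induction rule: tw_mor.induct)
  case (mor_BT m n f)
  then show ?case using brin_thompson_pts[OF mor_BT(3)] by (auto intro: finite_subset[of _ "{\<one>}"])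
next
  case (mor_Tup gs n)
  have "coc (Tup gs) ` pts n \<subseteq> set gs" using mor_Tup by (auto simp: mem_pts)
  then have "finite (coc (Tup gs) ` pts n)" by (rule finite_subset) simp
  then show ?case using mor_Tup shuffle_closed by (auto simp: in_lists_conv_set mem_pts)
next
  case (mor_Cmp n p e m e')
  have "coc (Cmp e e') ` pts m \<subseteq> (\<lambda>(g, h). g \<otimes> h) ` (coc e ` pts n \<times> coc e' ` pts m)"
  proof
    fix g assume "g \<in> coc (Cmp e e') ` pts m"
    then obtain x where "x \<in> pts m" "g = coc e (act e' x) \<otimes> coc e' x" by auto
    then show "g \<in> (\<lambda>(g, h). g \<otimes> h) ` (coc e ` pts n \<times> coc e' ` pts m)"
      using mor_Cmp by (intro image_eqI[of _ _ "(coc e (act e' x), coc e' x)"]) (auto intro!: imageI)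
  qed
  then have "finite (coc (Cmp e e') ` pts m)"
    by (rule finite_subset) (use mor_Cmp in auto)
  then show ?case using mor_Cmp by simp
next
  case (mor_DSum m n e m' n' e')
  have sub: "p \<in> pts m \<or> fst p \<ge> m \<and> (fst p - m, snd p) \<in> pts m'" if "p \<in> pts (m + m')" for p
    using that by (auto simp: mem_pts)
  have "coc (DSum e e') ` pts (m + m') \<subseteq> coc e ` pts m \<union> coc e' ` pts m'"
  proof
    fix g assume "g \<in> coc (DSum e e') ` pts (m + m')"
    then obtain p where p: "p \<in> pts (m + m')" "g = coc (DSum e e') p" by blast
    show "g \<in> coc e ` pts m \<union> coc e' ` pts m'"
    proof (cases "fst p < m")
      case True
      then show ?thesis using p sub[OF p(1)] mor_DSum by auto
    next
      case False
      then have "(fst p - m, snd p) \<in> pts m'" using p by (auto simp: mem_pts)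
      then show ?thesis using p False mor_DSum by auto
    qed
  qed
  then have "finite (coc (DSum e e') ` pts (m + m'))"
    by (rule finite_subset) (use mor_DSum in auto)
  moreover have "act (DSum e e') p \<in> pts (n + n') \<and> coc (DSum e e') p \<in> carrier G"
    if "p \<in> pts (m + m')" for p
  proof (cases "fst p < m")
    case True
    then have "p \<in> pts m" using that by (auto simp: mem_pts)
    then have "act e p \<in> pts n" "coc e p \<in> carrier G" using mor_DSum by blast+
    then show ?thesis using mor_DSum True by (auto simp: mem_pts)
  next
    case False
    then have "(fst p - m, snd p) \<in> pts m'" using that by (auto simp: mem_pts)
    then have "act e' (fst p - m, snd p) \<in> pts n'" "coc e' (fst p - m, snd p) \<in> carrier G"
      using mor_DSum by blast+
    then show ?thesis using mor_DSum False by (auto simp: mem_pts)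
  qed
  ultimately show ?case using mor_DSum by simp
qed

text \<open>The types of both sides are included because the sides of \<open>tw_eq\<close> are not
  assumed to be morphisms, and \<open>base\<close> below reads the types off the expression.\<close>

definition agree :: "nat \<Rightarrow> nat \<Rightarrow> ('g, 's) tw_expr \<Rightarrow> ('g, 's) tw_expr \<Rightarrow> bool" where
  "agree m n e e' \<longleftrightarrow> src e = m \<and> tgt e = n \<and> src e' = m \<and> tgt e' = n \<and>
    (\<forall>p\<in>pts m. act e p \<in> pts n \<and> coc e p \<in> carrier G \<and> act e p = act e' p \<and> coc e p = coc e' p)"

lemma agreeD:
  assumes "agree m n e e'"
  shows "src e = m" "tgt e = n" "src e' = m" "tgt e' = n"
    and "p \<in> pts m \<Longrightarrow> act e p \<in> pts n" "p \<in> pts m \<Longrightarrow> coc e p \<in> carrier G"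
    and "p \<in> pts m \<Longrightarrow> act e' p = act e p" "p \<in> pts m \<Longrightarrow> coc e' p = coc e p"
  using assms unfolding agree_def by metis+

lemma agree_sym: "agree m n e e' \<Longrightarrow> agree m n e' e"
  unfolding agree_def by metis

lemma agreeI:
  assumes "mor m n e" "src e' = m" "tgt e' = n"
    and "\<And>p. p \<in> pts m \<Longrightarrow> act e p = act e' p" "\<And>p. p \<in> pts m \<Longrightarrow> coc e p = coc e' p"
  shows "agree m n e e'"
  using mor_sound[OF assms(1)] assms(2-) unfolding agree_def by metis

lemma sum_pts_cases:
  assumes "p \<in> pts (m + m')"
  obtains "fst p < m" "p \<in> pts m" | "\<not> fst p < m" "(fst p - m, snd p) \<in> pts m'"
  using assms by (cases "fst p < m") (auto simp: mem_pts)

lemma eq_sound: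
  assumes "eq m n e e'"
  shows "agree m n e e'"
  using assms
proof (induction rule: tw_eq.induct)
  case (tw_refl m n e)
  then show ?case using mor_sound[OF tw_refl] by (simp add: agree_def)
next
  case (tw_sym m n e e')
  then show ?case unfolding agree_def by metis
next
  case (tw_trans m n e e' e'')
  then show ?case unfolding agree_def by metis
next
  case (tw_Cmp n p a a' m b b')
  show ?case
    unfolding agree_def
    using agreeD[OF tw_Cmp(3)] agreeD[OF tw_Cmp(4)] by simp
next
  case (tw_DSum m n a a' m' n' b b')
  note a = agreeD[OF tw_DSum(3)] and b = agreeD[OF tw_DSum(4)]
  have "act (DSum a b) p \<in> pts (n + n') \<and> coc (DSum a b) p \<in> carrier G \<and>
      act (DSum a b) p = act (DSum a' b') p \<and> coc (DSum a b) p = coc (DSum a' b') p"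
    if p: "p \<in> pts (m + m')" for p
    using p
  proof (cases rule: sum_pts_cases)
    case 1
    then show ?thesis using a(1-4) b(1-4) a(5-8)[OF 1(2)] by (simp add: mem_pts)
  next
    case 2
    then show ?thesis using a(1-4) b(1-4) b(5-8)[OF 2(2)] by (simp add: mem_pts)
  qed
  moreover have "src (DSum a b) = m + m'" "tgt (DSum a b) = n + n'"
    "src (DSum a' b') = m + m'" "tgt (DSum a' b') = n + n'"
    using a(1-4) b(1-4) by simp_all
  ultimately show ?case unfolding agree_def by blast
next
  case (tw_Cmp_assoc p q a n b m c)
  note s = mor_sound[OF tw_Cmp_assoc(1)] mor_sound[OF tw_Cmp_assoc(2)] mor_sound[OF tw_Cmp_assoc(3)]
  show ?case
  proof (rule agreeI)
    show "mor m q (Cmp (Cmp a b) c)" using tw_Cmp_assoc by (intro mor_Cmp)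
    fix x assume x: "x \<in> pts m"
    then have "act c x \<in> pts n" "coc c x \<in> carrier G" using s by blast+
    moreover from this have "act b (act c x) \<in> pts p" "coc b (act c x) \<in> carrier G" using s by blast+
    moreover from this have "coc a (act b (act c x)) \<in> carrier G" using s by blast
    ultimately show "coc (Cmp (Cmp a b) c) x = coc (Cmp a (Cmp b c)) x" by (simp add: G.m_assoc)
  qed (use s in simp_all)
next
  case (tw_id_left m n e)
  note s = mor_sound[OF tw_id_left]
  have id: "bt_id S n p = p" if "p \<in> pts n" for p using that by (simp add: bt_id_def pts_def)
  show ?case
    by (rule agree_sym, rule agreeI[OF tw_id_left]) (use s id in auto)
next
  case (tw_id_right m n e)
  note s = mor_sound[OF tw_id_right]
  have id: "bt_id S m p = p" if "p \<in> pts m" for p using that by (simp add: bt_id_def pts_def)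
  show ?case
    by (rule agree_sym, rule agreeI[OF tw_id_right]) (use s id in auto)
next
  case (tw_DSum_assoc m n a m' n' b m'' n'' c)
  note s = mor_sound[OF tw_DSum_assoc(1)] mor_sound[OF tw_DSum_assoc(2)] mor_sound[OF tw_DSum_assoc(3)]
  show ?case
  proof (rule agreeI)
    show "mor (m + m' + m'') (n + n' + n'') (DSum (DSum a b) c)"
      using tw_DSum_assoc by (intro mor_DSum)
    fix p :: "nat \<times> 's cantor_fun"
    have [simp]: "src a = m" "src b = m'" "src c = m''" "tgt a = n" "tgt b = n'" "tgt c = n''"
      using s by auto
    consider "fst p < m" | "\<not> fst p < m" "fst p < m + m'" | "\<not> fst p < m + m'" by linarith
    then have "act (DSum (DSum a b) c) p = act (DSum a (DSum b c)) p \<and>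
        coc (DSum (DSum a b) c) p = coc (DSum a (DSum b c)) p"
    proof cases
      case 2
      then have "fst p - m < m'" by linarith
      with 2 show ?thesis by simp
    next
      case 3
      then have "\<not> fst p < m" "\<not> fst p - m < m'" by linarith+
      with 3 show ?thesis by (simp add: add.assoc)
    qed simp
    then show "act (DSum (DSum a b) c) p = act (DSum a (DSum b c)) p"
      "coc (DSum (DSum a b) c) p = coc (DSum a (DSum b c)) p" by blast+
  qed (use s in simp_all)
next
  case (tw_interchange n p a m b n' p' a' m' b')
  note s = mor_sound[OF tw_interchange(1)] mor_sound[OF tw_interchange(2)]
    mor_sound[OF tw_interchange(3)] mor_sound[OF tw_interchange(4)]
  have [simp]: "src a = n" "tgt a = p" "src b = m" "tgt b = n"
    "src a' = n'" "tgt a' = p'" "src b' = m'" "tgt b' = n'" using s by auto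
  have eq: "act (DSum (Cmp a b) (Cmp a' b')) x = act (Cmp (DSum a a') (DSum b b')) x \<and>
      coc (DSum (Cmp a b) (Cmp a' b')) x = coc (Cmp (DSum a a') (DSum b b')) x"
    if "x \<in> pts (m + m')" for x
    using that
  proof (cases rule: sum_pts_cases)
    case 1
    then have "act b x \<in> pts n" using s by blast
    then show ?thesis using 1 by (simp add: mem_pts)
  next
    case 2
    then show ?thesis by simp
  qed
  show ?case
  proof (rule agreeI)
    show "mor (m + m') (p + p') (DSum (Cmp a b) (Cmp a' b'))"
      using tw_interchange by (intro mor_DSum mor_Cmp)
  qed (use eq in auto)
next
  case (tw_BT_Cmp m n p f f')
  show ?case
  proof (rule agreeI)
    show "mor m p (Cmp (BT n p f) (BT m n f'))"
      using tw_BT_Cmp by (intro mor_Cmp[of _ _ n] mor_BT)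
  qed (auto simp: compose_def pts_def)
next
  case (tw_BT_DSum m n m' n' f f')
  show ?case
  proof (rule agreeI)
    show "mor (m + m') (n + n') (DSum (BT m n f) (BT m' n' f'))"
      using tw_BT_DSum by (intro mor_DSum mor_BT)
  qed (auto simp: bt_sum_def pts_def apfst_def map_prod_def case_prod_unfold)
next
  case (tw_Tup_one n)
  show ?case
  proof (rule agreeI)
    show "mor n n (Tup (replicate n \<one>))"
      using tw_Tup_one by (intro mor_Tup) (auto simp: in_lists_conv_set)
  next
    fix p assume p: "p \<in> pts n"
    then show "act (Tup (replicate n \<one>)) p = act (Id n) p"
      by (auto simp: bt_id_def pts_def[symmetric] mem_pts shuffle_one)
    show "coc (Tup (replicate n \<one>)) p = coc (Id n) p" using p by (simp add: mem_pts)
  qed auto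
next
  case (tw_Tup_Cmp gs hs n)
  then have "gs ! i \<in> carrier G" "hs ! i \<in> carrier G" if "i < n" for i
    using that by (auto simp: in_lists_conv_set)
  then show ?case
  proof (intro agreeI)
    show "mor n n (Cmp (Tup gs) (Tup hs))" using tw_Tup_Cmp by (intro mor_Cmp[of _ _ n] mor_Tup)
  qed (use tw_Tup_Cmp in \<open>auto simp: shuffle_mult mem_pts\<close>)
next
  case (tw_Tup_DSum gs hs n n')
  show ?case
  proof (rule agreeI)
    show "mor (n + n') (n + n') (DSum (Tup gs) (Tup hs))"
      using tw_Tup_DSum by (intro mor_DSum mor_Tup)
  qed (use tw_Tup_DSum in \<open>auto simp: nth_append\<close>)
next
  case (tw_split g s)
  have gs: "\<phi> g s \<in> S" "\<phi> (inv g) (\<phi> g s) = s"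
    using tw_split element_image[of g] orbit_sym_aux by auto
  have inj: "\<phi> (inv g) t = s \<longleftrightarrow> t = \<phi> g s" if "t \<in> S" for t
    using that gs tw_split orbit_sym_aux[of "inv g" t] by auto
  \<comment> \<open>Shuffling carries coordinate \<open>s\<close> to \<open>\<phi> g s\<close>, so
    deleting a first letter there afterwards equals deleting it at \<open>s\<close> beforehand. By
    \<open>sh0\<close> the deleted letters agree, and with them the numbers of the copies.\<close>
  have sh: "(shuffle g \<kappa>)(\<phi> g s := (\<lambda>n. shuffle g \<kappa> (\<phi> g s) (Suc n)))
      = shuffle g (\<kappa>(s := (\<lambda>n. \<kappa> s (Suc n))))" (is "?l = ?r") for \<kappa>
  proof
    fix t
    show "?l t = ?r t"
    proof (cases "t = \<phi> g s")
      case False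
      then have "t \<in> S \<Longrightarrow> \<phi> (inv g) t \<noteq> s" using inj by blast
      then show ?thesis using False by (simp add: shuffle_def restrict_def)
    qed (use gs in \<open>simp add: shuffle_def\<close>)
  qed
  have sh0: "shuffle g \<kappa> (\<phi> g s) 0 = \<kappa> s 0" for \<kappa> using gs by (simp add: shuffle_def)
  have "s \<in> S" "g \<in> carrier G" using tw_split by auto
  show ?case
  proof (rule agreeI)
    show "mor 1 2 (Cmp (BT 1 2 (bt_split S (\<phi> g s))) (Tup [g]))"
      using tw_split gs by (intro mor_Cmp[of _ _ 1] mor_BT mor_Tup bt_split_in_brin_thompson) auto
  next
    fix p assume p: "p \<in> pts 1"
    obtain \<kappa> where p': "p = (0, \<kappa>)" "\<kappa> \<in> S \<rightarrow>\<^sub>E UNIV" using p by (cases p) (simp add: mem_pts)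
    have sp: "(0, \<kappa>') \<in> topspace (cantor_copies S 1) \<longleftrightarrow> \<kappa>' \<in> S \<rightarrow>\<^sub>E UNIV" for \<kappa>'
      by (simp add: topspace_cantor_copies)
    show "act (Cmp (BT 1 2 (bt_split S (\<phi> g s))) (Tup [g])) p =
        act (Cmp (Tup [g, g]) (BT 1 2 (bt_split S s))) p"
      using p' by (simp add: bt_split_def sp shuffle_closed sh sh0)
    show "coc (Cmp (BT 1 2 (bt_split S (\<phi> g s))) (Tup [g])) p =
        coc (Cmp (Tup [g, g]) (BT 1 2 (bt_split S s))) p"
      using p' tw_split by (simp add: bt_split_def sp)
  qed auto
next
  case (tw_perm gs n \<sigma>)
  have "gs ! i \<in> carrier G" if "i < n" for i
    using that tw_perm by (auto simp: in_lists_conv_set)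
  moreover have "\<sigma> i < n" if "i < n" for i
    using that permutes_in_image[OF tw_perm(4)] by auto
  ultimately show ?case
  proof (intro agreeI)
    show "mor n n (Cmp (Tup gs) (BT n n (bt_perm S n \<sigma>)))"
      using tw_perm by (intro mor_Cmp[of _ _ n] mor_BT mor_Tup bt_perm_in_brin_thompson)
  next
    fix p assume p: "p \<in> pts n"
    then have "(fst p, shuffle g (snd p)) \<in> pts n" for g
      by (simp add: mem_pts shuffle_closed)
    with p show "act (Cmp (Tup gs) (BT n n (bt_perm S n \<sigma>))) p =
        act (Cmp (BT n n (bt_perm S n \<sigma>)) (Tup (map (\<lambda>i. gs ! \<sigma> i) [0..<n]))) p"
      by (simp add: bt_perm_def pts_def[symmetric] case_prod_unfold) (simp add: mem_pts)
    from p show "coc (Cmp (Tup gs) (BT n n (bt_perm S n \<sigma>))) p =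
        coc (Cmp (BT n n (bt_perm S n \<sigma>)) (Tup (map (\<lambda>i. gs ! \<sigma> i) [0..<n]))) p"
      using \<open>\<And>i. i < n \<Longrightarrow> gs ! i \<in> carrier G\<close> \<open>\<And>i. i < n \<Longrightarrow> \<sigma> i < n\<close>
      by (simp add: bt_perm_def pts_def[symmetric] case_prod_unfold) (simp add: mem_pts)
  qed (use tw_perm in simp_all)
qed

section \<open>Transfer of the interpretation to classes; finite presentation of
  \<open>G\<close>\<close>

definition rep :: "('g, 's) tw_expr set \<Rightarrow> ('g, 's) tw_expr" where
  "rep A = (SOME e. mor 1 1 e \<and> cls e = A)"

lemma rep:
  assumes "A \<in> carrier SVG"
  shows mor_rep: "mor 1 1 (rep A)" and cls_rep: "cls (rep A) = A"
proof -
  have "\<exists>e. mor 1 1 e \<and> cls e = A" using assms by (auto simp: carrier_SVG)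
  then have "mor 1 1 (rep A) \<and> cls (rep A) = A" unfolding rep_def by (rule someI_ex)
  then show "mor 1 1 (rep A)" "cls (rep A) = A" by simp_all
qed

text \<open>By soundness the action and the cocycle of a class do not depend on the representative
  chosen by \<open>rep\<close>.\<close>

lemma rep_cls_sound:
  assumes "mor 1 1 e" "p \<in> pts 1"
  shows "act (rep (cls e)) p = act e p" "coc (rep (cls e)) p = coc e p"
proof -
  have "eq 1 1 (rep (cls e)) e"
    using cls_rep[of "cls e"] mor_rep[of "cls e"] cls_closed assms cls_eq_iff by blast
  from agreeD(7,8)[OF eq_sound[OF this]] show "act (rep (cls e)) p = act e p" "coc (rep (cls e)) p = coc e p"
    using assms by auto
qed

lemma cocycle_SVG:
  assumes "group SVG"
  shows "cocycle SVG G (pts 1) (\<lambda>A. act (rep A)) (\<lambda>A. coc (rep A))"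
proof -
  have Cmp: "act (rep (A \<otimes>\<^bsub>SVG\<^esub> B)) p = act (Cmp (rep A) (rep B)) p \<and>
      coc (rep (A \<otimes>\<^bsub>SVG\<^esub> B)) p = coc (Cmp (rep A) (rep B)) p"
    if "A \<in> carrier SVG" "B \<in> carrier SVG" "p \<in> pts 1" for A B p
  proof -
    have "A \<otimes>\<^bsub>SVG\<^esub> B = cls (Cmp (rep A) (rep B))"
      using cls_mult[OF mor_rep mor_rep] cls_rep that by metis
    then show ?thesis using rep_cls_sound[OF mor_Cmp[OF mor_rep mor_rep] that(3)] that by simp
  qed
  show ?thesis
  proof (intro cocycle.intro cocycle_axioms.intro assms G.is_group)
    fix p assume p: "p \<in> pts 1"
    then have "act (rep \<one>\<^bsub>SVG\<^esub>) p = act (Id 1) p"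
      unfolding one_SVG by (intro rep_cls_sound mor_Id) auto
    then show "act (rep \<one>\<^bsub>SVG\<^esub>) p = p" using p by (simp add: bt_id_def pts_def)
  next
    fix A assume A: "A \<in> carrier SVG"
    note s = mor_sound[OF mor_rep[OF A]]
    show "finite (coc (rep A) ` pts 1)" using s by blast
    fix p assume p: "p \<in> pts 1"
    show "act (rep A) p \<in> pts 1" "coc (rep A) p \<in> carrier G" using s p by blast+
    fix B assume B: "B \<in> carrier SVG"
    show "act (rep (A \<otimes>\<^bsub>SVG\<^esub> B)) p = act (rep A) (act (rep B) p)"
      "coc (rep (A \<otimes>\<^bsub>SVG\<^esub> B)) p = coc (rep A) (act (rep B) p) \<otimes> coc (rep B) p"
      using Cmp[OF A B p] by auto
  qed
qed

theorem finitely_presented_of_SVG: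
  assumes "finitely_presented SVG"
  shows "finitely_presented G"
proof -
  have grp: "group SVG" by (rule group_SVG[OF assms])
  interpret C: cocycle SVG G "pts 1" "\<lambda>A. act (rep A)" "\<lambda>A. coc (rep A)"
    by (rule cocycle_SVG[OF grp])
  define p :: "nat \<times> 's cantor_fun" where "p = (0, \<lambda>s\<in>S. \<lambda>_. False)"
  have p: "p \<in> pts 1" by (simp add: p_def mem_pts)
  have mor: "mor 1 1 (Tup [g])" if "g \<in> carrier G" for g
    using that by (intro mor_Tup) auto
  show ?thesis
  proof (rule C.finitely_presented_of_fixed_point[OF assms _ p, of "\<lambda>g. cls (Tup [g])"])
    show "(\<lambda>g. cls (Tup [g])) \<in> hom G SVG"
    proof (rule homI)
      fix g h assume gh: "g \<in> carrier G" "h \<in> carrier G"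
      then have "eq 1 1 (Cmp (Tup [g]) (Tup [h])) (Tup [g \<otimes> h])"
        using tw_Tup_Cmp[of "[g]" G "[h]" 1 S \<phi>] by auto
      then show "cls (Tup [g \<otimes> h]) = cls (Tup [g]) \<otimes>\<^bsub>SVG\<^esub> cls (Tup [h])"
        using cls_mult[OF mor mor] gh cls_eq_iff[OF mor_Cmp[OF mor mor]] by metis
    qed (auto intro: cls_closed mor)
  next
    fix g assume g: "g \<in> carrier G"
    have "shuffle g (\<lambda>s\<in>S. \<lambda>_. False) = (\<lambda>s\<in>S. \<lambda>_. False)"
      using g element_image[of "inv g"] by (auto simp: shuffle_def restrict_def fun_eq_iff)
    then show "act (rep (cls (Tup [g]))) p = p" "coc (rep (cls (Tup [g]))) p = g"
      using rep_cls_sound[OF mor[OF g] p] by (simp_all add: p_def)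
  qed
qed

end

section \<open>The kernel of the quotient map\<close>

declare tw_trans [trans]

context twisted_groupoid
begin

section \<open>Isomorphisms between objects and the functor to the group at 1\<close>

lemma eq_Cmp_left: "eq n p a a' \<Longrightarrow> mor m n b \<Longrightarrow> eq m p (Cmp a b) (Cmp a' b)"
  by (rule tw_Cmp[OF _ tw_refl])

lemma eq_Cmp_right: "eq m n b b' \<Longrightarrow> mor n p a \<Longrightarrow> eq m p (Cmp a b) (Cmp a b')"
  by (rule tw_Cmp[OF tw_refl])

text \<open>Some rules have a side, such as the composite map in \<open>tw_BT_Cmp\<close>, that is a
  morphism only once Brin--Thompson maps are known to be closed under composition or direct sum. But
  each basic rule has a visible morphism on one side, and symmetry and transitivity carry it to the
  other.\<close>

lemma eq_obtain_mor:
  assumes "eq m n e e'"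
  obtains c where "mor m n c" "eq m n e c"
proof -
  have "\<exists>c. mor m n c \<and> eq m n e c"
    using assms
  proof (induction rule: tw_eq.induct)
    case (tw_refl m n e)
    then show ?case using tw_eq.tw_refl by blast
  next
    case (tw_sym m n e e')
    then show ?case by (meson tw_eq.tw_sym tw_eq.tw_trans)
  next
    case (tw_trans m n e e' e'')
    then show ?case by blast
  next
    case (tw_Cmp n p a a' m b b')
    then show ?case by (meson tw_eq.tw_Cmp mor_Cmp)
  next
    case (tw_DSum m n a a' m' n' b b')
    then show ?case by (meson tw_eq.tw_DSum mor_DSum)
  next
    case (tw_Cmp_assoc p q a n b m c)
    then show ?case by (meson tw_eq.tw_refl mor_Cmp)
  next
    case (tw_id_left m n e)
    then show ?case by (meson tw_eq.tw_id_left)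
  next
    case (tw_id_right m n e)
    then show ?case by (meson tw_eq.tw_id_right)
  next
    case (tw_DSum_assoc m n a m' n' b m'' n'' c)
    then show ?case by (meson tw_eq.tw_refl mor_DSum)
  next
    case (tw_interchange n p a m b n' p' a' m' b')
    then show ?case by (meson tw_eq.tw_refl mor_Cmp mor_DSum)
  next
    case (tw_BT_Cmp m n p f f')
    then show ?case by (meson tw_eq.tw_refl mor_Cmp mor_BT)
  next
    case (tw_BT_DSum m n m' n' f f')
    then show ?case by (meson tw_eq.tw_refl mor_DSum mor_BT)
  next
    case (tw_Tup_one n)
    then have "mor n n (Tup (replicate n \<one>))" by (intro mor_Tup) (auto simp: in_lists_conv_set)
    then show ?case by (meson tw_eq.tw_refl)
  next
    case (tw_Tup_Cmp gs hs n)
    then have "mor n n (Cmp (Tup gs) (Tup hs))" by (intro mor_Cmp[of _ _ n] mor_Tup)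
    then show ?case by (meson tw_eq.tw_refl)
  next
    case (tw_Tup_DSum gs hs n n')
    then have "mor (n + n') (n + n') (DSum (Tup gs) (Tup hs))" by (intro mor_DSum mor_Tup)
    then show ?case by (meson tw_eq.tw_refl)
  next
    case (tw_split g s)
    then have "mor 1 2 (Cmp (BT 1 2 (bt_split S (\<phi> g s))) (Tup [g]))"
      using element_image[of g s] by (intro mor_Cmp[of _ _ 1] mor_BT mor_Tup bt_split_in_brin_thompson) auto
    then show ?case by (meson tw_eq.tw_refl)
  next
    case (tw_perm gs n \<sigma>)
    then have "mor n n (Cmp (Tup gs) (BT n n (bt_perm S n \<sigma>)))"
      by (intro mor_Cmp[of _ _ n] mor_BT mor_Tup bt_perm_in_brin_thompson)
    then show ?case by (meson tw_eq.tw_refl)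
  qed
  then show thesis using that by blast
qed

lemma cls_eqI: "eq 1 1 e e' \<Longrightarrow> cls e = cls e'"
  unfolding tw_class_def by (auto intro: tw_sym tw_trans)

definition is_iso :: "nat \<Rightarrow> nat \<Rightarrow> ('g, 's) tw_expr \<Rightarrow> ('g, 's) tw_expr \<Rightarrow> bool" where
  "is_iso m n x y \<longleftrightarrow> mor m n x \<and> mor n m y \<and> eq m m (Cmp y x) (Id m) \<and> eq n n (Cmp x y) (Id n)"

lemma Tup_ones: "1 \<le> n \<Longrightarrow> eq n n (Tup (replicate n \<one>)) (Id n)"
  by (rule tw_Tup_one)

lemma ones_lists: "replicate n \<one> \<in> lists (carrier G)"
  by (auto simp: in_lists_conv_set)

text \<open>Rewriting identities as tuples of ones turns the direct sum into concatenation of lists,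
  so the sum of the identity maps need not be computed.\<close>

lemma eq_DSum_Id:
  assumes "1 \<le> m" "1 \<le> n"
  shows "eq (m + n) (m + n) (DSum (Id m) (Id n)) (Id (m + n))"
proof -
  have "eq (m + n) (m + n) (DSum (Id m) (Id n)) (DSum (Tup (replicate m \<one>)) (Tup (replicate n \<one>)))"
    by (intro tw_DSum tw_sym[OF Tup_ones] assms)
  also have "eq (m + n) (m + n) \<dots> (Tup (replicate (m + n) \<one>))"
    unfolding replicate_add by (intro tw_Tup_DSum) (use assms ones_lists in auto)
  also have "eq (m + n) (m + n) \<dots> (Id (m + n))"
    using assms by (intro Tup_ones) simp
  finally show ?thesis .
qed

lemma is_iso_Id: "1 \<le> n \<Longrightarrow> is_iso n n (Id n) (Id n)"
  unfolding is_iso_def by (intro conjI mor_Id tw_id_left)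

lemma is_iso_DSum:
  assumes "is_iso m n x y" "is_iso m' n' x' y'"
  shows "is_iso (m + m') (n + n') (DSum x x') (DSum y y')"
proof -
  have *: "eq (m + m') (m + m') (Cmp (DSum y y') (DSum x x')) (Id (m + m'))"
    if "is_iso m n x y" "is_iso m' n' x' y'" for m n x y m' n' x' y'
  proof -
    have "eq (m + m') (m + m') (Cmp (DSum y y') (DSum x x')) (DSum (Cmp y x) (Cmp y' x'))"
      using that by (intro tw_sym[OF tw_interchange[of _ _ n _ _ _ _ n']]) (auto simp: is_iso_def)
    also have "eq (m + m') (m + m') \<dots> (DSum (Id m) (Id m'))"
      using that by (intro tw_DSum) (auto simp: is_iso_def)
    also have "eq (m + m') (m + m') \<dots> (Id (m + m'))"
      using that mor_pos by (intro eq_DSum_Id) (auto simp: is_iso_def)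
    finally show ?thesis .
  qed
  have sym: "is_iso n m y x" "is_iso n' m' y' x'" using assms by (auto simp: is_iso_def)
  show ?thesis
    using *[OF assms] *[OF sym] assms unfolding is_iso_def by (auto intro: mor_DSum)
qed

lemma is_iso_Cmp:
  assumes "is_iso m n x y" "is_iso n p x' y'"
  shows "is_iso m p (Cmp x' x) (Cmp y y')"
proof -
  have *: "eq m m (Cmp (Cmp y y') (Cmp x' x)) (Id m)"
    if "is_iso m n x y" "is_iso n p x' y'" for m n x y p x' y'
  proof -
    have t: "mor m n x" "mor n m y" "mor n p x'" "mor p n y'"
      "eq m m (Cmp y x) (Id m)" "eq n n (Cmp y' x') (Id n)"
      using that by (auto simp: is_iso_def)
    have "eq m m (Cmp (Cmp y y') (Cmp x' x)) (Cmp y (Cmp y' (Cmp x' x)))"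
      by (rule tw_Cmp_assoc[OF t(2,4) mor_Cmp[OF t(3,1)]])
    also have "eq m m \<dots> (Cmp y (Cmp (Cmp y' x') x))"
      by (rule eq_Cmp_right[OF tw_sym[OF tw_Cmp_assoc[OF t(4,3,1)]] t(2)])
    also have "eq m m \<dots> (Cmp y (Cmp (Id n) x))"
      by (rule eq_Cmp_right[OF eq_Cmp_left[OF t(6,1)] t(2)])
    also have "eq m m \<dots> (Cmp y x)"
      by (rule eq_Cmp_right[OF tw_id_left[OF t(1)] t(2)])
    also have "eq m m \<dots> (Id m)" by (rule t(5))
    finally show ?thesis .
  qed
  have sym: "is_iso n m y x" "is_iso p n y' x'" using assms by (auto simp: is_iso_def)
  show ?thesis
    using *[OF assms] *[OF sym(2,1)] assms unfolding is_iso_def by (auto intro: mor_Cmp)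
qed

lemma is_iso_split:
  assumes "s \<in> S"
  shows "is_iso 1 2 (BT 1 2 (bt_split S s)) (BT 2 1 (bt_merge S s))"
  unfolding is_iso_def
proof (intro conjI)
  note bt = bt_split_in_brin_thompson[OF assms] bt_merge_in_brin_thompson[OF assms]
  show "mor 1 2 (BT 1 2 (bt_split S s))" "mor 2 1 (BT 2 1 (bt_merge S s))"
    using bt by (auto intro: mor_BT)
  show "eq 1 1 (Cmp (BT 2 1 (bt_merge S s)) (BT 1 2 (bt_split S s))) (Id 1)"
    using tw_BT_Cmp[of 1 2 1 "bt_merge S s" S "bt_split S s" G \<phi>] bt
    by (simp add: compose_bt_split_merge[OF assms])
  show "eq 2 2 (Cmp (BT 1 2 (bt_split S s)) (BT 2 1 (bt_merge S s))) (Id 2)"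
    using tw_BT_Cmp[of 2 1 2 "bt_split S s" S "bt_merge S s" G \<phi>] bt
    by (simp add: compose_bt_split_merge[OF assms])
qed

text \<open>A comb of splits at one fixed \<open>s\<close>: the first copy is kept and the second is
  split further.\<close>

lemma is_iso_exists:
  assumes "S \<noteq> {}" "1 \<le> r"
  shows "\<exists>x y. is_iso 1 r x y"
  using assms(2)
proof (induction r rule: nat_induct_at_least)
  case base
  then show ?case using is_iso_Id by blast
next
  case (Suc r)
  obtain s where "s \<in> S" using assms by blast
  obtain x y where "is_iso 1 r x y" using Suc by blast
  then have "is_iso (1 + 1) (1 + r) (DSum (Id 1) x) (DSum (Id 1) y)"
    by (intro is_iso_DSum is_iso_Id) auto
  then have "is_iso 2 (Suc r) (DSum (Id 1) x) (DSum (Id 1) y)" by (simp add: numeral_2_eq_2 One_nat_def)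
  from is_iso_Cmp[OF is_iso_split[OF \<open>s \<in> S\<close>] this] show ?case by blast
qed

text \<open>
  Fixed isomorphisms between the object 1 and every object yield a functor \<open>base\<close> from the
  groupoid to the group at 1.  The choice at 1 makes it the identity on that group.
\<close>

definition fan_gather :: "nat \<Rightarrow> ('g, 's) tw_expr \<times> ('g, 's) tw_expr" where
  "fan_gather r = (if r = 1 then (Id 1, Id 1) else SOME (x, y). is_iso 1 r x y)"

abbreviation "fan r \<equiv> fst (fan_gather r)"
abbreviation "gather r \<equiv> snd (fan_gather r)"

definition base :: "('g, 's) tw_expr \<Rightarrow> ('g, 's) tw_expr set" where
  "base e = cls (Cmp (gather (tgt e)) (Cmp e (fan (src e))))"

end

locale nonempty_twisted_groupoid = twisted_groupoid G S \<phi>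
  for G :: "('g, 'b) monoid_scheme" (structure) and S :: "'s set" and \<phi> :: "'g \<Rightarrow> 's \<Rightarrow> 's" +
  assumes S_nonempty: "S \<noteq> {}"
begin

lemma is_iso_fan: "1 \<le> r \<Longrightarrow> is_iso 1 r (fan r) (gather r)"
  using is_iso_exists[OF S_nonempty, of r] is_iso_Id[of 1] someI_ex[of "\<lambda>p. case p of (x, y) \<Rightarrow> is_iso 1 r x y"]
  by (auto simp: fan_gather_def case_prod_unfold)

lemma mor_fan: "1 \<le> r \<Longrightarrow> mor 1 r (fan r)" "1 \<le> r \<Longrightarrow> mor r 1 (gather r)"
  using is_iso_fan by (auto simp: is_iso_def)

lemma mor_base: "mor m n e \<Longrightarrow> mor 1 1 (Cmp (gather n) (Cmp e (fan m)))"
  using mor_pos mor_fan by (blast intro: mor_Cmp)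

lemma base_mor: "mor m n e \<Longrightarrow> base e = cls (Cmp (gather n) (Cmp e (fan m)))"
  using mor_sound by (auto simp: base_def)

lemma base_closed: "mor m n e \<Longrightarrow> base e \<in> carrier SVG"
  using base_mor mor_base cls_closed by metis

text \<open>Since \<open>base\<close> reads source and target off its argument, soundness is invoked
  to know that equal expressions have the same types.\<close>

lemma base_eq:
  assumes "eq m n e e'"
  shows "base e = base e'"
proof -
  obtain c where "mor m n c" using eq_obtain_mor[OF assms] by blast
  then have "1 \<le> m" "1 \<le> n" using mor_pos by blast+
  then have "eq 1 1 (Cmp (gather n) (Cmp e (fan m))) (Cmp (gather n) (Cmp e' (fan m)))"
    by (intro eq_Cmp_right[OF eq_Cmp_left[OF assms mor_fan(1)] mor_fan(2)])
  then show ?thesis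
    using agreeD(1-4)[OF eq_sound[OF assms]] cls_eqI unfolding base_def by simp
qed

lemma base_one:
  assumes "mor 1 1 e"
  shows "base e = cls e"
proof -
  have "eq 1 1 (Cmp (Id 1) (Cmp e (Id 1))) e"
    using tw_trans[OF tw_id_left[OF mor_Cmp[OF assms mor_Id]] tw_id_right[OF assms]] by simp
  then show ?thesis using base_mor[OF assms] cls_eqI by (simp add: fan_gather_def)
qed

lemma base_Id:
  assumes "1 \<le> r"
  shows "base (Id r) = \<one>\<^bsub>SVG\<^esub>"
proof -
  have i: "mor 1 r (fan r)" "mor r 1 (gather r)" "eq 1 1 (Cmp (gather r) (fan r)) (Id 1)"
    using is_iso_fan[OF assms] by (auto simp: is_iso_def)
  have "eq 1 1 (Cmp (gather r) (Cmp (Id r) (fan r))) (Id 1)"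
    by (rule tw_trans[OF eq_Cmp_right[OF tw_id_left[OF i(1)] i(2)] i(3)])
  then show ?thesis using base_mor[OF mor_Id[OF assms]] cls_eqI by (simp add: one_SVG)
qed

text \<open>Functoriality: in the middle, \<open>gather n\<close> followed by \<open>fan n\<close>
  cancels.\<close>

lemma base_Cmp:
  assumes "mor n p a" "mor m n b"
  shows "base (Cmp a b) = base a \<otimes>\<^bsub>SVG\<^esub> base b"
proof -
  have pos: "1 \<le> m" "1 \<le> n" "1 \<le> p" using assms mor_pos by blast+
  let ?x = "fan n" and ?y = "gather n" and ?x' = "fan m" and ?y' = "gather p"
  have x: "mor 1 n ?x" "mor n 1 ?y" "eq n n (Cmp ?x ?y) (Id n)" "mor 1 m ?x'" "mor p 1 ?y'"
    using is_iso_fan[OF pos(2)] mor_fan pos by (auto simp: is_iso_def)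
  let ?B = "Cmp b ?x'"
  have B: "mor 1 n ?B" by (rule mor_Cmp[OF assms(2) x(4)])
  have yB: "mor 1 1 (Cmp ?y ?B)" by (rule mor_Cmp[OF x(2) B])
  have ax: "mor 1 p (Cmp a ?x)" by (rule mor_Cmp[OF assms(1) x(1)])
  have "eq 1 n (Cmp ?x (Cmp ?y ?B)) (Cmp (Cmp ?x ?y) ?B)"
    by (rule tw_sym[OF tw_Cmp_assoc[OF x(1,2) B]])
  also have "eq 1 n \<dots> (Cmp (Id n) ?B)" by (rule eq_Cmp_left[OF x(3) B])
  also have "eq 1 n \<dots> ?B" by (rule tw_id_left[OF B])
  finally have 1: "eq 1 n (Cmp ?x (Cmp ?y ?B)) ?B" .
  have "eq 1 1 (Cmp (Cmp ?y' (Cmp a ?x)) (Cmp ?y ?B)) (Cmp ?y' (Cmp (Cmp a ?x) (Cmp ?y ?B)))"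
    by (rule tw_Cmp_assoc[OF x(5) ax yB])
  also have "eq 1 1 \<dots> (Cmp ?y' (Cmp a (Cmp ?x (Cmp ?y ?B))))"
    by (rule eq_Cmp_right[OF tw_Cmp_assoc[OF assms(1) x(1) yB] x(5)])
  also have "eq 1 1 \<dots> (Cmp ?y' (Cmp a ?B))"
    by (rule eq_Cmp_right[OF eq_Cmp_right[OF 1 assms(1)] x(5)])
  also have "eq 1 1 \<dots> (Cmp ?y' (Cmp (Cmp a b) ?x'))"
    by (rule eq_Cmp_right[OF tw_sym[OF tw_Cmp_assoc[OF assms x(4)]] x(5)])
  finally show ?thesis
    using base_mor[OF assms(1)] base_mor[OF assms(2)] base_mor[OF mor_Cmp[OF assms]]
      cls_mult[OF mor_base[OF assms(1)] mor_base[OF assms(2)]] cls_eqI by metis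
qed

end

section \<open>Tuples inside a normal subgroup of the group at 1\<close>

lemma (in group_hom) normal_vimage:
  assumes "N \<lhd> H"
  shows "{g \<in> carrier G. h g \<in> N} \<lhd> G"
proof (rule G.normal_invI)
  interpret N: normal N H by fact
  show "subgroup {g \<in> carrier G. h g \<in> N} G"
    by (rule subgroup.intro) auto
  show "x \<otimes> y \<otimes> inv x \<in> {g \<in> carrier G. h g \<in> N}"
    if "x \<in> carrier G" "y \<in> {g \<in> carrier G. h g \<in> N}" for x y
    using that N.inv_op_closed2[of "h x" "h y"] by auto
qed

context nonempty_twisted_groupoid
begin

text \<open>By interchange, conjugation with \<open>x\<close> on the trivial summand resizes that
  summand from \<open>m\<close> to \<open>n\<close> copies, while \<open>A\<close> meets only
  identities.\<close>

lemma base_iso_DSum: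
  assumes "is_iso m n x y" "mor r r A" "1 \<le> m"
  shows "base (DSum A (Id n)) = base (DSum (Id r) x) \<otimes>\<^bsub>SVG\<^esub> base (DSum A (Id m)) \<otimes>\<^bsub>SVG\<^esub> base (DSum (Id r) y)"
    and "base (DSum (Id n) A) = base (DSum x (Id r)) \<otimes>\<^bsub>SVG\<^esub> base (DSum (Id m) A) \<otimes>\<^bsub>SVG\<^esub> base (DSum y (Id r))"
proof -
  have r: "1 \<le> r" and n: "1 \<le> n" using assms mor_pos by (auto simp: is_iso_def)
  have t: "mor m n x" "mor n m y" "eq n n (Cmp x y) (Id n)" using assms by (auto simp: is_iso_def)
  have tid: "mor r r (Id r)" "mor m m (Id m)" "mor n n (Id n)" using r assms(3) n by (auto intro: mor_Id)
  have A1: "eq r r (Cmp (Id r) A) A" "eq r r (Cmp A (Id r)) A"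
    using assms(2) by (auto intro: tw_id_left tw_id_right)
  have x1: "eq m n (Cmp x (Id m)) x" using t by (auto intro: tw_id_right)
  have y1: "eq n n (Cmp (Cmp x (Id m)) y) (Id n)"
    by (rule tw_trans[OF eq_Cmp_left[OF x1 t(2)] t(3)])
  have A2: "eq r r (Cmp (Cmp (Id r) A) (Id r)) A"
    by (rule tw_trans[OF eq_Cmp_left[OF A1(1) tid(1)] A1(2)])
  have "eq (r + n) (r + n) (Cmp (Cmp (DSum (Id r) x) (DSum A (Id m))) (DSum (Id r) y))
      (Cmp (DSum (Cmp (Id r) A) (Cmp x (Id m))) (DSum (Id r) y))"
    by (rule eq_Cmp_left[OF tw_sym[OF tw_interchange[OF tid(1) assms(2) t(1) tid(2)]] mor_DSum[OF tid(1) t(2)]])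
  also have "eq (r + n) (r + n) \<dots> (DSum (Cmp (Cmp (Id r) A) (Id r)) (Cmp (Cmp x (Id m)) y))"
    by (rule tw_sym[OF tw_interchange[OF mor_Cmp[OF tid(1) assms(2)] tid(1) mor_Cmp[OF t(1) tid(2)] t(2)]])
  also have "eq (r + n) (r + n) \<dots> (DSum A (Id n))"
    by (rule tw_DSum[OF A2 y1])
  finally show "base (DSum A (Id n)) = base (DSum (Id r) x) \<otimes>\<^bsub>SVG\<^esub> base (DSum A (Id m)) \<otimes>\<^bsub>SVG\<^esub> base (DSum (Id r) y)"
    using base_eq base_Cmp[OF mor_DSum[OF tid(1) t(1)] mor_DSum[OF assms(2) tid(2)]]
      base_Cmp[OF mor_Cmp[OF mor_DSum[OF tid(1) t(1)] mor_DSum[OF assms(2) tid(2)]] mor_DSum[OF tid(1) t(2)]]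
    by metis
  have "eq (n + r) (n + r) (Cmp (Cmp (DSum x (Id r)) (DSum (Id m) A)) (DSum y (Id r)))
      (Cmp (DSum (Cmp x (Id m)) (Cmp (Id r) A)) (DSum y (Id r)))"
    by (rule eq_Cmp_left[OF tw_sym[OF tw_interchange[OF t(1) tid(2) tid(1) assms(2)]] mor_DSum[OF t(2) tid(1)]])
  also have "eq (n + r) (n + r) \<dots> (DSum (Cmp (Cmp x (Id m)) y) (Cmp (Cmp (Id r) A) (Id r)))"
    by (rule tw_sym[OF tw_interchange[OF mor_Cmp[OF t(1) tid(2)] t(2) mor_Cmp[OF tid(1) assms(2)] tid(1)]])
  also have "eq (n + r) (n + r) \<dots> (DSum (Id n) A)"
    by (rule tw_DSum[OF y1 A2])
  finally show "base (DSum (Id n) A) = base (DSum x (Id r)) \<otimes>\<^bsub>SVG\<^esub> base (DSum (Id m) A) \<otimes>\<^bsub>SVG\<^esub> base (DSum y (Id r))"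
    using base_eq base_Cmp[OF mor_DSum[OF t(1) tid(1)] mor_DSum[OF tid(2) assms(2)]]
      base_Cmp[OF mor_Cmp[OF mor_DSum[OF t(1) tid(1)] mor_DSum[OF tid(2) assms(2)]] mor_DSum[OF t(2) tid(1)]]
    by metis
qed

definition unit_tup :: "nat \<Rightarrow> nat \<Rightarrow> 'g \<Rightarrow> 'g list" where
  "unit_tup p q g = replicate p \<one> @ [g] @ replicate q \<one>"

lemma unit_tup_lists: "g \<in> carrier G \<Longrightarrow> unit_tup p q g \<in> lists (carrier G)"
  by (auto simp: unit_tup_def in_lists_conv_set)

lemma length_unit_tup [simp]: "length (unit_tup p q g) = Suc (p + q)"
  by (simp add: unit_tup_def)

lemma base_Tup_Cmp:
  assumes "gs \<in> lists (carrier G)" "hs \<in> lists (carrier G)" "length gs = length hs" "gs \<noteq> []"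
  shows "base (Tup (map2 (\<otimes>) gs hs)) = base (Tup gs) \<otimes>\<^bsub>SVG\<^esub> base (Tup hs)"
proof -
  have n: "1 \<le> length hs" using assms(3,4) by (cases hs) auto
  have "mor (length hs) (length hs) (Tup gs)" "mor (length hs) (length hs) (Tup hs)"
    using assms n by (auto intro: mor_Tup)
  from base_Cmp[OF this] show ?thesis
    using base_eq[OF tw_Tup_Cmp[OF assms(1,2) _ _ n]] assms(3) by simp
qed

lemma base_Tup_append:
  assumes "gs \<in> lists (carrier G)" "hs \<in> lists (carrier G)" "gs \<noteq> []" "hs \<noteq> []"
  shows "base (Tup (gs @ hs)) = base (DSum (Tup gs) (Tup hs))"
proof -
  have "1 \<le> length gs" "1 \<le> length hs" using assms(3,4) by (cases gs, auto, cases hs, auto)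
  from base_eq[OF tw_Tup_DSum[OF assms(1,2) refl refl this]] show ?thesis by simp
qed

lemma base_Tup_append_ones:
  assumes "gs \<in> lists (carrier G)" "gs \<noteq> []" "1 \<le> q"
  shows "base (Tup (gs @ replicate q \<one>)) = base (DSum (Tup gs) (Id q))"
    and "base (Tup (replicate q \<one> @ gs)) = base (DSum (Id q) (Tup gs))"
proof -
  have "1 \<le> length gs" using assms(2) by (cases gs) auto
  then have "eq (length gs) (length gs) (Tup gs) (Tup gs)"
    using assms by (intro tw_refl mor_Tup) auto
  from base_eq[OF tw_DSum[OF this Tup_ones[OF assms(3)]]] base_eq[OF tw_DSum[OF Tup_ones[OF assms(3)] this]]
  show "base (Tup (gs @ replicate q \<one>)) = base (DSum (Tup gs) (Id q))"
    "base (Tup (replicate q \<one> @ gs)) = base (DSum (Id q) (Tup gs))"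
    using assms ones_lists by (simp_all add: base_Tup_append)
qed

context
  fixes N
  assumes grp: "group SVG" and N: "N \<lhd> SVG"
begin

interpretation \<Gamma>: group SVG by (rule grp)
interpretation N: normal N SVG by (rule N)

text \<open>The functor turns an inverse pair \<open>x\<close>, \<open>y\<close> between different
  objects into mutually inverse group elements, so conjugation in the groupoid becomes conjugation
  in the group.\<close>

lemma base_iso_conj:
  assumes "is_iso m n x y" "B \<in> N"
  shows "base x \<otimes>\<^bsub>SVG\<^esub> B \<otimes>\<^bsub>SVG\<^esub> base y \<in> N"
proof -
  have t: "mor m n x" "mor n m y" "eq n n (Cmp x y) (Id n)" using assms by (auto simp: is_iso_def)
  have "base x \<otimes>\<^bsub>SVG\<^esub> base y = \<one>\<^bsub>SVG\<^esub>"
    using base_Cmp[OF t(1,2)] base_eq[OF t(3)] base_Id mor_pos[OF t(1)] by metis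
  then have "base y = inv\<^bsub>SVG\<^esub> base x"
    using base_closed t by (metis \<Gamma>.inv_comm \<Gamma>.inv_equality)
  then show ?thesis using N.inv_op_closed2[OF base_closed[OF t(1)] assms(2)] by simp
qed

text \<open>The trailing \<open>\<one>\<close> is spread over \<open>q\<close> copies by conjugating
  with \<open>fan q\<close> on the last summand. An empty block has nothing to spread, whence the
  separate cases \<open>q = 0\<close> and \<open>p = 0\<close> below.\<close>

lemma base_pad_right:
  assumes "gs \<in> lists (carrier G)" "gs \<noteq> []" "base (Tup (gs @ [\<one>])) \<in> N" "1 \<le> q"
  shows "base (Tup (gs @ replicate q \<one>)) \<in> N"
proof -
  have l: "1 \<le> length gs" using assms(2) by (cases gs) auto
  then have A: "mor (length gs) (length gs) (Tup gs)" using assms by (intro mor_Tup) auto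
  have i: "is_iso 1 q (fan q) (gather q)" using assms(4) by (rule is_iso_fan)
  have "base (DSum (Tup gs) (Id 1)) \<in> N"
    using base_Tup_append_ones(1)[OF assms(1,2), of 1] assms(3) by (simp add: One_nat_def)
  then show ?thesis
    using base_iso_DSum(1)[OF i A] base_Tup_append_ones(1)[OF assms(1,2,4)]
      base_iso_conj[OF is_iso_DSum[OF is_iso_Id[OF l] i]] by simp
qed

lemma base_pad_left:
  assumes "gs \<in> lists (carrier G)" "gs \<noteq> []" "base (Tup (\<one> # gs)) \<in> N" "1 \<le> q"
  shows "base (Tup (replicate q \<one> @ gs)) \<in> N"
proof -
  have l: "1 \<le> length gs" using assms(2) by (cases gs) auto
  then have A: "mor (length gs) (length gs) (Tup gs)" using assms by (intro mor_Tup) auto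
  have i: "is_iso 1 q (fan q) (gather q)" using assms(4) by (rule is_iso_fan)
  have "base (DSum (Id 1) (Tup gs)) \<in> N"
    using base_Tup_append_ones(2)[OF assms(1,2), of 1] assms(3) by (simp add: One_nat_def)
  then show ?thesis
    using base_iso_DSum(2)[OF i A] base_Tup_append_ones(2)[OF assms(1,2,4)]
      base_iso_conj[OF is_iso_DSum[OF i is_iso_Id[OF l]]] by simp
qed

text \<open>Makes the preimage of \<open>N\<close> a normal subgroup of \<open>G\<close>, which can
  then be compared with the normal closure of \<open>T\<close>.\<close>

lemma base_unit_tup_hom: "group_hom G SVG (\<lambda>g. base (Tup (unit_tup p q g)))"
  unfolding group_hom_def group_hom_axioms_def
proof (intro conjI G.is_group grp homI)
  fix g assume "g \<in> carrier G"
  then have "mor (Suc (p + q)) (Suc (p + q)) (Tup (unit_tup p q g))"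
    by (intro mor_Tup unit_tup_lists) auto
  then show "base (Tup (unit_tup p q g)) \<in> carrier SVG" by (rule base_closed)
next
  fix g h assume gh: "g \<in> carrier G" "h \<in> carrier G"
  have "map2 (\<otimes>) (unit_tup p q g) (unit_tup p q h) = unit_tup p q (g \<otimes> h)"
    by (simp add: unit_tup_def zip_replicate)
  then show "base (Tup (unit_tup p q (g \<otimes> h))) =
      base (Tup (unit_tup p q g)) \<otimes>\<^bsub>SVG\<^esub> base (Tup (unit_tup p q h))"
    using base_Tup_Cmp[OF unit_tup_lists[OF gh(1)] unit_tup_lists[OF gh(2)], of p q p q]
    by (simp add: unit_tup_def)
qed

lemma base_Tup_in_normal:
  assumes K: "\<And>M. M \<lhd> G \<Longrightarrow> T \<subseteq> M \<Longrightarrow> K \<subseteq> M" "T \<subseteq> carrier G" "K \<subseteq> carrier G"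
    and T: "\<And>p q k. p \<le> 1 \<Longrightarrow> q \<le> 1 \<Longrightarrow> k \<in> T \<Longrightarrow> base (Tup (unit_tup p q k)) \<in> N"
    and ks: "ks \<in> lists K" "ks \<noteq> []"
  shows "base (Tup ks) \<in> N"
proof -
  \<comment> \<open>For a fixed shape, the elements of \<open>G\<close> whose tuple lies in
    \<open>N\<close> form a normal subgroup containing \<open>T\<close>, hence containing
    \<open>K\<close>.\<close>
  have 1: "base (Tup (unit_tup p q k)) \<in> N" if "p \<le> 1" "q \<le> 1" "k \<in> K" for p q k
  proof -
    interpret h: group_hom G SVG "\<lambda>g. base (Tup (unit_tup p q g))" by (rule base_unit_tup_hom)
    have "K \<subseteq> {g \<in> carrier G. base (Tup (unit_tup p q g)) \<in> N}"
      using h.normal_vimage[OF N] T that K(2) by (intro K(1)) auto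
    then show ?thesis using that by blast
  qed
  have 2: "base (Tup (unit_tup p q k)) \<in> N" if "p \<le> 1" "k \<in> K" for p q k
  proof (cases "q = 0")
    case False
    have "replicate p \<one> @ [k] \<in> lists (carrier G)"
      using that K(3) by (auto simp: in_lists_conv_set)
    from base_pad_right[OF this _ _ ] show ?thesis
      using 1[OF that(1) _ that(2), of 1] False by (simp add: unit_tup_def One_nat_def)
  qed (use 1 that in simp)
  have 3: "base (Tup (unit_tup p q k)) \<in> N" if "k \<in> K" for p q k
  proof (cases "p = 0")
    case False
    have "[k] @ replicate q \<one> \<in> lists (carrier G)"
      using that K(3) by (auto simp: in_lists_conv_set)
    from base_pad_left[OF this _ _ ] show ?thesis
      using 2[OF _ that, of 1 q] False by (simp add: unit_tup_def One_nat_def)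
  qed (use 2 that in simp)
  \<comment> \<open>Peel off one entry at a time: \<open>k # ks\<close> behind \<open>p\<close> ones
    is the product of the tuple with \<open>k\<close> alone and the tuple with \<open>k\<close>
    replaced by \<open>\<one>\<close>. The leading ones make the induction go through, and the bound
    on the length excludes the empty tuple, which is no morphism.\<close>
  have "base (Tup (replicate p \<one> @ ks)) \<in> N" if "1 \<le> p + length ks" "ks \<in> lists K" for p ks
    using that(2,1)
  proof (induction ks arbitrary: p rule: lists.induct)
    case Nil
    then show ?case using base_eq[OF Tup_ones[of p]] base_Id[of p] by simp
  next
    case (Cons k ks)
    have lists: "replicate (Suc p) \<one> @ ks \<in> lists (carrier G)"
      using Cons K(3) by (auto simp: in_lists_conv_set)
    have k: "k \<in> carrier G" using Cons K(3) by auto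
    have ones: "map2 (\<otimes>) (replicate (length ks) \<one>) ks = ks"
      using lists by (intro nth_equalityI) (auto simp: in_lists_conv_set)
    have "replicate (Suc p) \<one> @ ks = replicate p \<one> @ [\<one>] @ ks"
      by (simp add: replicate_append_same)
    then have "map2 (\<otimes>) (unit_tup p (length ks) k) (replicate (Suc p) \<one> @ ks) = replicate p \<one> @ (k # ks)"
      using k ones by (simp add: unit_tup_def zip_replicate)
    then have "base (Tup (replicate p \<one> @ (k # ks))) =
        base (Tup (unit_tup p (length ks) k)) \<otimes>\<^bsub>SVG\<^esub> base (Tup (replicate (Suc p) \<one> @ ks))"
      using base_Tup_Cmp[OF unit_tup_lists[OF k, of p "length ks"] lists] by (simp add: unit_tup_def)
    then show ?case using 3[OF Cons(1)] Cons(3)[of "Suc p"] by simp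
  qed
  from this[of 0 ks] show ?thesis using ks by (cases ks) simp_all
qed

end

end

section \<open>The congruence modulo tuples over a normal subgroup\<close>

text \<open>
  Closure under composition and direct sum is proved below rather than built in: this keeps
  the induction in \<open>keq_base\<close> free of direct sums, with which \<open>base\<close> is not compatible.
\<close>

inductive kernel_eq ::
    "('g, 'b) monoid_scheme \<Rightarrow> 's set \<Rightarrow> ('g \<Rightarrow> 's \<Rightarrow> 's) \<Rightarrow> 'g set \<Rightarrow> nat \<Rightarrow> nat \<Rightarrow>
     ('g, 's) tw_expr \<Rightarrow> ('g, 's) tw_expr \<Rightarrow> bool"
  for G S \<phi> K where
  kernel_eq: "tw_eq G S \<phi> m n e e' \<Longrightarrow> kernel_eq G S \<phi> K m n e e'"
| kernel_Tup: "tw_mor G S r n a \<Longrightarrow> tw_mor G S m r b \<Longrightarrow> ks \<in> lists K \<Longrightarrow> length ks = r \<Longrightarrow>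
    kernel_eq G S \<phi> K m n (Cmp a (Cmp (Tup ks) b)) (Cmp a b)"
| kernel_sym: "kernel_eq G S \<phi> K m n e e' \<Longrightarrow> kernel_eq G S \<phi> K m n e' e"
| kernel_trans: "kernel_eq G S \<phi> K m n e e' \<Longrightarrow> kernel_eq G S \<phi> K m n e' e'' \<Longrightarrow>
    kernel_eq G S \<phi> K m n e e''"

declare kernel_trans [trans]

context nonempty_twisted_groupoid
begin

context
  fixes K
  assumes K: "K \<lhd> G"
begin

interpretation K: normal K G by (rule K)

abbreviation keq :: "nat \<Rightarrow> nat \<Rightarrow> ('g, 's) tw_expr \<Rightarrow> ('g, 's) tw_expr \<Rightarrow> bool" where
  "keq \<equiv> kernel_eq G S \<phi> K"

lemma mor_Tup_K: "ks \<in> lists K \<Longrightarrow> length ks = r \<Longrightarrow> 1 \<le> r \<Longrightarrow> mor r r (Tup ks)"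
  using K.subset by (intro mor_Tup) (auto simp: in_lists_conv_set)

lemma keq_obtain_mor:
  assumes "keq m n e e'"
  obtains c where "mor m n c" "eq m n e c"
proof -
  have "(\<exists>c. mor m n c \<and> eq m n e c) \<and> (\<exists>c. mor m n c \<and> eq m n e' c)"
    using assms
  proof (induction rule: kernel_eq.induct)
    case (kernel_eq m n e e')
    then show ?case by (meson eq_obtain_mor tw_sym)
  next
    case (kernel_Tup r n a m b ks)
    then have "1 \<le> r" using mor_pos by blast
    note T = mor_Tup_K[OF kernel_Tup(3,4) this]
    have "mor m n (Cmp a (Cmp (Tup ks) b))" "mor m n (Cmp a b)"
      using mor_Cmp[OF kernel_Tup(1) mor_Cmp[OF T kernel_Tup(2)]] mor_Cmp[OF kernel_Tup(1,2)] by auto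
    then show ?case by (meson tw_refl)
  qed auto
  then show thesis using that by blast
qed


text \<open>Associativity moves \<open>c\<close> into the left factor of an insertion; the contexts
  \<open>a\<close> and \<open>b\<close> in \<open>kernel_Tup\<close> are there to absorb such
  factors.\<close>

lemma keq_Cmp_mor_left:
  assumes "keq m n e e'" "mor n p c"
  shows "keq m p (Cmp c e) (Cmp c e')"
  using assms
proof (induction rule: kernel_eq.induct)
  case (kernel_eq m n e e')
  then show ?case by (intro kernel_eq.kernel_eq eq_Cmp_right)
next
  case (kernel_Tup r n a m b ks)
  have T: "mor r r (Tup ks)" using kernel_Tup mor_Tup_K mor_pos by blast
  have "eq m p (Cmp c (Cmp a (Cmp (Tup ks) b))) (Cmp (Cmp c a) (Cmp (Tup ks) b))"
    by (rule tw_sym[OF tw_Cmp_assoc[OF kernel_Tup(5,1) mor_Cmp[OF T kernel_Tup(2)]]])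
  moreover have "keq m p (Cmp (Cmp c a) (Cmp (Tup ks) b)) (Cmp (Cmp c a) b)"
    by (rule kernel_eq.kernel_Tup[OF mor_Cmp[OF kernel_Tup(5,1)] kernel_Tup(2-4)])
  moreover have "eq m p (Cmp (Cmp c a) b) (Cmp c (Cmp a b))"
    by (rule tw_Cmp_assoc[OF kernel_Tup(5,1,2)])
  ultimately show ?case by (meson kernel_eq.kernel_eq kernel_trans)
qed (meson kernel_sym kernel_trans)+

lemma keq_Cmp_mor_right:
  assumes "keq n p e e'" "mor m n c"
  shows "keq m p (Cmp e c) (Cmp e' c)"
  using assms
proof (induction rule: kernel_eq.induct)
  case (kernel_eq n p e e')
  then show ?case by (intro kernel_eq.kernel_eq eq_Cmp_left)
next
  case (kernel_Tup r p a n b ks)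
  have T: "mor r r (Tup ks)" using kernel_Tup mor_Tup_K mor_pos by blast
  have "eq m p (Cmp (Cmp a (Cmp (Tup ks) b)) c) (Cmp a (Cmp (Cmp (Tup ks) b) c))"
    by (rule tw_Cmp_assoc[OF kernel_Tup(1) mor_Cmp[OF T kernel_Tup(2)] kernel_Tup(5)])
  moreover have "eq m p (Cmp a (Cmp (Cmp (Tup ks) b) c)) (Cmp a (Cmp (Tup ks) (Cmp b c)))"
    by (rule eq_Cmp_right[OF tw_Cmp_assoc[OF T kernel_Tup(2,5)] kernel_Tup(1)])
  moreover have "keq m p (Cmp a (Cmp (Tup ks) (Cmp b c))) (Cmp a (Cmp b c))"
    by (rule kernel_eq.kernel_Tup[OF kernel_Tup(1) mor_Cmp[OF kernel_Tup(2,5)] kernel_Tup(3,4)])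
  moreover have "eq m p (Cmp a (Cmp b c)) (Cmp (Cmp a b) c)"
    by (rule tw_sym[OF tw_Cmp_assoc[OF kernel_Tup(1,2,5)]])
  ultimately show ?case by (meson kernel_eq.kernel_eq kernel_trans)
qed (meson kernel_sym kernel_trans)+

text \<open>One factor is changed at a time, and the other must then be a morphism, which the given
  sides need not be. Hence the detour through morphisms \<open>a0\<close> and \<open>b0\<close>
  equal to \<open>a'\<close> and \<open>b\<close>.\<close>

lemma keq_Cmp:
  assumes "keq n p a a'" "keq m n b b'"
  shows "keq m p (Cmp a b) (Cmp a' b')"
proof -
  obtain a0 where a0: "mor n p a0" "eq n p a' a0"
    using keq_obtain_mor[OF kernel_sym[OF assms(1)]] by blast
  obtain b0 where b0: "mor m n b0" "eq m n b b0"
    using keq_obtain_mor[OF assms(2)] by blast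
  have bb: "eq m n b b" "eq n p a' a'" and b'b': "eq m n b' b'"
    using a0 b0 keq_obtain_mor[OF kernel_sym[OF assms(2)]] by (meson tw_sym tw_trans)+
  have aa: "eq n p a a" using keq_obtain_mor[OF assms(1)] by (meson tw_sym tw_trans)
  have "keq m p (Cmp a b) (Cmp a b0)" by (rule kernel_eq.kernel_eq[OF tw_Cmp[OF aa b0(2)]])
  moreover have "keq m p (Cmp a b0) (Cmp a' b0)" by (rule keq_Cmp_mor_right[OF assms(1) b0(1)])
  moreover have "keq m p (Cmp a' b0) (Cmp a0 b)"
    by (rule kernel_eq.kernel_eq[OF tw_Cmp[OF a0(2) tw_sym[OF b0(2)]]])
  moreover have "keq m p (Cmp a0 b) (Cmp a0 b')" by (rule keq_Cmp_mor_left[OF assms(2) a0(1)])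
  moreover have "keq m p (Cmp a0 b') (Cmp a' b')"
    by (rule kernel_eq.kernel_eq[OF tw_Cmp[OF tw_sym[OF a0(2)] b'b']])
  ultimately show ?thesis by (meson kernel_trans)
qed

text \<open>Padding \<open>c\<close> with identities before interchanging gathers \<open>c\<close>
  into the outer factor, so that \<open>t\<close> is met only by an identity and its sum can be
  rewritten as a longer tuple.\<close>

lemma eq_DSum_Cmp:
  assumes "mor r n a" "mor m r b" "mor r r t" "mor m' n' c"
  shows "eq (m + m') (n + n') (DSum (Cmp a (Cmp t b)) c)
      (Cmp (DSum a c) (Cmp (DSum t (Id m')) (DSum b (Id m'))))"
    and "eq (m' + m) (n' + n) (DSum c (Cmp a (Cmp t b)))
      (Cmp (DSum c a) (Cmp (DSum (Id m') t) (DSum (Id m') b)))"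
    and "eq (m + m') (n + n') (DSum (Cmp a b) c) (Cmp (DSum a c) (DSum b (Id m')))"
    and "eq (m' + m) (n' + n) (DSum c (Cmp a b)) (Cmp (DSum c a) (DSum (Id m') b))"
proof -
  have m': "1 \<le> m'" using assms mor_pos by blast
  note I = mor_Id[OF m']
  have c: "eq m' n' c (Cmp c (Id m'))" by (rule tw_sym[OF tw_id_right[OF assms(4)]])
  have II: "eq m' m' (Id m') (Cmp (Id m') (Id m'))" by (rule tw_sym[OF tw_id_right[OF I]])
  have cI: "eq m' n' c (Cmp c (Cmp (Id m') (Id m')))"
    by (rule tw_trans[OF c eq_Cmp_right[OF II assms(4)]])
  note tb = mor_Cmp[OF assms(3,2)]
  note II' = mor_Cmp[OF I I]
  show "eq (m + m') (n + n') (DSum (Cmp a b) c) (Cmp (DSum a c) (DSum b (Id m')))"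
    by (rule tw_trans[OF tw_DSum[OF tw_refl[OF mor_Cmp[OF assms(1,2)]] c]
        tw_interchange[OF assms(1,2,4) I]])
  show "eq (m' + m) (n' + n) (DSum c (Cmp a b)) (Cmp (DSum c a) (DSum (Id m') b))"
    by (rule tw_trans[OF tw_DSum[OF c tw_refl[OF mor_Cmp[OF assms(1,2)]]]
        tw_interchange[OF assms(4) I assms(1,2)]])
  have "eq (m + m') (n + n') (DSum (Cmp a (Cmp t b)) c) (DSum (Cmp a (Cmp t b)) (Cmp c (Cmp (Id m') (Id m'))))"
    by (rule tw_DSum[OF tw_refl[OF mor_Cmp[OF assms(1) tb]] cI])
  also have "eq (m + m') (n + n') \<dots> (Cmp (DSum a c) (DSum (Cmp t b) (Cmp (Id m') (Id m'))))"
    by (rule tw_interchange[OF assms(1) tb assms(4) II'])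
  also have "eq (m + m') (n + n') \<dots> (Cmp (DSum a c) (Cmp (DSum t (Id m')) (DSum b (Id m'))))"
    by (rule eq_Cmp_right[OF tw_interchange[OF assms(3,2) I I] mor_DSum[OF assms(1,4)]])
  finally show "eq (m + m') (n + n') (DSum (Cmp a (Cmp t b)) c)
      (Cmp (DSum a c) (Cmp (DSum t (Id m')) (DSum b (Id m'))))" .
  have "eq (m' + m) (n' + n) (DSum c (Cmp a (Cmp t b))) (DSum (Cmp c (Cmp (Id m') (Id m'))) (Cmp a (Cmp t b)))"
    by (rule tw_DSum[OF cI tw_refl[OF mor_Cmp[OF assms(1) tb]]])
  also have "eq (m' + m) (n' + n) \<dots> (Cmp (DSum c a) (DSum (Cmp (Id m') (Id m')) (Cmp t b)))"
    by (rule tw_interchange[OF assms(4) II' assms(1) tb])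
  also have "eq (m' + m) (n' + n) \<dots> (Cmp (DSum c a) (Cmp (DSum (Id m') t) (DSum (Id m') b)))"
    by (rule eq_Cmp_right[OF tw_interchange[OF I I assms(3,2)] mor_DSum[OF assms(4,1)]])
  finally show "eq (m' + m) (n' + n) (DSum c (Cmp a (Cmp t b)))
      (Cmp (DSum c a) (Cmp (DSum (Id m') t) (DSum (Id m') b)))" .
qed

lemma eq_Tup_pad:
  assumes "ks \<in> lists K" "length ks = r" "1 \<le> r" "1 \<le> q"
  shows "eq (r + q) (r + q) (DSum (Tup ks) (Id q)) (Tup (ks @ replicate q \<one>))"
    and "eq (q + r) (q + r) (DSum (Id q) (Tup ks)) (Tup (replicate q \<one> @ ks))"
proof -
  have ks: "ks \<in> lists (carrier G)" using assms(1) K.subset by (auto simp: in_lists_conv_set)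
  note T = tw_refl[OF mor_Tup_K[OF assms(1-3)]] and I = tw_sym[OF Tup_ones[OF assms(4)]]
  show "eq (r + q) (r + q) (DSum (Tup ks) (Id q)) (Tup (ks @ replicate q \<one>))"
    by (rule tw_trans[OF tw_DSum[OF T I] tw_Tup_DSum[OF ks ones_lists assms(2) length_replicate assms(3,4)]])
  show "eq (q + r) (q + r) (DSum (Id q) (Tup ks)) (Tup (replicate q \<one> @ ks))"
    by (rule tw_trans[OF tw_DSum[OF I T] tw_Tup_DSum[OF ones_lists ks length_replicate assms(2,4,3)]])
qed

lemma keq_DSum_mor:
  assumes "keq m n e e'" "mor m' n' c"
  shows "keq (m + m') (n + n') (DSum e c) (DSum e' c) \<and> keq (m' + m) (n' + n) (DSum c e) (DSum c e')"
  using assms(1)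
proof (induction rule: kernel_eq.induct)
  case (kernel_eq m n e e')
  then show ?case using tw_refl[OF assms(2)] by (blast intro: kernel_eq.kernel_eq tw_DSum)
next
  case (kernel_Tup r n a m b ks)
  have r: "1 \<le> r" using kernel_Tup mor_pos by blast
  have m': "1 \<le> m'" using assms mor_pos by blast
  note T = mor_Tup_K[OF kernel_Tup(3,4) r] and I = mor_Id[OF m']
  note D = eq_DSum_Cmp[OF kernel_Tup(1,2) T assms(2)]
  note P = eq_Tup_pad[OF kernel_Tup(3,4) r m']
  \<comment> \<open>As \<open>\<one>\<close> belongs to \<open>K\<close>, the padded tuples are
    again over \<open>K\<close>, and the direct sum is an insertion of the same kind.\<close>
  have l: "ks @ replicate m' \<one> \<in> lists K" "replicate m' \<one> @ ks \<in> lists K"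
    using kernel_Tup(3) by (auto simp: in_lists_conv_set)
  note ac = mor_DSum[OF kernel_Tup(1) assms(2)] and ca = mor_DSum[OF assms(2) kernel_Tup(1)]
  note bI = mor_DSum[OF kernel_Tup(2) I] and Ib = mor_DSum[OF I kernel_Tup(2)]
  have "keq (m + m') (n + n') (DSum (Cmp a (Cmp (Tup ks) b)) c)
      (Cmp (DSum a c) (Cmp (Tup (ks @ replicate m' \<one>)) (DSum b (Id m'))))"
    by (rule kernel_eq.kernel_eq[OF tw_trans[OF D(1) eq_Cmp_right[OF eq_Cmp_left[OF P(1) bI] ac]]])
  also have "keq (m + m') (n + n') \<dots> (Cmp (DSum a c) (DSum b (Id m')))"
    by (rule kernel_eq.kernel_Tup[OF ac bI l(1)]) (simp add: kernel_Tup)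
  also have "keq (m + m') (n + n') \<dots> (DSum (Cmp a b) c)"
    by (rule kernel_eq.kernel_eq[OF tw_sym[OF D(3)]])
  finally have 1: "keq (m + m') (n + n') (DSum (Cmp a (Cmp (Tup ks) b)) c) (DSum (Cmp a b) c)" .
  have "keq (m' + m) (n' + n) (DSum c (Cmp a (Cmp (Tup ks) b)))
      (Cmp (DSum c a) (Cmp (Tup (replicate m' \<one> @ ks)) (DSum (Id m') b)))"
    by (rule kernel_eq.kernel_eq[OF tw_trans[OF D(2) eq_Cmp_right[OF eq_Cmp_left[OF P(2) Ib] ca]]])
  also have "keq (m' + m) (n' + n) \<dots> (Cmp (DSum c a) (DSum (Id m') b))"
    by (rule kernel_eq.kernel_Tup[OF ca Ib l(2)]) (simp add: kernel_Tup)
  also have "keq (m' + m) (n' + n) \<dots> (DSum c (Cmp a b))"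
    by (rule kernel_eq.kernel_eq[OF tw_sym[OF D(4)]])
  finally show ?case using 1 by blast
qed (meson kernel_sym kernel_trans)+

lemma keq_DSum:
  assumes "keq m n a a'" "keq m' n' b b'"
  shows "keq (m + m') (n + n') (DSum a b) (DSum a' b')"
proof -
  obtain a0 where a0: "mor m n a0" "eq m n a' a0"
    using keq_obtain_mor[OF kernel_sym[OF assms(1)]] by blast
  obtain b0 where b0: "mor m' n' b0" "eq m' n' b b0"
    using keq_obtain_mor[OF assms(2)] by blast
  have b'b': "eq m' n' b' b'"
    using keq_obtain_mor[OF kernel_sym[OF assms(2)]] by (meson tw_sym tw_trans)
  have aa: "eq m n a a" using keq_obtain_mor[OF assms(1)] by (meson tw_sym tw_trans)
  have "keq (m + m') (n + n') (DSum a b) (DSum a b0)"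
    by (rule kernel_eq.kernel_eq[OF tw_DSum[OF aa b0(2)]])
  moreover have "keq (m + m') (n + n') (DSum a b0) (DSum a' b0)"
    using keq_DSum_mor[OF assms(1) b0(1)] by blast
  moreover have "keq (m + m') (n + n') (DSum a' b0) (DSum a0 b)"
    by (rule kernel_eq.kernel_eq[OF tw_DSum[OF a0(2) tw_sym[OF b0(2)]]])
  moreover have "keq (m + m') (n + n') (DSum a0 b) (DSum a0 b')"
    using keq_DSum_mor[OF assms(2) a0(1)] by blast
  moreover have "keq (m + m') (n + n') (DSum a0 b') (DSum a' b')"
    by (rule kernel_eq.kernel_eq[OF tw_DSum[OF tw_sym[OF a0(2)] b'b']])
  ultimately show ?thesis by (meson kernel_trans)
qed

text \<open>The tuples differ by a right factor \<open>ks\<close> over \<open>K\<close>, and the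
  identity behind it gives the shape required by \<open>kernel_Tup\<close>. Normality is what turns
  the given right cosets into left ones.\<close>

lemma keq_Tup:
  assumes "gs \<in> lists (carrier G)" "hs \<in> lists (carrier G)" "length gs = n" "length hs = n" "1 \<le> n"
    and "\<And>i. i < n \<Longrightarrow> K #> gs ! i = K #> hs ! i"
  shows "keq n n (Tup gs) (Tup hs)"
proof -
  define ks where "ks = map2 (\<lambda>h g. inv h \<otimes> g) hs gs"
  have G: "gs ! i \<in> carrier G" "hs ! i \<in> carrier G" if "i < n" for i
    using that assms by (auto simp: in_lists_conv_set)
  have ks: "ks ! i \<in> K \<and> hs ! i \<otimes> ks ! i = gs ! i" if i: "i < n" for i
  proof -
    have "gs ! i \<in> K #> hs ! i"
      using assms(6)[OF i] G.rcos_self[OF G(1)[OF i] K.is_subgroup] by simp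
    then have "gs ! i \<in> hs ! i <# K" using K.coset_eq G(2)[OF i] by auto
    then have "inv (hs ! i) \<otimes> gs ! i \<in> K"
      using G[OF i] K.subset by (auto simp: l_coset_def G.m_assoc[symmetric])
    then show ?thesis using G[OF i] assms(3,4) i by (simp add: ks_def G.m_assoc[symmetric])
  qed
  have len: "length ks = n" using assms(3,4) by (simp add: ks_def)
  have ksK: "ks \<in> lists K" using ks len by (auto simp: in_lists_conv_set in_set_conv_nth)
  then have ksG: "ks \<in> lists (carrier G)" using K.subset by (auto simp: in_lists_conv_set)
  have gs: "map2 (\<otimes>) hs ks = gs"
    using ks len assms(3,4) by (intro nth_equalityI) auto
  have T: "mor n n (Tup hs)" "mor n n (Tup ks)" using assms ksG len by (auto intro: mor_Tup)
  note I = mor_Id[OF assms(5)]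
  have "eq n n (Tup gs) (Cmp (Tup hs) (Tup ks))"
    using tw_sym[OF tw_Tup_Cmp[OF assms(2) ksG assms(4) len assms(5)]] gs by simp
  also have "eq n n \<dots> (Cmp (Tup hs) (Cmp (Tup ks) (Id n)))"
    by (rule eq_Cmp_right[OF tw_sym[OF tw_id_right[OF T(2)]] T(1)])
  finally have "keq n n (Tup gs) (Cmp (Tup hs) (Cmp (Tup ks) (Id n)))" by (rule kernel_eq)
  also have "keq n n \<dots> (Cmp (Tup hs) (Id n))"
    by (rule kernel_Tup[OF T(1) I ksK len])
  also have "keq n n \<dots> (Tup hs)"
    by (rule kernel_eq[OF tw_id_right[OF T(1)]])
  finally show ?thesis .
qed

text \<open>An inserted tuple becomes a left factor from \<open>N\<close> after conjugation by
  \<open>base a\<close>. This is possible although \<open>a\<close> may join different objects,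
  since \<open>base a\<close> is an element of the group at 1.\<close>

lemma keq_base:
  assumes "keq m n e e'" "group SVG" "N \<lhd> SVG"
    and "\<And>ks. ks \<in> lists K \<Longrightarrow> ks \<noteq> [] \<Longrightarrow> base (Tup ks) \<in> N"
  shows "N #>\<^bsub>SVG\<^esub> base e = N #>\<^bsub>SVG\<^esub> base e'"
  using assms(1)
proof (induction rule: kernel_eq.induct)
  case (kernel_eq m n e e')
  then show ?case by (simp add: base_eq)
next
  case (kernel_Tup r n a m b ks)
  interpret \<Gamma>: group SVG by fact
  interpret N: normal N SVG by fact
  have r: "1 \<le> r" using kernel_Tup mor_pos by blast
  then have "ks \<noteq> []" using kernel_Tup by auto
  then have ks: "base (Tup ks) \<in> N" using kernel_Tup(3) assms(4) by blast
  note T = mor_Tup_K[OF kernel_Tup(3,4) r]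
  note closed = base_closed[OF kernel_Tup(1)] base_closed[OF kernel_Tup(2)] base_closed[OF T]
  have "base (Cmp a (Cmp (Tup ks) b)) = base a \<otimes>\<^bsub>SVG\<^esub> base (Tup ks) \<otimes>\<^bsub>SVG\<^esub> base b"
    using closed base_Cmp[OF kernel_Tup(1) mor_Cmp[OF T kernel_Tup(2)]] base_Cmp[OF T kernel_Tup(2)]
    by (simp add: \<Gamma>.m_assoc)
  also have "\<dots> = (base a \<otimes>\<^bsub>SVG\<^esub> base (Tup ks) \<otimes>\<^bsub>SVG\<^esub> inv\<^bsub>SVG\<^esub> base a) \<otimes>\<^bsub>SVG\<^esub> base (Cmp a b)"
    using closed base_Cmp[OF kernel_Tup(1,2)] \<Gamma>.m_assoc[of "inv\<^bsub>SVG\<^esub> base a" "base a" "base b"]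
    by (simp add: \<Gamma>.m_assoc)
  finally have "base (Cmp a (Cmp (Tup ks) b)) =
      (base a \<otimes>\<^bsub>SVG\<^esub> base (Tup ks) \<otimes>\<^bsub>SVG\<^esub> inv\<^bsub>SVG\<^esub> base a) \<otimes>\<^bsub>SVG\<^esub> base (Cmp a b)" .
  moreover have "base a \<otimes>\<^bsub>SVG\<^esub> base (Tup ks) \<otimes>\<^bsub>SVG\<^esub> inv\<^bsub>SVG\<^esub> base a \<in> N"
    by (rule N.inv_op_closed2[OF closed(1) ks])
  ultimately show ?case
    using \<Gamma>.coset_mult_assoc[OF N.subset, of "base a \<otimes>\<^bsub>SVG\<^esub> base (Tup ks) \<otimes>\<^bsub>SVG\<^esub> inv\<^bsub>SVG\<^esub> base a"
        "base (Cmp a b)"] base_closed[OF mor_Cmp[OF kernel_Tup(1,2)]] closed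
    by (simp add: \<Gamma>.coset_join2 N.is_subgroup)
qed auto

end

end

section \<open>Change of the coefficient group\<close>

lemma tw_mor_map:
  assumes "tw_mor G S m n e" "h \<in> carrier G \<rightarrow> carrier H"
  shows "tw_mor H S m n (map_tw_expr h e)"
  using assms(1)
proof (induction rule: tw_mor.induct)
  case (mor_Tup gs n)
  then have "map h gs \<in> lists (carrier H)" using assms(2) by (auto simp: in_lists_conv_set)
  with mor_Tup show ?case by (simp add: tw_mor.mor_Tup)
qed (auto intro: tw_mor.intros)

text \<open>The Brin--Thompson part is left alone and tuples are mapped entrywise. The action enters
  through the split rule alone, where \<open>\<psi> (h g)\<close> and \<open>\<phi> g\<close> must
  name the same coordinate.\<close>

lemma tw_eq_map:
  assumes "tw_eq G S \<phi> m n e e'" and h: "h \<in> hom G H" and h1: "h \<one>\<^bsub>G\<^esub> = \<one>\<^bsub>H\<^esub>"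
    and \<psi>: "\<And>g s. g \<in> carrier G \<Longrightarrow> s \<in> S \<Longrightarrow> \<psi> (h g) s = \<phi> g s"
  shows "tw_eq H S \<psi> m n (map_tw_expr h e) (map_tw_expr h e')"
proof -
  have car: "h \<in> carrier G \<rightarrow> carrier H" using h by (auto simp: hom_def)
  have lists: "map h gs \<in> lists (carrier H)" if "gs \<in> lists (carrier G)" for gs
    using that car by (auto simp: in_lists_conv_set)
  note mor = tw_mor_map[OF _ car, of S]
  show ?thesis using assms(1)
  proof (induction rule: tw_eq.induct)
    case (tw_trans m n e e' e'')
    show ?case by (rule tw_eq.tw_trans[OF tw_trans.IH])
  next
    case (tw_Tup_one n)
    then show ?case using tw_eq.tw_Tup_one[of n H S \<psi>] by (simp add: h1)
  next
    case (tw_Tup_Cmp gs hs n)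
    have "map h (map2 (\<otimes>\<^bsub>G\<^esub>) gs hs) = map2 (\<otimes>\<^bsub>H\<^esub>) (map h gs) (map h hs)"
      using tw_Tup_Cmp h by (intro nth_equalityI) (auto simp: in_lists_conv_set hom_def)
    then show ?case
      using tw_eq.tw_Tup_Cmp[OF lists lists, of gs hs n S \<psi>] tw_Tup_Cmp by simp
  next
    case (tw_Tup_DSum gs hs n n')
    then show ?case
      using tw_eq.tw_Tup_DSum[OF lists lists, of gs hs n n' S \<psi>] by simp
  next
    case (tw_split g s)
    then have "h g \<in> carrier H" using car by auto
    from tw_eq.tw_split[OF this tw_split(2), of \<psi>] show ?case using tw_split by (simp add: \<psi>)
  next
    case (tw_perm gs n \<sigma>)
    have "map (\<lambda>i. map h gs ! \<sigma> i) [0..<n] = map h (map (\<lambda>i. gs ! \<sigma> i) [0..<n])"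
      using tw_perm permutes_in_image[OF tw_perm(4)] by auto
    then show ?case
      using tw_eq.tw_perm[OF lists _ tw_perm(3,4), of gs S \<psi>] tw_perm by (simp del: map_map)
  qed (auto intro: tw_eq.intros mor)
qed

context nonempty_twisted_groupoid
begin

abbreviation K :: "'g set" where
  "K \<equiv> action_kernel G S \<phi>"

lemma normal_K: "K \<lhd> G"
  unfolding action_kernel_def using group_hom by (rule group_hom.normal_kernel)

interpretation K: normal K G by (rule normal_K)

lemma induced_action_coset:
  assumes "g \<in> carrier G"
  shows "induced_action \<phi> (K #> g) = \<phi> g"
proof -
  interpret h: group_hom G "BijGroup S" \<phi> by (rule group_hom)
  have "\<phi> (k \<otimes> g) = \<phi> g" if "k \<in> K" for k
  proof -
    have k: "k \<in> carrier G" "\<phi> k = \<one>\<^bsub>BijGroup S\<^esub>"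
      using that unfolding action_kernel_def kernel_def by blast+
    have "\<phi> (k \<otimes> g) = \<phi> k \<otimes>\<^bsub>BijGroup S\<^esub> \<phi> g" by (rule h.hom_mult[OF k(1) assms])
    then show ?thesis unfolding k(2) using h.H.l_one[OF h.hom_closed[OF assms]] by (rule trans)
  qed
  moreover have "\<one> \<in> K" by (rule K.one_closed)
  ultimately have "\<phi> ` (K #> g) = {\<phi> g}" unfolding r_coset_def using assms by (auto simp del: id_eq_one intro!: image_eqI[of _ _ "\<one> \<otimes> g"])
  then show ?thesis unfolding induced_action_def by simp
qed

interpretation Q: nonempty_twisted_groupoid "G Mod K" S "induced_action \<phi>"
proof (intro nonempty_twisted_groupoid.intro twisted_groupoid.intro
    nonempty_twisted_groupoid_axioms.intro S_nonempty)
  show "group_action (G Mod K) S (induced_action \<phi>)"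
    using induced_action_faithful[OF group_action_axioms] by (rule faithful_action.axioms)
qed

section \<open>Projection to the quotient and lifting by coset representatives\<close>

definition proj :: "('g, 's) tw_expr \<Rightarrow> ('g set, 's) tw_expr" where
  "proj = map_tw_expr (\<lambda>g. K #> g)"

definition coset_rep :: "'g set \<Rightarrow> 'g" where
  "coset_rep A = (SOME g. g \<in> A)"

definition lift :: "('g set, 's) tw_expr \<Rightarrow> ('g, 's) tw_expr" where
  "lift = map_tw_expr coset_rep"

lemma coset_rep:
  assumes "A \<in> carrier (G Mod K)"
  shows "coset_rep A \<in> carrier G" "K #> coset_rep A = A"
proof -
  obtain g where g: "g \<in> carrier G" "A = K #> g" using assms by (auto simp: FactGroup_def RCOSETS_def)
  then have "coset_rep A \<in> A"
    unfolding coset_rep_def using G.rcos_self[OF g(1) K.is_subgroup] by (metis someI)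
  then have "coset_rep A \<in> K #> g" using g(2) by simp
  then show "coset_rep A \<in> carrier G" "K #> coset_rep A = A"
    using g(2) G.repr_independence[OF _ g(1) K.is_subgroup]
      subsetD[OF G.r_coset_subset_G[OF K.subset g(1)]] by auto
qed

lemma coset_hom: "(\<lambda>g. K #> g) \<in> hom G (G Mod K)"
  by (rule K.r_coset_hom_Mod)

lemma coset_closed: "g \<in> carrier G \<Longrightarrow> K #> g \<in> carrier (G Mod K)"
  using coset_hom by (auto simp: hom_def)

lemma coset_one: "K #> \<one> = \<one>\<^bsub>G Mod K\<^esub>"
  using K.subset by (simp add: G.coset_mult_one)

lemma coset_mult: "g \<in> carrier G \<Longrightarrow> h \<in> carrier G \<Longrightarrow> K #> (g \<otimes> h) = (K #> g) \<otimes>\<^bsub>G Mod K\<^esub> (K #> h)"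
  using coset_hom by (auto simp: hom_def)

lemma proj_mor: "mor m n e \<Longrightarrow> Q.mor m n (proj e)"
  unfolding proj_def by (rule tw_mor_map) (use coset_closed in auto)

lemma proj_eq: "eq m n e e' \<Longrightarrow> Q.eq m n (proj e) (proj e')"
  unfolding proj_def
  by (rule tw_eq_map[OF _ coset_hom coset_one]) (simp_all add: induced_action_coset)

lemma lift_mor: "Q.mor m n e \<Longrightarrow> mor m n (lift e)"
  unfolding lift_def by (rule tw_mor_map) (use coset_rep in auto)

lemma proj_lift: "Q.mor m n e \<Longrightarrow> proj (lift e) = e"
proof (induction rule: tw_mor.induct)
  case (mor_Tup gs n)
  then show ?case using coset_rep
    by (auto simp: proj_def lift_def in_lists_conv_set intro!: map_idI)
qed (auto simp: proj_def lift_def)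

lemma lift_lists: "As \<in> lists (carrier (G Mod K)) \<Longrightarrow> map coset_rep As \<in> lists (carrier G)"
  using coset_rep by (auto simp: in_lists_conv_set)

text \<open>Since \<open>coset_rep\<close> is not a homomorphism, the lifted rules for the identity
  tuple and for products of tuples hold only entrywise modulo \<open>K\<close>, which
  \<open>keq_Tup\<close> repairs. The remaining basic rules lift verbatim.\<close>

lemma lift_keq:
  assumes "Q.eq m n e e'"
  shows "kernel_eq G S \<phi> K m n (lift e) (lift e')"
  using assms
proof (induction rule: tw_eq.induct)
  case (tw_refl m n e)
  then show ?case by (intro kernel_eq tw_eq.tw_refl lift_mor)
next
  case (tw_sym m n e e')
  show ?case by (rule kernel_sym[OF tw_sym.IH])
next
  case (tw_trans m n e e' e'')
  show ?case by (rule kernel_trans[OF tw_trans.IH])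
next
  case (tw_Cmp n p a a' m b b')
  show ?case using keq_Cmp[OF normal_K tw_Cmp.IH] by (simp add: lift_def)
next
  case (tw_DSum m n a a' m' n' b b')
  show ?case using keq_DSum[OF normal_K tw_DSum.IH] by (simp add: lift_def)
next
  case (tw_Cmp_assoc p q a n b m c)
  show ?case using kernel_eq[OF tw_eq.tw_Cmp_assoc[OF tw_Cmp_assoc[THEN lift_mor]]] by (simp add: lift_def)
next
  case (tw_id_left m n e)
  show ?case using kernel_eq[OF tw_eq.tw_id_left[OF lift_mor[OF tw_id_left]]] by (simp add: lift_def)
next
  case (tw_id_right m n e)
  show ?case using kernel_eq[OF tw_eq.tw_id_right[OF lift_mor[OF tw_id_right]]] by (simp add: lift_def)
next
  case (tw_DSum_assoc m n a m' n' b m'' n'' c)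
  show ?case using kernel_eq[OF tw_eq.tw_DSum_assoc[OF tw_DSum_assoc[THEN lift_mor]]] by (simp add: lift_def)
next
  case (tw_interchange n p a m b n' p' a' m' b')
  show ?case using kernel_eq[OF tw_eq.tw_interchange[OF tw_interchange[THEN lift_mor]]] by (simp add: lift_def)
next
  case (tw_BT_Cmp m n p f f')
  show ?case using kernel_eq[OF tw_eq.tw_BT_Cmp[OF tw_BT_Cmp]] by (simp add: lift_def)
next
  case (tw_BT_DSum m n m' n' f f')
  show ?case using kernel_eq[OF tw_eq.tw_BT_DSum[OF tw_BT_DSum]] by (simp add: lift_def)
next
  case (tw_Tup_one n)
  have "kernel_eq G S \<phi> K n n (Tup (replicate n (coset_rep \<one>\<^bsub>G Mod K\<^esub>))) (Tup (replicate n \<one>))"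
    using coset_rep[OF Q.G.one_closed] coset_one tw_Tup_one
    by (intro keq_Tup[OF normal_K]) (auto simp: in_lists_conv_set)
  from kernel_trans[OF this kernel_eq[OF Tup_ones[OF tw_Tup_one]]] show ?case
    by (simp add: lift_def)
next
  case (tw_Tup_Cmp As Bs n)
  note l = lift_lists[OF tw_Tup_Cmp(1)] lift_lists[OF tw_Tup_Cmp(2)]
  have AB: "As ! i \<in> carrier (G Mod K)" "Bs ! i \<in> carrier (G Mod K)" if "i < n" for i
    using tw_Tup_Cmp that by (auto simp: in_lists_conv_set)
  have "kernel_eq G S \<phi> K n n (Tup (map2 (\<otimes>) (map coset_rep As) (map coset_rep Bs)))
      (Tup (map coset_rep (map2 (\<otimes>\<^bsub>G Mod K\<^esub>) As Bs)))"
  proof (rule keq_Tup[OF normal_K])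
    show "map2 (\<otimes>) (map coset_rep As) (map coset_rep Bs) \<in> lists (carrier G)"
      using AB coset_rep(1) tw_Tup_Cmp(3,4) by (auto simp: in_lists_conv_set in_set_conv_nth)
    show "map coset_rep (map2 (\<otimes>\<^bsub>G Mod K\<^esub>) As Bs) \<in> lists (carrier G)"
      using AB tw_Tup_Cmp(3,4) by (intro lift_lists) (auto simp del: mult_FactGroup simp: in_lists_conv_set in_set_conv_nth)
    fix i assume i: "i < n"
    show "K #> map2 (\<otimes>) (map coset_rep As) (map coset_rep Bs) ! i
        = K #> map coset_rep (map2 (\<otimes>\<^bsub>G Mod K\<^esub>) As Bs) ! i"
      using i AB[OF i] tw_Tup_Cmp(3,4) coset_rep
      by (simp del: mult_FactGroup add: coset_mult)
  qed (use tw_Tup_Cmp in auto)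
  from kernel_trans[OF kernel_eq[OF tw_eq.tw_Tup_Cmp[OF l _ _ tw_Tup_Cmp(5)]] this]
  show ?case using tw_Tup_Cmp by (simp add: lift_def)
next
  case (tw_Tup_DSum As Bs n n')
  show ?case
    using kernel_eq[OF tw_eq.tw_Tup_DSum[OF tw_Tup_DSum(1,2)[THEN lift_lists] _ _ tw_Tup_DSum(5,6)]]
      tw_Tup_DSum(3,4) by (simp add: lift_def)
next
  case (tw_split A s)
  note r = coset_rep[OF tw_split(1)]
  \<comment> \<open>The representative permutes \<open>S\<close> exactly as its coset does, so both
    splits keep their coordinates under lifting.\<close>
  have "induced_action \<phi> A = \<phi> (coset_rep A)" using induced_action_coset[OF r(1)] r(2) by simp
  then show ?case using kernel_eq[OF tw_eq.tw_split[OF r(1) tw_split(2)]] by (simp add: lift_def)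
next
  case (tw_perm As n \<sigma>)
  have "map (\<lambda>i. map coset_rep As ! \<sigma> i) [0..<n] = map coset_rep (map (\<lambda>i. As ! \<sigma> i) [0..<n])"
    using tw_perm permutes_in_image[OF tw_perm(4)] by auto
  then show ?case
    using kernel_eq[OF tw_eq.tw_perm[OF lift_lists[OF tw_perm(1)] _ tw_perm(3,4)]] tw_perm(2)
    by (simp add: lift_def del: map_map)
qed

lemma lift_proj_keq: "mor m n e \<Longrightarrow> kernel_eq G S \<phi> K m n e (lift (proj e))"
proof (induction rule: tw_mor.induct)
  case (mor_BT m n f)
  then show ?case by (auto simp: lift_def proj_def intro!: kernel_eq tw_refl tw_mor.mor_BT)
next
  case (mor_Tup gs n)
  then have g: "gs ! i \<in> carrier G" if "i < n" for i using that by (auto simp: in_lists_conv_set)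
  have "kernel_eq G S \<phi> K n n (Tup gs) (Tup (map coset_rep (map (\<lambda>g. K #> g) gs)))"
  proof (rule keq_Tup[OF normal_K mor_Tup(1)])
    show "map coset_rep (map (\<lambda>g. K #> g) gs) \<in> lists (carrier G)"
      using mor_Tup(1) coset_closed by (intro lift_lists) (auto simp: in_lists_conv_set)
  qed (use mor_Tup g coset_rep coset_closed in auto)
  then show ?case by (simp add: lift_def proj_def)
next
  case (mor_Cmp n p e m e')
  show ?case using keq_Cmp[OF normal_K mor_Cmp.IH] by (simp add: lift_def proj_def)
next
  case (mor_DSum m n e m' n' e')
  show ?case using keq_DSum[OF normal_K mor_DSum.IH] by (simp add: lift_def proj_def)
qed

section \<open>The quotient homomorphism and its kernel\<close>

definition quot :: "('g, 's) tw_expr set \<Rightarrow> ('g set, 's) tw_expr set" where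
  "quot A = Q.cls (proj (rep A))"

lemma quot_cls:
  assumes "mor 1 1 e"
  shows "quot (cls e) = Q.cls (proj e)"
proof -
  note c = cls_closed[OF assms]
  have "eq 1 1 (rep (cls e)) e"
    using cls_eq_iff[OF mor_rep[OF c], THEN iffD1, OF cls_rep[OF c]] .
  then show ?thesis unfolding quot_def by (intro Q.cls_eqI proj_eq)
qed

lemma proj_Id: "proj (Id n) = Q.Id n"
  by (simp add: proj_def)

lemma quot_hom: "quot \<in> hom SVG Q.SVG"
proof (rule homI)
  fix A assume "A \<in> carrier SVG"
  then show "quot A \<in> carrier Q.SVG"
    unfolding quot_def by (intro Q.cls_closed proj_mor mor_rep)
next
  fix A B assume "A \<in> carrier SVG" "B \<in> carrier SVG"
  then obtain a b where ab: "A = cls a" "B = cls b" "mor 1 1 a" "mor 1 1 b"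
    by (auto simp: carrier_SVG)
  then show "quot (A \<otimes>\<^bsub>SVG\<^esub> B) = quot A \<otimes>\<^bsub>Q.SVG\<^esub> quot B"
    using quot_cls[OF mor_Cmp[OF ab(3,4)]] Q.cls_mult[OF ab(3,4)[THEN proj_mor]]
    by (simp add: cls_mult quot_cls) (simp add: proj_def)
qed

lemma quot_surj: "quot ` carrier SVG = carrier Q.SVG"
proof
  show "quot ` carrier SVG \<subseteq> carrier Q.SVG" using quot_hom by (auto simp: hom_def)
  show "carrier Q.SVG \<subseteq> quot ` carrier SVG"
  proof
    fix A assume "A \<in> carrier Q.SVG"
    then obtain e where e: "A = Q.cls e" "Q.mor 1 1 e" by (auto simp: Q.carrier_SVG)
    then have "quot (cls (lift e)) = A" using quot_cls[OF lift_mor] proj_lift by simp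
    then show "A \<in> quot ` carrier SVG" using cls_closed[OF lift_mor[OF e(2)]] by blast
  qed
qed

text \<open>The target is so far known to be a monoid; its inverses are images of inverses, by
  surjectivity.\<close>

lemma quot_group_hom:
  assumes "group SVG"
  shows "group_hom SVG Q.SVG quot"
proof -
  interpret \<Gamma>: group SVG by fact
  have one: "quot \<one>\<^bsub>SVG\<^esub> = \<one>\<^bsub>Q.SVG\<^esub>"
    using quot_cls[OF mor_Id] by (simp add: one_SVG Q.one_SVG proj_Id)
  have "group Q.SVG"
  proof (rule monoid.group_l_invI[OF Q.monoid_SVG])
    fix A assume "A \<in> carrier Q.SVG"
    then obtain B where B: "B \<in> carrier SVG" "A = quot B" using quot_surj by blast
    then have "quot (inv\<^bsub>SVG\<^esub> B) \<otimes>\<^bsub>Q.SVG\<^esub> A = \<one>\<^bsub>Q.SVG\<^esub>"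
      using quot_hom one by (metis \<Gamma>.inv_closed \<Gamma>.l_inv hom_mult)
    then show "\<exists>y\<in>carrier Q.SVG. y \<otimes>\<^bsub>Q.SVG\<^esub> A = \<one>\<^bsub>Q.SVG\<^esub>"
      using B quot_surj \<Gamma>.inv_closed by blast
  qed
  then show ?thesis
    using assms quot_hom by (simp add: group_hom_def group_hom_axioms_def)
qed

text \<open>The projection turns \<open>ks\<close> into a tuple of ones, after which the projected
  \<open>fan\<close> and \<open>gather\<close> cancel. They are projected from \<open>G\<close>
  rather than chosen anew over the quotient, so no two choices have to be compared.\<close>

lemma base_Tup_in_kernel:
  assumes "ks \<in> lists K" "ks \<noteq> []"
  shows "base (Tup ks) \<in> kernel SVG Q.SVG quot"
proof -
  have r: "1 \<le> length ks" using assms(2) by (cases ks) auto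
  have T: "mor (length ks) (length ks) (Tup ks)" using assms(1) r by (intro mor_Tup_K[OF normal_K]) auto
  let ?r = "length ks" and ?x = "fan (length ks)" and ?y = "gather (length ks)"
  have x: "mor 1 ?r ?x" "mor ?r 1 ?y" "eq 1 1 (Cmp ?y ?x) (Id 1)"
    using is_iso_fan[OF r] by (auto simp: is_iso_def)
  have "map (\<lambda>k. K #> k) ks = map (\<lambda>_. \<one>\<^bsub>G Mod K\<^esub>) ks"
    using assms(1) G.coset_join2[OF _ K.is_subgroup] K.subset by (auto simp: in_lists_conv_set)
  then have "proj (Tup ks) = Tup (replicate ?r \<one>\<^bsub>G Mod K\<^esub>)"
    by (simp add: proj_def map_replicate_const)
  then have "Q.eq ?r ?r (proj (Tup ks)) (Q.Id ?r)" using Q.Tup_ones[OF r] by simp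
  note e = Q.eq_Cmp_left[OF this proj_mor[OF x(1)]]
  have "Q.eq 1 1 (Cmp (proj ?y) (Cmp (proj (Tup ks)) (proj ?x))) (Cmp (proj ?y) (Cmp (Q.Id ?r) (proj ?x)))"
    by (rule Q.eq_Cmp_right[OF e proj_mor[OF x(2)]])
  also have "Q.eq 1 1 \<dots> (Cmp (proj ?y) (proj ?x))"
    by (rule Q.eq_Cmp_right[OF tw_id_left[OF proj_mor[OF x(1)]] proj_mor[OF x(2)]])
  also have "Q.eq 1 1 \<dots> (Q.Id 1)"
    using proj_eq[OF x(3)] by (simp add: proj_def)
  finally have "Q.eq 1 1 (proj (Cmp ?y (Cmp (Tup ks) ?x))) (Q.Id 1)" by (simp add: proj_def)
  then have "quot (base (Tup ks)) = \<one>\<^bsub>Q.SVG\<^esub>"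
    using quot_cls[OF mor_base[OF T]] base_mor[OF T] Q.cls_eqI by (simp add: Q.one_SVG)
  then show ?thesis using base_closed[OF T] by (simp add: kernel_def)
qed

text \<open>An element of the kernel is trivial after projection; lifting back makes it trivial up
  to inserted tuples over \<open>K\<close>, and \<open>base\<close> converts these insertions into
  factors from \<open>N\<close>.\<close>

lemma kernel_quot_subset:
  assumes "group SVG" "N \<lhd> SVG" "\<And>ks. ks \<in> lists K \<Longrightarrow> ks \<noteq> [] \<Longrightarrow> base (Tup ks) \<in> N"
  shows "kernel SVG Q.SVG quot \<subseteq> N"
proof
  interpret \<Gamma>: group SVG by fact
  interpret N: normal N SVG by fact
  fix A assume A: "A \<in> kernel SVG Q.SVG quot"
  then obtain e where e: "A = cls e" "mor 1 1 e" by (auto simp: kernel_def carrier_SVG)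
  then have "Q.cls (proj e) = Q.cls (Q.Id 1)"
    using A quot_cls by (simp add: kernel_def Q.one_SVG)
  then have "Q.eq 1 1 (proj e) (Q.Id 1)" using Q.cls_eq_iff[OF proj_mor[OF e(2)]] by blast
  then have "kernel_eq G S \<phi> K 1 1 (lift (proj e)) (Id 1)" using lift_keq by (fastforce simp: lift_def)
  then have "kernel_eq G S \<phi> K 1 1 e (Id 1)" by (rule kernel_trans[OF lift_proj_keq[OF e(2)]])
  then have "N #>\<^bsub>SVG\<^esub> base e = N #>\<^bsub>SVG\<^esub> base (Id 1)"
    by (rule keq_base[OF normal_K _ assms])
  then have "N #>\<^bsub>SVG\<^esub> A = N"
    using e N.subset by (simp add: base_one base_Id \<Gamma>.coset_mult_one)
  then show "A \<in> N"
    using e cls_closed \<Gamma>.rcos_self[OF _ N.is_subgroup] by metis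
qed

lemma finitely_presented_SVG_quotient:
  assumes "finitely_presented SVG" "finitely_presented (G Mod K)"
  shows "finitely_presented Q.SVG"
proof -
  have grp: "group SVG" by (rule group_SVG[OF assms(1)])
  \<comment> \<open>The first direction, applied to \<open>G\<close> itself, supplies the finite
    generating set needed for normal generation of \<open>K\<close>.\<close>
  obtain X :: "nat set" and R f where X: "finite X" "finite R" "presents G X R f"
    using finitely_presentedE[OF G.is_group finitely_presented_of_SVG[OF assms(1)]] .
  have f: "f \<in> X \<rightarrow> carrier G" "carrier G \<subseteq> word_eval G f ` words X"
    using X(3) by (simp_all add: presents_def)
  obtain T where T: "finite T" "T \<subseteq> K" "\<And>M. M \<lhd> G \<Longrightarrow> T \<subseteq> M \<Longrightarrow> K \<subseteq> M"
  proof (rule finite_normal_generators[OF G.is_group normal_K assms(2) X(1) f])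
    fix T assume "finite T" "T \<subseteq> K" "\<And>M. M \<lhd> G \<Longrightarrow> T \<subseteq> M \<Longrightarrow> K \<subseteq> M"
    then show thesis by (rule that)
  qed
  \<comment> \<open>Each of the two trivial blocks has length 0 or 1, which gives four tuples for
    every element of \<open>T\<close>.\<close>
  define T' where "T' = (\<lambda>(p, q, k). base (Tup (unit_tup p q k))) ` ({..1} \<times> {..1} \<times> T)"
  show ?thesis
  proof (rule finitely_presented_quotient[OF quot_group_hom[OF grp] quot_surj assms(1)])
    show "finite T'" using T(1) by (simp add: T'_def)
    show "T' \<subseteq> kernel SVG Q.SVG quot"
    proof -
      have "unit_tup p q k \<in> lists K" "unit_tup p q k \<noteq> []" if "k \<in> T" for p q k
        using that T(2) K.one_closed by (auto simp: unit_tup_def in_lists_conv_set)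
      then show ?thesis using base_Tup_in_kernel by (auto simp: T'_def)
    qed
    fix N assume N: "N \<lhd> SVG" "T' \<subseteq> N"
    have T'N: "base (Tup (unit_tup p q k)) \<in> N" if "p \<le> 1" "q \<le> 1" "k \<in> T" for p q k
    proof -
      have "base (Tup (unit_tup p q k)) \<in> T'"
        unfolding T'_def using that by (intro image_eqI[of _ _ "(p, q, k)"]) simp_all
      then show ?thesis using N(2) by blast
    qed
    have TG: "T \<subseteq> carrier G" using T(2) K.subset by blast
    show "kernel SVG Q.SVG quot \<subseteq> N"
    proof (rule kernel_quot_subset[OF grp N(1)])
      fix ks assume ks: "ks \<in> lists K" "ks \<noteq> []"
      show "base (Tup ks) \<in> N"
        by (rule base_Tup_in_normal[OF grp N(1) T(3) TG K.subset T'N ks])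
    qed
  qed
qed

lemma finitely_presented_SVG_quotient_iff:
  assumes "finitely_presented SVG"
  shows "finitely_presented Q.SVG \<longleftrightarrow> finitely_presented (G Mod K)"
  using finitely_presented_SVG_quotient[OF assms] Q.finitely_presented_of_SVG by blast

end

theorem corollary4p2:
  fixes G :: "('g, 'b) monoid_scheme" and S :: "'s set" and \<phi> :: "'g \<Rightarrow> 's \<Rightarrow> 's"
    and K :: "'g set"
  assumes "group_action G S \<phi>"
    and "S \<noteq> {}"
    and "K = action_kernel G S \<phi>"
    and "finitely_presented (twisted_BT_group G S \<phi>)"
  shows "finitely_presented (twisted_BT_group (G Mod K) S (induced_action \<phi>)) \<longleftrightarrow>
    finitely_presented (G Mod K)"
proof -
  interpret nonempty_twisted_groupoid G S \<phi>
    using assms(1,2) by (intro nonempty_twisted_groupoid.intro twisted_groupoid.intro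
        nonempty_twisted_groupoid_axioms.intro)
  show ?thesis
    unfolding assms(3) by (rule finitely_presented_SVG_quotient_iff[OF assms(4)])
qed

end
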